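(* Let $R$ be a principal ideal domain, let $L$ be a free $R$-module of rank $f\ge 1$, and let $M\subsetneq L$ be a proper submodule that is also free of rank $f$, with basis $\{u_1,\dots,u_f\}$. Let $g_1\mid\cdots\mid g_s$ be the invariant factors of $L/M$, i.e. $g_1$ is not a unit, $g_s\neq 0$, and $L/M\cong R/Rg_1\oplus\cdots\oplus R/Rg_s$. Then: (i) There exist $v\in L$ and $a_1,\dots,a_f\in R$ such that $g_sv=a_1u_1+\cdots+a_fu_f$ and $hv\notin M$ for every proper factor $h$ of $g_s$. (ii) For any such $v$ and $a_1,\dots,a_f$, the submodule $P=Rv+M$ of $L$ satisfies $$P/M\cong R/Rg_s\quad\text{and}\quad L/P\cong R/Rg_1\oplus\cdots\oplus R/Rg_{s-1}.$$ (iii) For any such $v$ and $a_1,\dots,a_f$, set $u_{f+1}=v$ and $a_{f+1}=-g_s$. Then $\gcd(a_1,\dots,a_{f+1})=1$, there exists $Q\in\mathrm{GL}_{f+1}(R)$ such that $(a_1,\dots,a_{f+1})Q=(1,0,\dots,0)$, and for any such $Q$, if $(v_1,\dots,v_{f+1})^{T}=Q^{-1}(u_1,\dots,u_{f+1})^{T}$ (the product of a matrix over $R$ with a column of vectors of $L$), then $v_1=0$ and $\{v_2,\dots,v_{f+1}\}$ is an $R$-basis of $P=Rv+M$.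
   Context: A proper factor of $g_s$ is a divisor $h$ of $g_s$ in $R$ that is not an associate of $g_s$. When $s=1$ the empty direct sum in (ii) is zero, i.e. $P=L$. *)

theory Defs
  imports "HOL-Algebra.Ring_Divisibility" "HOL-Algebra.Module"
begin

text \<open>
  Finite families are functions on \<open>nat\<close> together with an explicit index set. In the module
  records below the fields \<open>mult\<close> and \<open>one\<close>, which the record type inherits from rings, play no
  role and are left \<open>undefined\<close>; the module axioms do not mention them.
\<close>

subsection \<open>Module isomorphisms, quotients and direct sums\<close>

definition module_hom ::
    "('a, 'm) ring_scheme \<Rightarrow> ('a, 'b, 'n) module_scheme \<Rightarrow> ('a, 'c, 'k) module_scheme \<Rightarrow> ('b \<Rightarrow> 'c) set"
  where "module_hom R M N =
    {h \<in> carrier M \<rightarrow> carrier N.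
       (\<forall>x\<in>carrier M. \<forall>y\<in>carrier M. h (x \<oplus>\<^bsub>M\<^esub> y) = h x \<oplus>\<^bsub>N\<^esub> h y) \<and>
       (\<forall>r\<in>carrier R. \<forall>x\<in>carrier M. h (r \<odot>\<^bsub>M\<^esub> x) = r \<odot>\<^bsub>N\<^esub> h x)}"

definition module_isomorphic ::
    "('a, 'm) ring_scheme \<Rightarrow> ('a, 'b, 'n) module_scheme \<Rightarrow> ('a, 'c, 'k) module_scheme \<Rightarrow> bool"
  where "module_isomorphic R M N \<longleftrightarrow>
    (\<exists>h\<in>module_hom R M N. bij_betw h (carrier M) (carrier N))"

definition self_module :: "('a, 'm) ring_scheme \<Rightarrow> ('a, 'a) module"
  where "self_module R =
    \<lparr>carrier = carrier R, mult = undefined, one = undefined, zero = \<zero>\<^bsub>R\<^esub>, add = add R,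
     smult = mult R\<rparr>"

text \<open>
  As with \<^const>\<open>rcoset_mult\<close>, the scalar action is written as a union over representatives;
  for a submodule \<open>K\<close> it sends the coset of \<open>x\<close> to the coset of \<open>r \<odot> x\<close>.
\<close>

definition quotient_module :: "('a, 'b, 'n) module_scheme \<Rightarrow> 'b set \<Rightarrow> ('a, 'b set) module"
  where "quotient_module N K =
    \<lparr>carrier = a_rcosets\<^bsub>N\<^esub> K, mult = undefined, one = undefined, zero = K, add = set_add N,
     smult = (\<lambda>r X. \<Union>x\<in>X. K +>\<^bsub>N\<^esub> (r \<odot>\<^bsub>N\<^esub> x))\<rparr>"

text \<open>
  The index sets are always finite, so the direct sum is the direct product. The elements are
  extensional functions; hence over the empty index set there is exactly one element.
\<close>

definition finite_direct_sum ::
    "'i set \<Rightarrow> ('i \<Rightarrow> ('a, 'b, 'n) module_scheme) \<Rightarrow> ('a, 'i \<Rightarrow> 'b) module"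
  where "finite_direct_sum I N =
    \<lparr>carrier = (\<Pi>\<^sub>E i\<in>I. carrier (N i)), mult = undefined, one = undefined,
     zero = (\<lambda>i\<in>I. \<zero>\<^bsub>N i\<^esub>),
     add = (\<lambda>x y. \<lambda>i\<in>I. x i \<oplus>\<^bsub>N i\<^esub> y i),
     smult = (\<lambda>r x. \<lambda>i\<in>I. r \<odot>\<^bsub>N i\<^esub> x i)\<rparr>"

definition cyclic_module :: "('a, 'm) ring_scheme \<Rightarrow> 'a \<Rightarrow> ('a, 'a set) module"
  where "cyclic_module R d = quotient_module (self_module R) (PIdl\<^bsub>R\<^esub> d)"

abbreviation restrict_module ::
    "('a, 'b, 'n) module_scheme \<Rightarrow> 'b set \<Rightarrow> ('a, 'b, 'n) module_scheme"
  where "restrict_module L P \<equiv> L\<lparr>carrier := P\<rparr>"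


subsection \<open>Bases and invariant factors\<close>

definition is_basis ::
    "('a, 'm) ring_scheme \<Rightarrow> ('a, 'b, 'n) module_scheme \<Rightarrow> 'i set \<Rightarrow> ('i \<Rightarrow> 'b) \<Rightarrow> bool"
  where "is_basis R N I u \<longleftrightarrow>
    finite I \<and> u \<in> I \<rightarrow> carrier N \<and>
    (\<forall>x\<in>carrier N. \<exists>c\<in>I \<rightarrow> carrier R. x = (\<Oplus>\<^bsub>N\<^esub> i\<in>I. c i \<odot>\<^bsub>N\<^esub> u i)) \<and>
    (\<forall>c\<in>I \<rightarrow> carrier R. (\<Oplus>\<^bsub>N\<^esub> i\<in>I. c i \<odot>\<^bsub>N\<^esub> u i) = \<zero>\<^bsub>N\<^esub> \<longrightarrow> (\<forall>i\<in>I. c i = \<zero>\<^bsub>R\<^esub>))"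

definition free_of_rank ::
    "('a, 'm) ring_scheme \<Rightarrow> ('a, 'b, 'n) module_scheme \<Rightarrow> nat \<Rightarrow> bool"
  where "free_of_rank R N f \<longleftrightarrow> (\<exists>e. is_basis R N {1..f} e)"

definition invariant_factors ::
    "('a, 'm) ring_scheme \<Rightarrow> ('a, 'b, 'n) module_scheme \<Rightarrow> nat \<Rightarrow> (nat \<Rightarrow> 'a) \<Rightarrow> bool"
  where "invariant_factors R N s g \<longleftrightarrow>
    1 \<le> s \<and> g \<in> {1..s} \<rightarrow> carrier R \<and>
    (\<forall>i\<in>{1..<s}. g i divides\<^bsub>R\<^esub> g (i + 1)) \<and>
    g 1 \<notin> Units R \<and> g s \<noteq> \<zero>\<^bsub>R\<^esub> \<and>
    module_isomorphic R N (finite_direct_sum {1..s} (\<lambda>i. cyclic_module R (g i)))"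

text \<open>
  The last conjunct ranges over the proper factors \<open>h\<close> of \<open>d\<close>: divisors that are not associates.
  Below, \<open>d\<close> is the last invariant factor of \<open>L/M\<close>, and \<open>u\<close> is a basis of \<open>M\<close>.
\<close>

definition maximal_order_vector ::
    "('a, 'm) ring_scheme \<Rightarrow> ('a, 'b, 'n) module_scheme \<Rightarrow> 'b set \<Rightarrow> nat \<Rightarrow> (nat \<Rightarrow> 'b) \<Rightarrow>
     'a \<Rightarrow> 'b \<Rightarrow> (nat \<Rightarrow> 'a) \<Rightarrow> bool"
  where "maximal_order_vector R L M f u d v a \<longleftrightarrow>
    v \<in> carrier L \<and> a \<in> {1..f} \<rightarrow> carrier R \<and>
    d \<odot>\<^bsub>L\<^esub> v = (\<Oplus>\<^bsub>L\<^esub> i\<in>{1..f}. a i \<odot>\<^bsub>L\<^esub> u i) \<and>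
    (\<forall>h\<in>carrier R. h divides\<^bsub>R\<^esub> d \<and> \<not> h \<sim>\<^bsub>R\<^esub> d \<longrightarrow> h \<odot>\<^bsub>L\<^esub> v \<notin> M)"


subsection \<open>Greatest common divisors and matrices\<close>

text \<open>
  Extends \<^const>\<open>isgcd\<close> from two elements to a set. A greatest common divisor is determined only
  up to associates, so \<open>gcd = 1\<close> is rendered as \<open>\<one>\<close> being one of them.
\<close>

definition is_gcd_of_set :: "('a, 'm) ring_scheme \<Rightarrow> 'a \<Rightarrow> 'a set \<Rightarrow> bool"
  where "is_gcd_of_set R d A \<longleftrightarrow> greatest (division_rel R) d (Lower (division_rel R) A)"

definition matrix_monoid :: "('a, 'm) ring_scheme \<Rightarrow> nat \<Rightarrow> (nat \<times> nat \<Rightarrow> 'a) monoid"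
  where "matrix_monoid R n =
    \<lparr>carrier = {1..n} \<times> {1..n} \<rightarrow>\<^sub>E carrier R,
     mult = (\<lambda>A B. \<lambda>(i, j)\<in>{1..n} \<times> {1..n}. \<Oplus>\<^bsub>R\<^esub> k\<in>{1..n}. A (i, k) \<otimes>\<^bsub>R\<^esub> B (k, j)),
     one = (\<lambda>(i, j)\<in>{1..n} \<times> {1..n}. if i = j then \<one>\<^bsub>R\<^esub> else \<zero>\<^bsub>R\<^esub>)\<rparr>"

definition GL :: "('a, 'm) ring_scheme \<Rightarrow> nat \<Rightarrow> (nat \<times> nat \<Rightarrow> 'a) set"
  where "GL R n = Units (matrix_monoid R n)"

definition row_times_matrix ::
    "('a, 'm) ring_scheme \<Rightarrow> nat \<Rightarrow> (nat \<Rightarrow> 'a) \<Rightarrow> (nat \<times> nat \<Rightarrow> 'a) \<Rightarrow> nat \<Rightarrow> 'a"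
  where "row_times_matrix R n a Q j = (\<Oplus>\<^bsub>R\<^esub> i\<in>{1..n}. a i \<otimes>\<^bsub>R\<^esub> Q (i, j))"

definition matrix_times_column ::
    "('a, 'b, 'n) module_scheme \<Rightarrow> nat \<Rightarrow> (nat \<times> nat \<Rightarrow> 'a) \<Rightarrow> (nat \<Rightarrow> 'b) \<Rightarrow> nat \<Rightarrow> 'b"
  where "matrix_times_column L n B u i = (\<Oplus>\<^bsub>L\<^esub> j\<in>{1..n}. B (i, j) \<odot>\<^bsub>L\<^esub> u j)"

definition row_is_e1 :: "('a, 'm) ring_scheme \<Rightarrow> nat \<Rightarrow> (nat \<Rightarrow> 'a) \<Rightarrow> bool"
  where "row_is_e1 R n b \<longleftrightarrow> (\<forall>j\<in>{1..n}. b j = (if j = 1 then \<one>\<^bsub>R\<^esub> else \<zero>\<^bsub>R\<^esub>))"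

end

(*
  Choosing representatives in R of the coordinates of L/M = R/g_1 + ... + R/g_s turns everything
  into congruences in R.  The vector v has annihilator exactly R g_s modulo M, and this forces the
  elements (g_s/g_i) x_i, where x_i are the coordinates of v, to generate the unit ideal together
  with g_s.  As R/g_s has stable range one, some linear form with a unit coefficient at the s-th
  coordinate takes the value 1 at v; subtracting multiples of it from the other coordinates gives
  a surjection of L onto R/g_1 + ... + R/g_(s-1) with kernel R v + M.  This replaces an appeal to
  the uniqueness of invariant factors.

  For (iii), the linear relations among u_1, ..., u_f, v are exactly the multiples of
  (a_1, ..., a_f, -g_s).  As L is torsion free, a common divisor of this row would give a smaller
  relation, so it is unimodular.  A matrix Q carrying the row to (1, 0, ..., 0) then carries the
  only relation to v_1 = 0, whence the remaining v_i are independent.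
*)
theory Submission
  imports Defs
begin

subsection \<open>Congruences, comaximal elements and stable range\<close>

text \<open>The second claim of (ii) must hold for every admissible \<open>v\<close>, and nothing
  ties \<open>v\<close> to the coordinate that is to be dropped. Take L/M = R/p + R/p with p prime
  and v = (1, 0). The form x_1 takes the value 1 at \<open>v\<close>, but correcting the remaining
  coordinate by it gives x_1 - x_1 = 0, and all information is lost. With x_1 + x_2, which also
  takes the value 1 at \<open>v\<close>, the corrected coordinate is -x_2, and this is a coordinate
  modulo R v + M. The unit coefficient at the dropped place is what makes the dropped coordinate
  recoverable from the others and the form. It cannot be had by Bezout alone, which controls no
  single coefficient; this is where stable range one enters. Working in R instead of in the various
  R/g_i has a price, as lifted coordinates are linear only up to multiples of their moduli. The gain
  is that forms with different moduli can be compared inside one ring, through multiplication by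
  g_s/g_i.\<close>

definition cong_mod :: "('a, 'm) ring_scheme \<Rightarrow> 'a \<Rightarrow> 'a \<Rightarrow> 'a \<Rightarrow> bool"
  where "cong_mod R d x y \<longleftrightarrow> d divides\<^bsub>R\<^esub> (x \<ominus>\<^bsub>R\<^esub> y)"

context cring begin

lemma divides_add:
  assumes "d \<in> carrier R" "x \<in> carrier R" "y \<in> carrier R" "d divides x" "d divides y"
  shows "d divides (x \<oplus> y)"
proof -
  obtain k l where "k \<in> carrier R" "x = d \<otimes> k" "l \<in> carrier R" "y = d \<otimes> l"
    using assms(4,5) by (meson dividesE)
  then have "x \<oplus> y = d \<otimes> (k \<oplus> l)" using assms by algebra
  then show ?thesis using \<open>k \<in> _\<close> \<open>l \<in> _\<close> by (metis a_closed dividesI)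
qed

lemma divides_mult_left:
  assumes "d \<in> carrier R" "x \<in> carrier R" "r \<in> carrier R" "d divides x"
  shows "d divides (r \<otimes> x)"
proof -
  obtain k where "k \<in> carrier R" "x = d \<otimes> k"
    using assms by (auto elim: dividesE)
  then have "r \<otimes> x = d \<otimes> (r \<otimes> k)" using assms by algebra
  then show ?thesis using \<open>k \<in> _\<close> assms by (metis m_closed dividesI)
qed

lemma divides_uminus:
  assumes "d \<in> carrier R" "x \<in> carrier R" "d divides x"
  shows "d divides (\<ominus> x)"
proof -
  have "\<ominus> x = \<ominus> \<one> \<otimes> x" using assms by algebra
  then show ?thesis using divides_mult_left[of d x "\<ominus> \<one>"] assms by simp
qed

lemma divides_minus:
  assumes "d \<in> carrier R" "x \<in> carrier R" "y \<in> carrier R" "d divides x" "d divides y"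
  shows "d divides (x \<ominus> y)"
  using assms by (simp add: a_minus_def divides_add divides_uminus)

lemma cong_mod_refl [simp]:
  assumes "d \<in> carrier R" "x \<in> carrier R" shows "cong_mod R d x x"
proof -
  have "x \<ominus> x = \<zero>" using assms by algebra
  then show ?thesis using assms divides_zero[of d] by (simp only: cong_mod_def)
qed

lemma cong_mod_sym:
  assumes "d \<in> carrier R" "x \<in> carrier R" "y \<in> carrier R" "cong_mod R d x y"
  shows "cong_mod R d y x"
proof -
  have "y \<ominus> x = \<ominus> (x \<ominus> y)" using assms by algebra
  then show ?thesis using assms divides_uminus by (simp add: cong_mod_def)
qed

lemma cong_mod_trans:
  assumes "cong_mod R d x y" "cong_mod R d y z"
    "d \<in> carrier R" "x \<in> carrier R" "y \<in> carrier R" "z \<in> carrier R"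
  shows "cong_mod R d x z"
proof -
  have "x \<ominus> z = (x \<ominus> y) \<oplus> (y \<ominus> z)" using assms by algebra
  then show ?thesis using assms divides_add[of d "x \<ominus> y" "y \<ominus> z"] by (simp add: cong_mod_def)
qed

lemma cong_mod_add:
  assumes "cong_mod R d x y" "cong_mod R d x' y'"
    "d \<in> carrier R" "x \<in> carrier R" "y \<in> carrier R" "x' \<in> carrier R" "y' \<in> carrier R"
  shows "cong_mod R d (x \<oplus> x') (y \<oplus> y')"
proof -
  have "(x \<oplus> x') \<ominus> (y \<oplus> y') = (x \<ominus> y) \<oplus> (x' \<ominus> y')" using assms by algebra
  then show ?thesis using assms divides_add by (simp add: cong_mod_def)
qed

lemma cong_mod_scale:
  assumes "cong_mod R d x y"
    "d \<in> carrier R" "x \<in> carrier R" "y \<in> carrier R" "r \<in> carrier R"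
  shows "cong_mod R d (r \<otimes> x) (r \<otimes> y)"
proof -
  have "r \<otimes> x \<ominus> r \<otimes> y = r \<otimes> (x \<ominus> y)" using assms by algebra
  then show ?thesis using assms divides_mult_left by (simp add: cong_mod_def)
qed

text \<open>Multiplication by \<open>r\<close> is well defined from R/d to R/(dr). With r = g_s/g_i
  it moves a coordinate with modulus g_i to the modulus g_s, where coordinates can be added.\<close>

lemma cong_mod_scale_modulus:
  assumes "cong_mod R d x y"
    "d \<in> carrier R" "x \<in> carrier R" "y \<in> carrier R" "r \<in> carrier R"
  shows "cong_mod R (d \<otimes> r) (r \<otimes> x) (r \<otimes> y)"
proof -
  have "r \<otimes> x \<ominus> r \<otimes> y = r \<otimes> (x \<ominus> y)" using assms by algebra
  moreover have "d \<otimes> r = r \<otimes> d" using assms by algebra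
  ultimately show ?thesis using assms divides_mult by (simp add: cong_mod_def)
qed

lemma cong_mod_minus:
  assumes "cong_mod R d x y" "cong_mod R d x' y'"
    "d \<in> carrier R" "x \<in> carrier R" "y \<in> carrier R" "x' \<in> carrier R" "y' \<in> carrier R"
  shows "cong_mod R d (x \<ominus> x') (y \<ominus> y')"
proof -
  have "(x \<ominus> x') \<ominus> (y \<ominus> y') = (x \<ominus> y) \<ominus> (x' \<ominus> y')" using assms by algebra
  then show ?thesis using assms divides_minus by (simp add: cong_mod_def)
qed

lemma cong_mod_weaken:
  assumes "cong_mod R d x y" "d' divides d"
    "d \<in> carrier R" "d' \<in> carrier R" "x \<in> carrier R" "y \<in> carrier R"
  shows "cong_mod R d' x y"
  using assms divides_trans[of d' d] by (simp add: cong_mod_def)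

lemma cong_mod_zero_iff:
  assumes "d \<in> carrier R" "x \<in> carrier R"
  shows "cong_mod R d x \<zero> \<longleftrightarrow> d divides x"
proof -
  have "x \<ominus> \<zero> = x" using assms by algebra
  then show ?thesis by (simp add: cong_mod_def)
qed

lemma cong_mod_divides_iff:
  assumes "cong_mod R d x y" "d \<in> carrier R" "x \<in> carrier R" "y \<in> carrier R"
  shows "d divides x \<longleftrightarrow> d divides y"
  using assms cong_mod_trans[of d x y \<zero>] cong_mod_trans[of d y x \<zero>] cong_mod_sym[of d x y]
  by (auto simp: cong_mod_zero_iff[symmetric])

lemma cong_mod_finsum:
  assumes "finite I" "d \<in> carrier R" "x \<in> I \<rightarrow> carrier R" "y \<in> I \<rightarrow> carrier R"
    "\<And>i. i \<in> I \<Longrightarrow> cong_mod R d (x i) (y i)"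
  shows "cong_mod R d (\<Oplus>i\<in>I. x i) (\<Oplus>i\<in>I. y i)"
  using assms
proof (induction rule: finite_induct)
  case empty then show ?case by simp
next
  case (insert i I)
  then show ?case by (simp add: Pi_def cong_mod_add)
qed

end

text \<open>Says that \<open>x\<close> is a unit modulo \<open>y\<close>. The witnesses are kept
  because \<open>\<alpha>\<close> is an inverse of \<open>x\<close> modulo \<open>y\<close>, which
  is needed later.\<close>

definition comaximal :: "('a, 'm) ring_scheme \<Rightarrow> 'a \<Rightarrow> 'a \<Rightarrow> bool"
  where "comaximal R x y \<longleftrightarrow>
    (\<exists>\<alpha>\<in>carrier R. \<exists>\<beta>\<in>carrier R. \<alpha> \<otimes>\<^bsub>R\<^esub> x \<oplus>\<^bsub>R\<^esub> \<beta> \<otimes>\<^bsub>R\<^esub> y = \<one>\<^bsub>R\<^esub>)"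

context cring begin

lemma comaximalI:
  assumes "\<alpha> \<in> carrier R" "\<beta> \<in> carrier R" "\<alpha> \<otimes> x \<oplus> \<beta> \<otimes> y = \<one>"
  shows "comaximal R x y"
  using assms by (auto simp: comaximal_def)

text \<open>In the product of the two Bezout identities every term contains \<open>x\<close> except
  one, which is a multiple of \<open>y \<otimes> z\<close>.\<close>

lemma comaximal_mult:
  assumes "comaximal R x y" "comaximal R x z"
    "x \<in> carrier R" "y \<in> carrier R" "z \<in> carrier R"
  shows "comaximal R x (y \<otimes> z)"
proof -
  obtain a b where ab: "a \<in> carrier R" "b \<in> carrier R" "a \<otimes> x \<oplus> b \<otimes> y = \<one>"
    using assms by (auto simp: comaximal_def)
  obtain c d where cd: "c \<in> carrier R" "d \<in> carrier R" "c \<otimes> x \<oplus> d \<otimes> z = \<one>"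
    using assms by (auto simp: comaximal_def)
  have "(a \<otimes> c \<otimes> x \<oplus> a \<otimes> d \<otimes> z \<oplus> b \<otimes> y \<otimes> c) \<otimes> x \<oplus> (b \<otimes> d) \<otimes> (y \<otimes> z)
      = (a \<otimes> x \<oplus> b \<otimes> y) \<otimes> (c \<otimes> x \<oplus> d \<otimes> z)"
    using ab(1,2) cd(1,2) assms(3-) by algebra
  then show ?thesis using ab cd assms(3-)
    by (intro comaximalI[of "a \<otimes> c \<otimes> x \<oplus> a \<otimes> d \<otimes> z \<oplus> b \<otimes> y \<otimes> c" "b \<otimes> d"]) simp_all
qed

lemma comaximal_sym:
  assumes "comaximal R x y" "x \<in> carrier R" "y \<in> carrier R"
  shows "comaximal R y x"
proof -
  obtain a b where ab: "a \<in> carrier R" "b \<in> carrier R" "a \<otimes> x \<oplus> b \<otimes> y = \<one>"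
    using assms by (auto simp: comaximal_def)
  have "b \<otimes> y \<oplus> a \<otimes> x = a \<otimes> x \<oplus> b \<otimes> y" using ab(1,2) assms(2,3) by algebra
  then show ?thesis using ab by (intro comaximalI[of b a]) auto
qed

lemma comaximal_cong:
  assumes "comaximal R x d" "cong_mod R d x y" "x \<in> carrier R" "y \<in> carrier R" "d \<in> carrier R"
  shows "comaximal R y d"
proof -
  obtain a b where ab: "a \<in> carrier R" "b \<in> carrier R" "a \<otimes> x \<oplus> b \<otimes> d = \<one>"
    using assms by (auto simp: comaximal_def)
  obtain k where k: "k \<in> carrier R" "x \<ominus> y = d \<otimes> k"
    using assms by (auto simp: cong_mod_def elim: dividesE)
  have "a \<otimes> y \<oplus> (b \<oplus> a \<otimes> k) \<otimes> d = a \<otimes> y \<oplus> a \<otimes> (d \<otimes> k) \<oplus> b \<otimes> d"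
    using ab(1,2) k(1) assms(3-) by algebra
  also have "\<dots> = a \<otimes> x \<oplus> b \<otimes> d"
    unfolding k(2)[symmetric] using ab(1,2) k(1) assms(3-) by algebra
  finally show ?thesis using ab k by (intro comaximalI[of a "b \<oplus> a \<otimes> k"]) simp_all
qed

lemma comaximal_divisor:
  assumes "comaximal R x y" "d divides y" "x \<in> carrier R" "y \<in> carrier R" "d \<in> carrier R"
  shows "comaximal R x d"
proof -
  obtain a b where ab: "a \<in> carrier R" "b \<in> carrier R" "a \<otimes> x \<oplus> b \<otimes> y = \<one>"
    using assms by (auto simp: comaximal_def)
  obtain k where k: "k \<in> carrier R" "y = d \<otimes> k"
    using assms by (auto elim: dividesE)
  have "a \<otimes> x \<oplus> (b \<otimes> k) \<otimes> d = a \<otimes> x \<oplus> b \<otimes> y"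
    using ab(1,2) k assms(3-) by algebra
  then show ?thesis using ab k(1) by (intro comaximalI[of a "b \<otimes> k"]) simp_all
qed

end

section \<open>Bezout identities and units modulo a nonzero element\<close>

context principal_domain begin

text \<open>The combination is a generator of the ideal R a + R b. The coefficients are named
  because they reappear as coefficients of linear forms and as matrix entries.\<close>

lemma bezout:
  assumes "a \<in> carrier R" "b \<in> carrier R"
  obtains \<alpha> \<beta> where "\<alpha> \<in> carrier R" "\<beta> \<in> carrier R"
    "(\<alpha> \<otimes> a \<oplus> \<beta> \<otimes> b) divides a" "(\<alpha> \<otimes> a \<oplus> \<beta> \<otimes> b) divides b"
proof -
  have "ideal (PIdl a <+>\<^bsub>R\<^esub> PIdl b) R"
    using assms by (simp add: add_ideals cgenideal_ideal)
  then obtain d where d: "d \<in> carrier R" "PIdl a <+>\<^bsub>R\<^esub> PIdl b = PIdl d"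
    using exists_gen by blast
  then have "d gcdof a b" using ideal_sum_iff_gcd[of a b d] assms by auto
  moreover have "d \<in> PIdl a <+>\<^bsub>R\<^esub> PIdl b" using d by (simp add: cgenideal_self)
  then obtain \<alpha> \<beta> where "\<alpha> \<in> carrier R" "\<beta> \<in> carrier R" "d = \<alpha> \<otimes> a \<oplus> \<beta> \<otimes> b"
    by (auto simp: set_add_def' cgenideal_def)
  ultimately show thesis using that by (auto simp: isgcd_def)
qed

text \<open>The combination found so far is treated as one element and combined with the new one,
  which multiplies all earlier coefficients by \<open>\<alpha>\<close>.\<close>

lemma bezout_finsum:
  assumes "finite I" "a \<in> I \<rightarrow> carrier R"
  shows "\<exists>b\<in>I \<rightarrow> carrier R. \<forall>i\<in>I. (\<Oplus>j\<in>I. b j \<otimes> a j) divides a i"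
  using assms
proof (induction rule: finite_induct)
  case empty then show ?case by simp
next
  case (insert i I)
  then obtain b where b: "b \<in> I \<rightarrow> carrier R" "\<forall>i\<in>I. (\<Oplus>j\<in>I. b j \<otimes> a j) divides a i"
    by auto
  have a: "a \<in> I \<rightarrow> carrier R" "a i \<in> carrier R" using insert by auto
  let ?d = "\<Oplus>j\<in>I. b j \<otimes> a j"
  have d: "?d \<in> carrier R" using b a by (auto intro!: finsum_closed)
  obtain \<alpha> \<beta> where ab: "\<alpha> \<in> carrier R" "\<beta> \<in> carrier R"
    "(\<alpha> \<otimes> ?d \<oplus> \<beta> \<otimes> a i) divides ?d" "(\<alpha> \<otimes> ?d \<oplus> \<beta> \<otimes> a i) divides a i"
    using bezout[of ?d "a i"] d a by auto
  let ?b = "\<lambda>j. if j = i then \<beta> else \<alpha> \<otimes> b j"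
  have "(\<Oplus>j\<in>I. ?b j \<otimes> a j) = (\<Oplus>j\<in>I. \<alpha> \<otimes> (b j \<otimes> a j))"
    using insert a b ab by (intro finsum_cong') (auto simp: m_assoc Pi_def)
  also have "\<dots> = \<alpha> \<otimes> ?d" using insert(1) a b ab by (intro finsum_rdistr[symmetric]) auto
  finally have sum: "(\<Oplus>j\<in>insert i I. ?b j \<otimes> a j) = \<alpha> \<otimes> ?d \<oplus> \<beta> \<otimes> a i"
    using insert(1,2) a b ab(1,2) d by (subst finsum_insert) (auto simp: a_comm Pi_iff)
  have "(\<alpha> \<otimes> ?d \<oplus> \<beta> \<otimes> a i) divides a j" if "j \<in> insert i I" for j
    using that ab b d a divides_trans[of "\<alpha> \<otimes> ?d \<oplus> \<beta> \<otimes> a i" ?d "a j"] by auto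
  moreover have "?b \<in> insert i I \<rightarrow> carrier R" using ab(1,2) b(1) by (auto simp: Pi_iff)
  ultimately show ?case unfolding sum[symmetric] by (intro bexI[of _ ?b] ballI)
qed

text \<open>The Bezout combination of \<open>x\<close> and \<open>p\<close> divides
  \<open>p\<close>. So it is either a unit, which makes \<open>x\<close> invertible modulo
  \<open>p\<close>, or an associate of \<open>p\<close>, which then divides
  \<open>x\<close>.\<close>

lemma irreducible_comaximal_or_divides:
  assumes "p \<in> carrier R" "ring_irreducible p" "x \<in> carrier R"
  shows "comaximal R x p \<or> p divides x"
proof -
  obtain \<alpha> \<beta> where ab: "\<alpha> \<in> carrier R" "\<beta> \<in> carrier R"
    "(\<alpha> \<otimes> x \<oplus> \<beta> \<otimes> p) divides x" "(\<alpha> \<otimes> x \<oplus> \<beta> \<otimes> p) divides p"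
    using bezout[of x p] assms by auto
  let ?d = "\<alpha> \<otimes> x \<oplus> \<beta> \<otimes> p"
  have d: "?d \<in> carrier R" using ab assms by auto
  obtain k where k: "k \<in> carrier R" "p = ?d \<otimes> k" using ab(4) by (meson dividesE)
  from ring_irreducibleE(5)[OF assms(1,2) d k] show ?thesis
  proof
    assume "?d \<in> Units R"
    then have "inv ?d \<in> carrier R" "inv ?d \<otimes> ?d = \<one>" by (auto simp: Units_l_inv)
    moreover have "(inv ?d \<otimes> \<alpha>) \<otimes> x \<oplus> (inv ?d \<otimes> \<beta>) \<otimes> p = inv ?d \<otimes> ?d"
      using \<open>inv ?d \<in> carrier R\<close> ab(1,2) assms by algebra
    ultimately show ?thesis using ab(1,2) \<open>inv ?d \<in> carrier R\<close>
      by (intro disjI1 comaximalI[of "inv ?d \<otimes> \<alpha>" "inv ?d \<otimes> \<beta>"]) simp_all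
  next
    assume "k \<in> Units R"
    then have "p \<sim> ?d" using associatedI2'[OF k(2) _ d] by simp
    then have "p divides x"
      using divides_trans[OF _ ab(3) assms(1)] by (simp add: associated_def)
    then show ?thesis by simp
  qed
qed

text \<open>A nonzero \<open>m\<close> has only finitely many prime divisors up to associates, so \<open>R/m\<close> has
  stable range one.\<close>

lemma stable_range_one:
  assumes "m \<in> carrier R" "m \<noteq> \<zero>" "a \<in> carrier R" "b \<in> carrier R"
    and "\<exists>\<alpha>\<in>carrier R. \<exists>\<beta>\<in>carrier R. \<exists>\<gamma>\<in>carrier R. \<alpha> \<otimes> a \<oplus> \<beta> \<otimes> b \<oplus> \<gamma> \<otimes> m = \<one>"
  shows "\<exists>t\<in>carrier R. comaximal R (a \<oplus> t \<otimes> b) m"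
proof -
  \<comment> \<open>Induction on a list of irreducible factors of the modulus. When a factor is
    dropped, the third coefficient of the unimodularity relation absorbs it.\<close>
  have "\<exists>t\<in>carrier R. comaximal R (a \<oplus> t \<otimes> b) m"
    if "set fs \<subseteq> carrier R" "\<forall>p\<in>set fs. ring_irreducible p"
     "\<exists>\<alpha>\<in>carrier R. \<exists>\<beta>\<in>carrier R. \<exists>\<gamma>\<in>carrier R. \<alpha> \<otimes> a \<oplus> \<beta> \<otimes> b \<oplus> \<gamma> \<otimes> m = \<one>"
     "m = foldr (\<otimes>) fs \<one>" for fs m
    using that
  proof (induction fs arbitrary: m)
    case Nil
    then have "comaximal R (a \<oplus> \<zero> \<otimes> b) m"
      using assms(3,4) by (intro comaximalI[of \<zero> \<one>]) auto
    then show ?case by blast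
  next
    case (Cons p fs)
    define n where "n = foldr (\<otimes>) fs \<one>"
    have p: "p \<in> carrier R" "ring_irreducible p" using Cons.prems by auto
    have n: "n \<in> carrier R" using Cons.prems(1) unfolding n_def by (induction fs) auto
    have m: "m = p \<otimes> n" using Cons.prems n_def by simp
    obtain \<alpha> \<beta> \<gamma> where abc: "\<alpha> \<in> carrier R" "\<beta> \<in> carrier R" "\<gamma> \<in> carrier R"
      "\<alpha> \<otimes> a \<oplus> \<beta> \<otimes> b \<oplus> \<gamma> \<otimes> m = \<one>" using Cons.prems by blast
    have "\<alpha> \<otimes> a \<oplus> \<beta> \<otimes> b \<oplus> (\<gamma> \<otimes> p) \<otimes> n = \<one>"
      using abc(4) m abc(1-3) p n assms(3,4) by (simp add: m_assoc)
    then obtain t where t: "t \<in> carrier R" "comaximal R (a \<oplus> t \<otimes> b) n"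
      using Cons.IH[of n, OF _ _ _ n_def] Cons.prems(1,2) abc(1,2) m_closed[OF abc(3) p(1)]
      by auto
    let ?x = "a \<oplus> t \<otimes> b"
    have x: "?x \<in> carrier R" using t assms by auto
    show ?case
    proof (cases "comaximal R ?x p")
      case True
      then have "comaximal R ?x m" using t m p n x by (simp add: comaximal_mult)
      then show ?thesis using t by blast
    next
      case False
      then have px: "p divides ?x" using irreducible_comaximal_or_divides[OF p x] by simp
      have "\<not> p divides n"
        using False comaximal_divisor[OF t(2) _ x n p(1)] by blast
      then have np: "comaximal R p n"
        using irreducible_comaximal_or_divides[OF p n] comaximal_sym[OF _ n p(1)] by simp
      \<comment> \<open>If \<open>p\<close> divided \<open>b\<close>, it would also divide
        \<open>a\<close>, being a divisor of \<open>?x\<close>, and it divides \<open>m\<close>; so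
        it would divide 1.\<close>
      have "\<not> p divides b"
      proof
        assume pb: "p divides b"
        have "a = ?x \<ominus> t \<otimes> b" using assms t by algebra
        then have pa: "p divides a"
          using divides_minus[OF p(1) x _ px divides_mult_left[OF p(1) assms(4) t(1) pb]] t assms
          by simp
        have "p divides (\<alpha> \<otimes> a \<oplus> \<beta> \<otimes> b \<oplus> \<gamma> \<otimes> m)"
          using pa pb abc(1-3) p n m assms
          by (intro divides_add divides_mult_left) auto
        then show False using abc(4) p divides_one ring_irreducibleE(4) by auto
      qed
      then have "comaximal R p b"
        using irreducible_comaximal_or_divides[OF p assms(4)] comaximal_sym[OF _ assms(4) p(1)]
        by simp
      then have "comaximal R p (n \<otimes> b)" using np p n assms by (simp add: comaximal_mult)
      then have nbp: "comaximal R (n \<otimes> b) p" using comaximal_sym[OF _ p(1)] n assms by simp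
      \<comment> \<open>Raising \<open>t\<close> by \<open>n\<close> keeps the value unchanged
        modulo \<open>n\<close>, and moves it modulo \<open>p\<close> from 0 to
        \<open>n \<otimes> b\<close>, which is a unit there.\<close>
      let ?y = "a \<oplus> (t \<oplus> n) \<otimes> b"
      have y: "?y \<in> carrier R" using t n assms by auto
      have "n \<otimes> b \<ominus> ?y = \<ominus> ?x" using assms t n by algebra
      then have "comaximal R ?y p"
        using comaximal_cong[OF nbp] px x y n p assms divides_uminus by (simp add: cong_mod_def)
      moreover have "?x \<ominus> ?y = n \<otimes> (\<ominus> b)" using assms t n by algebra
      then have "comaximal R ?y n"
        using comaximal_cong[OF t(2) _ x y n] assms unfolding cong_mod_def
        by (simp add: dividesI[of "\<ominus> b"])
      ultimately have "comaximal R ?y m" using m p n y by (simp add: comaximal_mult)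
      then show ?thesis using t n by blast
    qed
  qed
  note main = this
  \<comment> \<open>The factorization recovers \<open>m\<close> only up to an associate
    \<open>n\<close>. That \<open>n\<close> divides \<open>m\<close> carries the hypothesis over to
    \<open>n\<close>, and that \<open>m\<close> divides \<open>n\<close> brings the conclusion
    back.\<close>
  obtain fs where fs: "set fs \<subseteq> carrier (mult_of R)" "wfactors (mult_of R) fs m"
    using mult_of.wfactors_exist[of m] assms by auto
  define n where "n = foldr (\<otimes>) fs \<one>"
  have n: "n \<in> carrier R"
    using fs(1) unfolding n_def by (induction fs) auto
  have "n \<sim>\<^bsub>mult_of R\<^esub> m" using fs(2) by (simp add: wfactors_def n_def)
  then have nm: "n divides m" "m divides n" by (simp_all add: associated_def)
  have irr: "\<forall>p\<in>set fs. ring_irreducible p"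
    using fs by (auto simp: wfactors_def intro!: ring_irreducibleI')
  obtain \<alpha> \<beta> \<gamma> where abc: "\<alpha> \<in> carrier R" "\<beta> \<in> carrier R" "\<gamma> \<in> carrier R"
    "\<alpha> \<otimes> a \<oplus> \<beta> \<otimes> b \<oplus> \<gamma> \<otimes> m = \<one>" using assms(5) by blast
  obtain w where w: "w \<in> carrier R" "m = n \<otimes> w" using nm(1) by (meson dividesE)
  have "\<gamma> \<otimes> m = (\<gamma> \<otimes> w) \<otimes> n" using abc w n by algebra
  then have "\<alpha> \<otimes> a \<oplus> \<beta> \<otimes> b \<oplus> (\<gamma> \<otimes> w) \<otimes> n = \<one>" using abc by simp
  then obtain t where "t \<in> carrier R" "comaximal R (a \<oplus> t \<otimes> b) n"
    using main[OF _ irr _ n_def] fs(1) abc(1,2) m_closed[OF abc(3) w(1)] by fastforce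
  then show ?thesis using comaximal_divisor[OF _ nm(2) _ n assms(1)] assms(3,4) by auto
qed

end

subsection \<open>Quotient modules and coordinates\<close>

context module begin

lemma submodule_abelian_subgroup:
  assumes "submodule K R M"
  shows "abelian_subgroup K M"
proof -
  interpret submodule K R M by fact
  show ?thesis
    by (intro abelian_subgroupI3 additive_subgroup.intro subgroup_axioms M.abelian_group_axioms)
qed

lemma carrier_quotient_module:
  "carrier (quotient_module M K) = (\<lambda>x. K +>\<^bsub>M\<^esub> x) ` carrier M"
  by (auto simp: quotient_module_def A_RCOSETS_def')

lemma quotient_module_add:
  assumes "submodule K R M" "x \<in> carrier M" "y \<in> carrier M"
  shows "(K +>\<^bsub>M\<^esub> x) \<oplus>\<^bsub>quotient_module M K\<^esub> (K +>\<^bsub>M\<^esub> y) = K +>\<^bsub>M\<^esub> (x \<oplus>\<^bsub>M\<^esub> y)"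
  using abelian_subgroup.a_rcos_sum[OF submodule_abelian_subgroup[OF assms(1)] assms(2,3)]
  by (simp add: quotient_module_def)

lemma coset_eq_iff:
  assumes "submodule K R M" "x \<in> carrier M" "y \<in> carrier M"
  shows "K +>\<^bsub>M\<^esub> x = K +>\<^bsub>M\<^esub> y \<longleftrightarrow> x \<ominus>\<^bsub>M\<^esub> y \<in> K"
proof -
  interpret abelian_subgroup K M using submodule_abelian_subgroup assms by blast
  show ?thesis
    unfolding a_minus_def a_rcos_module[OF assms(3,2), symmetric]
    using a_rcos_self[OF assms(2)] a_repr_independence'[of x y] assms by auto
qed

lemma coset_mem_iff:
  assumes "submodule K R M" "x \<in> carrier M"
  shows "y \<in> K +>\<^bsub>M\<^esub> x \<longleftrightarrow> y \<in> carrier M \<and> y \<ominus>\<^bsub>M\<^esub> x \<in> K"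
proof -
  interpret abelian_subgroup K M using submodule_abelian_subgroup assms by blast
  show ?thesis
    using a_rcos_module[OF assms(2), of y] a_elemrcos_carrier[OF assms(2), of y]
    by (auto simp: a_minus_def)
qed

lemma minus_zero_right:
  assumes "x \<in> carrier M" shows "x \<ominus>\<^bsub>M\<^esub> \<zero>\<^bsub>M\<^esub> = x"
  using assms M.r_neg[OF M.zero_closed] by (simp add: a_minus_def)

lemma smult_minus_right:
  assumes "r \<in> carrier R" "x \<in> carrier M" "y \<in> carrier M"
  shows "r \<odot>\<^bsub>M\<^esub> (x \<ominus>\<^bsub>M\<^esub> y) = r \<odot>\<^bsub>M\<^esub> x \<ominus>\<^bsub>M\<^esub> r \<odot>\<^bsub>M\<^esub> y"
  using assms by (simp add: a_minus_def smult_r_distr smult_r_minus)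

lemma quotient_module_smult:
  assumes "submodule K R M" "r \<in> carrier R" "x \<in> carrier M"
  shows "r \<odot>\<^bsub>quotient_module M K\<^esub> (K +>\<^bsub>M\<^esub> x) = K +>\<^bsub>M\<^esub> (r \<odot>\<^bsub>M\<^esub> x)"
proof -
  have eq: "K +>\<^bsub>M\<^esub> (r \<odot>\<^bsub>M\<^esub> y) = K +>\<^bsub>M\<^esub> (r \<odot>\<^bsub>M\<^esub> x)" if "y \<in> K +>\<^bsub>M\<^esub> x" for y
  proof -
    have y: "y \<in> carrier M" "y \<ominus>\<^bsub>M\<^esub> x \<in> K" using that coset_mem_iff assms by auto
    then have "r \<odot>\<^bsub>M\<^esub> y \<ominus>\<^bsub>M\<^esub> r \<odot>\<^bsub>M\<^esub> x \<in> K"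
      using submodule.smult_closed[OF assms(1,2)] assms by (simp flip: smult_minus_right)
    then show ?thesis using coset_eq_iff[OF assms(1)] y assms by simp
  qed
  \<comment> \<open>The union that defines the action has to range over a nonempty set, so
    \<open>x\<close> is exhibited in its own coset.\<close>
  have "x \<ominus>\<^bsub>M\<^esub> x \<in> K"
    using assms submoduleE[OF assms(1)] subgroup.one_closed[OF submodule.axioms(1)[OF assms(1)]]
    by (simp add: a_minus_def M.r_neg)
  then have "x \<in> K +>\<^bsub>M\<^esub> x" using coset_mem_iff assms by simp
  then have "(\<Union>y\<in>K +>\<^bsub>M\<^esub> x. K +>\<^bsub>M\<^esub> (r \<odot>\<^bsub>M\<^esub> y)) = K +>\<^bsub>M\<^esub> (r \<odot>\<^bsub>M\<^esub> x)"
    using eq by blast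
  then show ?thesis by (simp add: quotient_module_def)
qed

text \<open>The kernel is expressed through equality of values, which avoids negation in
  \<open>N\<close> and with it a proof that this record is a module. The induced map is well defined
  because \<open>h\<close> is constant on each coset.\<close>

lemma first_isomorphism:
  assumes K: "submodule K R M" and h: "h \<in> module_hom R M N"
    and surj: "h ` carrier M = carrier N"
    and ker: "\<And>x y. x \<in> carrier M \<Longrightarrow> y \<in> carrier M \<Longrightarrow> h x = h y \<longleftrightarrow> x \<ominus>\<^bsub>M\<^esub> y \<in> K"
  shows "module_isomorphic R (quotient_module M K) N"
proof -
  let ?H = "\<lambda>X. the_elem (h ` X)"
  have H: "?H (K +>\<^bsub>M\<^esub> x) = h x" if x: "x \<in> carrier M" for x
  proof -
    have "K +>\<^bsub>M\<^esub> x \<noteq> {}"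
      using abelian_subgroup.a_rcos_self[OF submodule_abelian_subgroup[OF K] x] by auto
    moreover have "h y = h x" if "y \<in> K +>\<^bsub>M\<^esub> x" for y
      using that coset_mem_iff[OF K x] ker x by simp
    ultimately have "h ` (K +>\<^bsub>M\<^esub> x) = {h x}" by auto
    then show ?thesis by simp
  qed
  have "?H \<in> module_hom R (quotient_module M K) N"
    using h H K unfolding module_hom_def
    by (auto simp: carrier_quotient_module quotient_module_add quotient_module_smult)
  moreover have "inj_on ?H (carrier (quotient_module M K))"
    using H ker coset_eq_iff[OF K] by (auto simp: inj_on_def carrier_quotient_module)
  moreover have "?H ` carrier (quotient_module M K) = carrier N"
    using H surj by (auto simp: carrier_quotient_module image_image)
  ultimately show ?thesis by (auto simp: module_isomorphic_def bij_betw_def)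
qed

end

section \<open>Principal ideals and the cyclic modules R/d\<close>

context cring begin

lemma self_module_is_module: "module R (self_module R)"
proof (rule moduleI)
  show "abelian_group (self_module R)"
    by (rule abelian_groupI) (auto simp: self_module_def a_ac intro: l_neg)
qed (simp_all add: self_module_def is_cring l_distr r_distr m_assoc)

lemma self_module_uminus: "\<ominus>\<^bsub>self_module R\<^esub> y = \<ominus> y"
  by (simp add: self_module_def a_inv_def m_inv_def)

lemma self_module_minus: "x \<ominus>\<^bsub>self_module R\<^esub> y = x \<ominus> y"
  by (simp add: a_minus_def self_module_uminus) (simp add: self_module_def)

lemma PIdl_submodule:
  assumes "d \<in> carrier R"
  shows "submodule (PIdl d) R (self_module R)"
proof -
  interpret ideal "PIdl d" R using cgenideal_ideal assms .
  show ?thesis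
  proof (rule module.submoduleI[OF self_module_is_module])
    show "PIdl d \<subseteq> carrier (self_module R)" using a_subset by (simp add: self_module_def)
    show "\<zero>\<^bsub>self_module R\<^esub> \<in> PIdl d"
      using additive_subgroup.zero_closed[OF is_additive_subgroup] by (simp add: self_module_def)
  qed (simp_all add: self_module_uminus, simp_all add: self_module_def I_l_closed)
qed

lemma mem_PIdl_iff:
  assumes "d \<in> carrier R"
  shows "x \<in> PIdl d \<longleftrightarrow> d divides x"
  using assms by (auto simp: cgenideal_def factor_def m_comm)

lemma a_r_coset_self_module: "I +>\<^bsub>self_module R\<^esub> x = I +> x"
  by (simp add: self_module_def a_r_coset_def r_coset_def)

lemma carrier_cyclic_module:
  "carrier (cyclic_module R d) = (\<lambda>c. PIdl d +> c) ` carrier R"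
  using module.carrier_quotient_module[OF self_module_is_module, of "PIdl d"]
  by (simp add: cyclic_module_def a_r_coset_self_module) (simp add: self_module_def)

lemma cyclic_module_add:
  assumes "d \<in> carrier R" "x \<in> carrier R" "y \<in> carrier R"
  shows "(PIdl d +> x) \<oplus>\<^bsub>cyclic_module R d\<^esub> (PIdl d +> y) = PIdl d +> (x \<oplus> y)"
  using module.quotient_module_add[OF self_module_is_module PIdl_submodule, of d x y] assms
  by (simp add: cyclic_module_def a_r_coset_self_module) (simp add: self_module_def)

lemma cyclic_module_smult:
  assumes "d \<in> carrier R" "r \<in> carrier R" "x \<in> carrier R"
  shows "r \<odot>\<^bsub>cyclic_module R d\<^esub> (PIdl d +> x) = PIdl d +> (r \<otimes> x)"
  using module.quotient_module_smult[OF self_module_is_module PIdl_submodule, of d r x] assms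
  by (simp add: cyclic_module_def a_r_coset_self_module) (simp add: self_module_def)

lemma PIdl_coset_eq_iff:
  assumes "d \<in> carrier R" "x \<in> carrier R" "y \<in> carrier R"
  shows "PIdl d +> x = PIdl d +> y \<longleftrightarrow> cong_mod R d x y"
  using module.coset_eq_iff[OF self_module_is_module PIdl_submodule, of d x y] assms
  by (simp add: a_r_coset_self_module self_module_minus cong_mod_def mem_PIdl_iff)
     (simp add: self_module_def)

end

text \<open>The linear maps from \<open>M\<close> to R/d, each given by a lift to R that comes from
  choosing representatives.\<close>

definition linear_mod ::
    "('a, 'm) ring_scheme \<Rightarrow> ('a, 'b, 'n) module_scheme \<Rightarrow> 'a \<Rightarrow> ('b \<Rightarrow> 'a) \<Rightarrow> bool"
  where "linear_mod R M d \<phi> \<longleftrightarrow>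
    \<phi> \<in> carrier M \<rightarrow> carrier R \<and>
    (\<forall>x\<in>carrier M. \<forall>y\<in>carrier M. cong_mod R d (\<phi> (x \<oplus>\<^bsub>M\<^esub> y)) (\<phi> x \<oplus>\<^bsub>R\<^esub> \<phi> y)) \<and>
    (\<forall>r\<in>carrier R. \<forall>x\<in>carrier M. cong_mod R d (\<phi> (r \<odot>\<^bsub>M\<^esub> x)) (r \<otimes>\<^bsub>R\<^esub> \<phi> x))"

text \<open>An isomorphism of \<open>M/K\<close> with a direct sum of cyclic modules \<open>R/g\<^sub>i\<close>, described by
  representatives in \<open>R\<close> of the coordinates.\<close>

definition quotient_coordinates ::
    "('a, 'm) ring_scheme \<Rightarrow> ('a, 'b, 'n) module_scheme \<Rightarrow> 'b set \<Rightarrow> 'i set \<Rightarrow> ('i \<Rightarrow> 'a) \<Rightarrow>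
     ('i \<Rightarrow> 'b \<Rightarrow> 'a) \<Rightarrow> bool"
  where "quotient_coordinates R M K I g \<xi> \<longleftrightarrow>
    (\<forall>i\<in>I. linear_mod R M (g i) (\<xi> i)) \<and>
    (\<forall>x\<in>carrier M. x \<in> K \<longleftrightarrow> (\<forall>i\<in>I. g i divides\<^bsub>R\<^esub> \<xi> i x)) \<and>
    (\<forall>c\<in>I \<rightarrow> carrier R. \<exists>x\<in>carrier M. \<forall>i\<in>I. cong_mod R (g i) (\<xi> i x) (c i))"

context module begin

lemma linear_modD:
  assumes "linear_mod R M d \<phi>"
  shows "\<And>x. x \<in> carrier M \<Longrightarrow> \<phi> x \<in> carrier R"
    "\<And>x y. \<lbrakk>x \<in> carrier M; y \<in> carrier M\<rbrakk> \<Longrightarrow> cong_mod R d (\<phi> (x \<oplus>\<^bsub>M\<^esub> y)) (\<phi> x \<oplus> \<phi> y)"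
    "\<And>r x. \<lbrakk>r \<in> carrier R; x \<in> carrier M\<rbrakk> \<Longrightarrow> cong_mod R d (\<phi> (r \<odot>\<^bsub>M\<^esub> x)) (r \<otimes> \<phi> x)"
  using assms by (auto simp: linear_mod_def)

lemma linear_mod_minus_smult:
  assumes "linear_mod R M d \<phi>" "d \<in> carrier R" "r \<in> carrier R" "x \<in> carrier M" "y \<in> carrier M"
  shows "cong_mod R d (\<phi> (x \<ominus>\<^bsub>M\<^esub> r \<odot>\<^bsub>M\<^esub> y)) (\<phi> x \<ominus> r \<otimes> \<phi> y)"
proof -
  note D = linear_modD[OF assms(1)]
  have eq: "x \<ominus>\<^bsub>M\<^esub> r \<odot>\<^bsub>M\<^esub> y = x \<oplus>\<^bsub>M\<^esub> (\<ominus> r) \<odot>\<^bsub>M\<^esub> y"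
    using assms by (simp add: a_minus_def smult_l_minus)
  have "cong_mod R d (\<phi> x \<oplus> \<phi> ((\<ominus> r) \<odot>\<^bsub>M\<^esub> y)) (\<phi> x \<oplus> \<ominus> r \<otimes> \<phi> y)"
    using D assms by (intro cong_mod_add cong_mod_refl D) auto
  then have "cong_mod R d (\<phi> (x \<ominus>\<^bsub>M\<^esub> r \<odot>\<^bsub>M\<^esub> y)) (\<phi> x \<oplus> \<ominus> r \<otimes> \<phi> y)"
    unfolding eq using D assms
    by (intro cong_mod_trans[OF D(2)]) auto
  moreover have "\<phi> x \<oplus> \<ominus> r \<otimes> \<phi> y = \<phi> x \<ominus> r \<otimes> \<phi> y"
    using D(1) assms by (simp add: a_minus_def l_minus)
  ultimately show ?thesis by simp
qed

lemma linear_mod_minus: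
  assumes "linear_mod R M d \<phi>" "d \<in> carrier R" "x \<in> carrier M" "y \<in> carrier M"
  shows "cong_mod R d (\<phi> (x \<ominus>\<^bsub>M\<^esub> y)) (\<phi> x \<ominus> \<phi> y)"
  using linear_mod_minus_smult[OF assms(1,2) one_closed assms(3,4)] linear_modD(1)[OF assms(1)] assms
  by simp

lemma linear_mod_weaken:
  assumes "linear_mod R M d \<phi>" "d' divides d" "d \<in> carrier R" "d' \<in> carrier R"
  shows "linear_mod R M d' \<phi>"
  using assms linear_modD(1)[OF assms(1)] unfolding linear_mod_def
  by (auto intro!: cong_mod_weaken[OF _ assms(2)])

lemma linear_mod_scale:
  assumes "linear_mod R M d \<phi>" "d \<in> carrier R" "r \<in> carrier R"
  shows "linear_mod R M d (\<lambda>x. r \<otimes> \<phi> x)"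
proof -
  note D = linear_modD[OF assms(1)]
  have "cong_mod R d (r \<otimes> \<phi> (x \<oplus>\<^bsub>M\<^esub> y)) (r \<otimes> \<phi> x \<oplus> r \<otimes> \<phi> y)"
    if "x \<in> carrier M" "y \<in> carrier M" for x y
    using cong_mod_scale[OF D(2)[OF that]] that D(1) assms by (simp add: r_distr)
  moreover have "cong_mod R d (r \<otimes> \<phi> (q \<odot>\<^bsub>M\<^esub> x)) (q \<otimes> (r \<otimes> \<phi> x))"
    if "x \<in> carrier M" "q \<in> carrier R" for x q
    using cong_mod_scale[OF D(3)[OF that(2,1)]] that D(1) assms by (simp add: m_lcomm[of q r])
  ultimately show ?thesis using D assms by (auto simp: linear_mod_def)
qed

lemma linear_mod_scale_modulus:
  assumes "linear_mod R M d \<phi>" "d \<in> carrier R" "r \<in> carrier R"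
  shows "linear_mod R M (d \<otimes> r) (\<lambda>x. r \<otimes> \<phi> x)"
proof -
  note D = linear_modD[OF assms(1)]
  have "cong_mod R (d \<otimes> r) (r \<otimes> \<phi> (x \<oplus>\<^bsub>M\<^esub> y)) (r \<otimes> \<phi> x \<oplus> r \<otimes> \<phi> y)"
    if "x \<in> carrier M" "y \<in> carrier M" for x y
    using cong_mod_scale_modulus[OF D(2)[OF that]] that D(1) assms by (simp add: r_distr)
  moreover have "cong_mod R (d \<otimes> r) (r \<otimes> \<phi> (q \<odot>\<^bsub>M\<^esub> x)) (q \<otimes> (r \<otimes> \<phi> x))"
    if "x \<in> carrier M" "q \<in> carrier R" for x q
    using cong_mod_scale_modulus[OF D(3)[OF that(2,1)]] that D(1) assms by (simp add: m_lcomm[of q r])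
  ultimately show ?thesis using D assms by (auto simp: linear_mod_def)
qed

lemma linear_mod_add:
  assumes "linear_mod R M d \<phi>" "linear_mod R M d \<psi>" "d \<in> carrier R"
  shows "linear_mod R M d (\<lambda>x. \<phi> x \<oplus> \<psi> x)"
proof -
  note D = linear_modD[OF assms(1)] linear_modD[OF assms(2)]
  have "cong_mod R d (\<phi> (x \<oplus>\<^bsub>M\<^esub> y) \<oplus> \<psi> (x \<oplus>\<^bsub>M\<^esub> y)) (\<phi> x \<oplus> \<psi> x \<oplus> (\<phi> y \<oplus> \<psi> y))"
    if "x \<in> carrier M" "y \<in> carrier M" for x y
  proof -
    have "\<phi> x \<oplus> \<psi> x \<oplus> (\<phi> y \<oplus> \<psi> y) = \<phi> x \<oplus> \<phi> y \<oplus> (\<psi> x \<oplus> \<psi> y)"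
      using D(1,4)[OF that(1)] D(1,4)[OF that(2)] by algebra
    then show ?thesis
      using cong_mod_add[OF D(2)[OF that] D(5)[OF that]] that D(1,4) assms by simp
  qed
  moreover have "cong_mod R d (\<phi> (q \<odot>\<^bsub>M\<^esub> x) \<oplus> \<psi> (q \<odot>\<^bsub>M\<^esub> x)) (q \<otimes> (\<phi> x \<oplus> \<psi> x))"
    if "x \<in> carrier M" "q \<in> carrier R" for x q
    using cong_mod_add[OF D(3)[OF that(2,1)] D(6)[OF that(2,1)]] that D(1,4) assms
    by (simp add: r_distr)
  ultimately show ?thesis using D assms by (auto simp: linear_mod_def)
qed

lemma linear_mod_zero:
  assumes "d \<in> carrier R" shows "linear_mod R M d (\<lambda>x. \<zero>)"
  using assms by (simp add: linear_mod_def)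

lemma linear_mod_finsum:
  assumes "finite I" "\<And>i. i \<in> I \<Longrightarrow> linear_mod R M d (\<phi> i)" "d \<in> carrier R"
  shows "linear_mod R M d (\<lambda>x. \<Oplus>i\<in>I. \<phi> i x)"
  using assms
proof (induction rule: finite_induct)
  case empty
  then show ?case by (simp add: linear_mod_zero)
next
  case (insert i I)
  have c: "\<phi> j x \<in> carrier R" if "j \<in> insert i I" "x \<in> carrier M" for j x
    using linear_modD(1) insert.prems(1) that by blast
  have "(\<Oplus>j\<in>insert i I. \<phi> j x) = \<phi> i x \<oplus> (\<Oplus>j\<in>I. \<phi> j x)" if "x \<in> carrier M" for x
    using insert.hyps c that by (subst R.finsum_insert) auto
  moreover have "linear_mod R M d (\<lambda>x. \<phi> i x \<oplus> (\<Oplus>j\<in>I. \<phi> j x))"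
    using insert by (intro linear_mod_add) auto
  ultimately show ?case by (simp add: linear_mod_def Pi_def)
qed

text \<open>Each component of the image of a coset under the isomorphism is itself a coset of the
  ideal of \<open>g i\<close>; a representative of it is chosen as the coordinate.\<close>

lemma quotient_coordinates_exist:
  assumes K: "submodule K R M" and g: "g \<in> I \<rightarrow> carrier R"
    and iso: "module_isomorphic R (quotient_module M K)
      (finite_direct_sum I (\<lambda>i. cyclic_module R (g i)))"
  shows "\<exists>\<xi>. quotient_coordinates R M K I g \<xi>"
proof -
  let ?Q = "quotient_module M K" and ?S = "finite_direct_sum I (\<lambda>i. cyclic_module R (g i))"
  obtain h where h: "h \<in> module_hom R ?Q ?S" "bij_betw h (carrier ?Q) (carrier ?S)"
    using iso by (auto simp: module_isomorphic_def)
  let ?h = "\<lambda>x. h (K +>\<^bsub>M\<^esub> x)"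
  have inQ: "K +>\<^bsub>M\<^esub> x \<in> carrier ?Q" if "x \<in> carrier M" for x
    using that by (simp add: carrier_quotient_module)
  have hS: "?h x \<in> carrier ?S" if "x \<in> carrier M" for x
    using bij_betw_apply[OF h(2) inQ[OF that]] .
  define \<xi> where "\<xi> i x = (SOME c. c \<in> carrier R \<and> ?h x i = PIdl (g i) +> c)" for i x
  have \<xi>: "\<xi> i x \<in> carrier R \<and> ?h x i = PIdl (g i) +> \<xi> i x"
    if "x \<in> carrier M" "i \<in> I" for x i
  proof -
    have "\<exists>c. c \<in> carrier R \<and> ?h x i = PIdl (g i) +> c"
      using hS[OF that(1)] that(2)
      by (auto simp: finite_direct_sum_def carrier_cyclic_module PiE_iff)
    then show ?thesis unfolding \<xi>_def by (rule someI_ex)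
  qed
  have gi: "g i \<in> carrier R" if "i \<in> I" for i using g that by auto
  have "cong_mod R (g i) (\<xi> i (x \<oplus>\<^bsub>M\<^esub> y)) (\<xi> i x \<oplus> \<xi> i y)"
    if "i \<in> I" "x \<in> carrier M" "y \<in> carrier M" for i x y
  proof -
    have "?h (x \<oplus>\<^bsub>M\<^esub> y) = ?h x \<oplus>\<^bsub>?S\<^esub> ?h y"
      using h(1) inQ[OF that(2)] inQ[OF that(3)]
      unfolding quotient_module_add[OF K that(2,3), symmetric] by (simp add: module_hom_def)
    then have "?h (x \<oplus>\<^bsub>M\<^esub> y) i = ?h x i \<oplus>\<^bsub>cyclic_module R (g i)\<^esub> ?h y i"
      using that by (simp add: finite_direct_sum_def)
    then have "PIdl (g i) +> \<xi> i (x \<oplus>\<^bsub>M\<^esub> y) = PIdl (g i) +> (\<xi> i x \<oplus> \<xi> i y)"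
      using \<xi> that gi by (simp add: cyclic_module_add)
    then show ?thesis using PIdl_coset_eq_iff \<xi> that gi by simp
  qed
  moreover have smult: "cong_mod R (g i) (\<xi> i (r \<odot>\<^bsub>M\<^esub> x)) (r \<otimes> \<xi> i x)"
    if "i \<in> I" "r \<in> carrier R" "x \<in> carrier M" for i x r
  proof -
    have "?h (r \<odot>\<^bsub>M\<^esub> x) = r \<odot>\<^bsub>?S\<^esub> ?h x"
      using h(1) inQ[OF that(3)] that(2)
      unfolding quotient_module_smult[OF K that(2,3), symmetric] by (simp add: module_hom_def)
    then have "?h (r \<odot>\<^bsub>M\<^esub> x) i = r \<odot>\<^bsub>cyclic_module R (g i)\<^esub> ?h x i"
      using that by (simp add: finite_direct_sum_def)
    then have "PIdl (g i) +> \<xi> i (r \<odot>\<^bsub>M\<^esub> x) = PIdl (g i) +> (r \<otimes> \<xi> i x)"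
      using \<xi> that gi by (simp add: cyclic_module_smult)
    then show ?thesis using PIdl_coset_eq_iff \<xi> that gi by simp
  qed
  moreover have "x \<in> K \<longleftrightarrow> (\<forall>i\<in>I. g i divides \<xi> i x)" if x: "x \<in> carrier M" for x
  proof -
    \<comment> \<open>The representative chosen for the zero vector need not be
      \<open>\<zero>\<close>, only a multiple of \<open>g i\<close>.\<close>
    have zero: "cong_mod R (g i) (\<xi> i \<zero>\<^bsub>M\<^esub>) \<zero>" if "i \<in> I" for i
      using smult[OF that R.zero_closed, of "\<zero>\<^bsub>M\<^esub>"] \<xi>[OF _ that] by simp
    have "x \<in> K \<longleftrightarrow> K +>\<^bsub>M\<^esub> x = K +>\<^bsub>M\<^esub> \<zero>\<^bsub>M\<^esub>"
      using coset_eq_iff[OF K x, of "\<zero>\<^bsub>M\<^esub>"] x by (simp add: minus_zero_right)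
    also have "\<dots> \<longleftrightarrow> ?h x = ?h \<zero>\<^bsub>M\<^esub>"
      using inj_on_eq_iff[OF bij_betw_imp_inj_on[OF h(2)] inQ inQ] x by simp
    \<comment> \<open>Elements of the direct sum are extensional, so agreement on \<open>I\<close>
      is equality.\<close>
    also have "\<dots> \<longleftrightarrow> (\<forall>i\<in>I. ?h x i = ?h \<zero>\<^bsub>M\<^esub> i)"
      using hS[OF x] hS[OF M.zero_closed]
        PiE_ext[of "?h x" I "\<lambda>i. carrier (cyclic_module R (g i))" "?h \<zero>\<^bsub>M\<^esub>"]
      unfolding finite_direct_sum_def module.simps partial_object.simps by metis
    also have "\<dots> \<longleftrightarrow> (\<forall>i\<in>I. cong_mod R (g i) (\<xi> i x) (\<xi> i \<zero>\<^bsub>M\<^esub>))"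
      using \<xi> x gi by (simp add: PIdl_coset_eq_iff)
    also have "\<dots> \<longleftrightarrow> (\<forall>i\<in>I. cong_mod R (g i) (\<xi> i x) \<zero>)"
    proof (intro ball_cong refl)
      fix i assume i: "i \<in> I"
      show "cong_mod R (g i) (\<xi> i x) (\<xi> i \<zero>\<^bsub>M\<^esub>) \<longleftrightarrow> cong_mod R (g i) (\<xi> i x) \<zero>"
        using cong_mod_trans[of "g i" "\<xi> i x" "\<xi> i \<zero>\<^bsub>M\<^esub>" \<zero>]
          cong_mod_trans[of "g i" "\<xi> i x" \<zero> "\<xi> i \<zero>\<^bsub>M\<^esub>"]
          cong_mod_sym[OF _ _ _ zero[OF i]] zero[OF i] gi[OF i] \<xi>[OF _ i] x by auto
    qed
    finally show ?thesis using cong_mod_zero_iff \<xi> x gi by simp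
  qed
  moreover have "\<exists>x\<in>carrier M. \<forall>i\<in>I. cong_mod R (g i) (\<xi> i x) (c i)" if c: "c \<in> I \<rightarrow> carrier R" for c
  proof -
    have "(\<lambda>i\<in>I. PIdl (g i) +> c i) \<in> carrier ?S"
      using c by (auto simp: finite_direct_sum_def carrier_cyclic_module)
    then have "(\<lambda>i\<in>I. PIdl (g i) +> c i) \<in> ?h ` carrier M"
      unfolding bij_betw_imp_surj_on[OF h(2), symmetric] carrier_quotient_module image_image .
    then obtain x where x: "(\<lambda>i\<in>I. PIdl (g i) +> c i) = ?h x" "x \<in> carrier M"
      by (rule imageE)
    have "cong_mod R (g i) (\<xi> i x) (c i)" if i: "i \<in> I" for i
    proof -
      have "PIdl (g i) +> \<xi> i x = PIdl (g i) +> c i"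
        using \<xi>[OF x(2) i] fun_cong[OF x(1), of i] i by simp
      then show ?thesis using PIdl_coset_eq_iff[OF gi[OF i]] \<xi>[OF x(2) i] c i by auto
    qed
    then show ?thesis using x(2) by blast
  qed
  ultimately show ?thesis
    using \<xi> by (intro exI[of _ \<xi>]) (auto simp: quotient_coordinates_def linear_mod_def)
qed

text \<open>The way back from congruences to modules. For empty \<open>I\<close> the coordinates say
  that \<open>K\<close> is all of \<open>M\<close>, and both sides have exactly one element.\<close>

lemma isomorphic_if_quotient_coordinates:
  assumes K: "submodule K R M" and g: "g \<in> I \<rightarrow> carrier R"
    and \<xi>: "quotient_coordinates R M K I g \<xi>"
  shows "module_isomorphic R (quotient_module M K)
      (finite_direct_sum I (\<lambda>i. cyclic_module R (g i)))"
proof (rule first_isomorphism[OF K])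
  let ?S = "finite_direct_sum I (\<lambda>i. cyclic_module R (g i))"
  let ?h = "\<lambda>x. \<lambda>i\<in>I. PIdl (g i) +> \<xi> i x"
  have gi: "g i \<in> carrier R" if "i \<in> I" for i using g that by auto
  have lin: "linear_mod R M (g i) (\<xi> i)" if "i \<in> I" for i
    using \<xi> that by (simp add: quotient_coordinates_def)
  note D = linear_modD[OF lin]
  have S: "?h x \<in> carrier ?S" if "x \<in> carrier M" for x
    using D(1) that by (auto simp: finite_direct_sum_def carrier_cyclic_module)
  moreover have "?h (x \<oplus>\<^bsub>M\<^esub> y) = ?h x \<oplus>\<^bsub>?S\<^esub> ?h y" if "x \<in> carrier M" "y \<in> carrier M" for x y
  proof -
    have "PIdl (g i) +> \<xi> i (x \<oplus>\<^bsub>M\<^esub> y) = PIdl (g i) +> (\<xi> i x \<oplus> \<xi> i y)" if "i \<in> I" for i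
      using that D \<open>x \<in> carrier M\<close> \<open>y \<in> carrier M\<close> gi by (simp add: PIdl_coset_eq_iff)
    then show ?thesis
      using that D(1) gi
      by (simp add: finite_direct_sum_def cyclic_module_add cong: restrict_cong)
  qed
  moreover have "?h (r \<odot>\<^bsub>M\<^esub> x) = r \<odot>\<^bsub>?S\<^esub> ?h x" if "x \<in> carrier M" "r \<in> carrier R" for x r
  proof -
    have "PIdl (g i) +> \<xi> i (r \<odot>\<^bsub>M\<^esub> x) = PIdl (g i) +> (r \<otimes> \<xi> i x)" if "i \<in> I" for i
      using that D \<open>x \<in> carrier M\<close> \<open>r \<in> carrier R\<close> gi by (simp add: PIdl_coset_eq_iff)
    then show ?thesis
      using that D(1) gi
      by (simp add: finite_direct_sum_def cyclic_module_smult cong: restrict_cong)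
  qed
  ultimately show "?h \<in> module_hom R M ?S" by (simp add: module_hom_def)
  show "?h ` carrier M = carrier ?S"
  proof (intro equalityI subsetI)
    fix X assume "X \<in> ?h ` carrier M" then show "X \<in> carrier ?S" using S by auto
  next
    fix X assume X: "X \<in> carrier ?S"
    then have "\<forall>i\<in>I. \<exists>c\<in>carrier R. X i = PIdl (g i) +> c"
      by (auto simp: finite_direct_sum_def carrier_cyclic_module PiE_iff)
    then obtain c where c: "\<forall>i\<in>I. c i \<in> carrier R \<and> X i = PIdl (g i) +> c i" by metis
    then obtain x where x: "x \<in> carrier M" "\<forall>i\<in>I. cong_mod R (g i) (\<xi> i x) (c i)"
      using \<xi> unfolding quotient_coordinates_def by (metis Pi_I)
    have "?h x i = X i" if i: "i \<in> I" for i
      using x(2) c i D(1)[OF i x(1)] PIdl_coset_eq_iff[OF gi[OF i]] by simp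
    then have "?h x = X"
      using X S[OF x(1)] unfolding finite_direct_sum_def module.simps partial_object.simps
      by (intro PiE_ext[of _ I "\<lambda>i. carrier (cyclic_module R (g i))"]) simp_all
    then show "X \<in> ?h ` carrier M" using x(1) by blast
  qed
  fix x y assume xy: "x \<in> carrier M" "y \<in> carrier M"
  have "?h x = ?h y \<longleftrightarrow> (\<forall>i\<in>I. PIdl (g i) +> \<xi> i x = PIdl (g i) +> \<xi> i y)"
    by (metis (no_types, lifting) restrict_apply' restrict_ext)
  also have "\<dots> \<longleftrightarrow> (\<forall>i\<in>I. g i divides (\<xi> i x \<ominus> \<xi> i y))"
    using PIdl_coset_eq_iff gi D(1) xy by (simp add: cong_mod_def)
  also have "\<dots> \<longleftrightarrow> (\<forall>i\<in>I. g i divides \<xi> i (x \<ominus>\<^bsub>M\<^esub> y))"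
    using cong_mod_divides_iff[OF linear_mod_minus[OF lin gi xy]] gi D(1) xy by simp
  also have "\<dots> \<longleftrightarrow> x \<ominus>\<^bsub>M\<^esub> y \<in> K"
    using \<xi> xy by (simp add: quotient_coordinates_def)
  finally show "?h x = ?h y \<longleftrightarrow> x \<ominus>\<^bsub>M\<^esub> y \<in> K" .
qed

end

subsection \<open>Splitting off an element of maximal order\<close>

context module begin

lemma mem_span_sum_iff:
  assumes K: "submodule K R M" and v: "v \<in> carrier M" and x: "x \<in> carrier M"
  shows "x \<in> (\<lambda>r. r \<odot>\<^bsub>M\<^esub> v) ` carrier R <+>\<^bsub>M\<^esub> K \<longleftrightarrow>
    (\<exists>r\<in>carrier R. x \<ominus>\<^bsub>M\<^esub> r \<odot>\<^bsub>M\<^esub> v \<in> K)" (is "?L \<longleftrightarrow> ?R")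
proof
  assume ?L
  then obtain r m where r: "r \<in> carrier R" "m \<in> K" "x = r \<odot>\<^bsub>M\<^esub> v \<oplus>\<^bsub>M\<^esub> m"
    by (auto simp: set_add_def')
  moreover have "m \<in> carrier M" using r submoduleE(1)[OF K] by blast
  ultimately have "x \<ominus>\<^bsub>M\<^esub> r \<odot>\<^bsub>M\<^esub> v = m"
    using v by (simp add: a_minus_def M.a_ac M.r_neg1 M.r_neg2 M.l_neg M.r_neg)
  then show ?R using r(1,2) by (intro bexI[of _ r]) simp_all
next
  assume ?R
  then obtain r where r: "r \<in> carrier R" "x \<ominus>\<^bsub>M\<^esub> r \<odot>\<^bsub>M\<^esub> v \<in> K" by auto
  moreover have "x = r \<odot>\<^bsub>M\<^esub> v \<oplus>\<^bsub>M\<^esub> (x \<ominus>\<^bsub>M\<^esub> r \<odot>\<^bsub>M\<^esub> v)"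
    using v x r(1) by (simp add: a_minus_def M.a_lcomm M.r_neg)
  ultimately show ?L unfolding set_add_def' by blast
qed

text \<open>Coefficients of \<open>v\<close> modulo \<open>K\<close> are not unique, but they add
  and, by the next lemma, scale. This gives the closure of R v + K, and later the homomorphism from
  R v + K to R/d.\<close>

lemma span_coefficient_add:
  assumes K: "submodule K R M" and v: "v \<in> carrier M"
    and x: "x \<in> carrier M" "r \<in> carrier R" "x \<ominus>\<^bsub>M\<^esub> r \<odot>\<^bsub>M\<^esub> v \<in> K"
    and y: "y \<in> carrier M" "q \<in> carrier R" "y \<ominus>\<^bsub>M\<^esub> q \<odot>\<^bsub>M\<^esub> v \<in> K"
  shows "(x \<oplus>\<^bsub>M\<^esub> y) \<ominus>\<^bsub>M\<^esub> (r \<oplus> q) \<odot>\<^bsub>M\<^esub> v \<in> K"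
proof -
  have "(x \<oplus>\<^bsub>M\<^esub> y) \<ominus>\<^bsub>M\<^esub> (r \<oplus> q) \<odot>\<^bsub>M\<^esub> v
      = (x \<ominus>\<^bsub>M\<^esub> r \<odot>\<^bsub>M\<^esub> v) \<oplus>\<^bsub>M\<^esub> (y \<ominus>\<^bsub>M\<^esub> q \<odot>\<^bsub>M\<^esub> v)"
    using x(1,2) y(1,2) v by (simp add: a_minus_def smult_l_distr M.minus_add M.a_ac)
  then show ?thesis using submoduleE(5)[OF K x(3) y(3)] by simp
qed

lemma span_coefficient_smult:
  assumes K: "submodule K R M" and v: "v \<in> carrier M" and c: "c \<in> carrier R"
    and x: "x \<in> carrier M" "r \<in> carrier R" "x \<ominus>\<^bsub>M\<^esub> r \<odot>\<^bsub>M\<^esub> v \<in> K"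
  shows "c \<odot>\<^bsub>M\<^esub> x \<ominus>\<^bsub>M\<^esub> (c \<otimes> r) \<odot>\<^bsub>M\<^esub> v \<in> K"
proof -
  have "c \<odot>\<^bsub>M\<^esub> x \<ominus>\<^bsub>M\<^esub> (c \<otimes> r) \<odot>\<^bsub>M\<^esub> v = c \<odot>\<^bsub>M\<^esub> (x \<ominus>\<^bsub>M\<^esub> r \<odot>\<^bsub>M\<^esub> v)"
    using c x(1,2) v by (simp add: smult_minus_right smult_assoc1)
  then show ?thesis using submoduleE(4)[OF K c x(3)] by simp
qed

lemma submodule_span_sum:
  assumes K: "submodule K R M" and v: "v \<in> carrier M"
  shows "submodule ((\<lambda>r. r \<odot>\<^bsub>M\<^esub> v) ` carrier R <+>\<^bsub>M\<^esub> K) R M" (is "submodule ?P R M")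
proof -
  note KE = submoduleE[OF K]
  have Pc: "?P \<subseteq> carrier M" using KE(1) v by (auto simp: set_add_def')
  have z: "\<zero>\<^bsub>M\<^esub> \<in> K"
    using subgroup.one_closed[OF submodule.axioms(1)[OF K]] by simp
  have I: "x \<in> ?P" if "x \<in> carrier M" "r \<in> carrier R" "x \<ominus>\<^bsub>M\<^esub> r \<odot>\<^bsub>M\<^esub> v \<in> K" for x r
    using mem_span_sum_iff[OF K v] that by blast
  have Pc': "x \<in> carrier M" if "x \<in> ?P" for x using Pc that by (rule subsetD)
  have E: "\<exists>r\<in>carrier R. x \<ominus>\<^bsub>M\<^esub> r \<odot>\<^bsub>M\<^esub> v \<in> K" if "x \<in> ?P" for x
    using mem_span_sum_iff[OF K v Pc'[OF that]] that by (rule iffD1)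
  have add: "x \<oplus>\<^bsub>M\<^esub> y \<in> ?P" if xy: "x \<in> ?P" "y \<in> ?P" for x y
  proof -
    obtain r q where rq: "r \<in> carrier R" "q \<in> carrier R"
      "x \<ominus>\<^bsub>M\<^esub> r \<odot>\<^bsub>M\<^esub> v \<in> K" "y \<ominus>\<^bsub>M\<^esub> q \<odot>\<^bsub>M\<^esub> v \<in> K"
      using E[OF xy(1)] E[OF xy(2)] by (elim bexE)
    then show ?thesis
      using span_coefficient_add[OF K v Pc'[OF xy(1)] _ _ Pc'[OF xy(2)]] Pc'[OF xy(1)] Pc'[OF xy(2)]
      by (intro I[of _ "r \<oplus> q"]) simp_all
  qed
  have smult: "c \<odot>\<^bsub>M\<^esub> x \<in> ?P" if c: "c \<in> carrier R" "x \<in> ?P" for c x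
  proof -
    obtain r where r: "r \<in> carrier R" "x \<ominus>\<^bsub>M\<^esub> r \<odot>\<^bsub>M\<^esub> v \<in> K"
      using E[OF c(2)] by (elim bexE)
    then show ?thesis
      using span_coefficient_smult[OF K v c(1) Pc'[OF c(2)]] c(1) Pc'[OF c(2)]
      by (intro I[of _ "c \<otimes> r"]) simp_all
  qed
  have "\<ominus>\<^bsub>M\<^esub> x \<in> ?P" if "x \<in> ?P" for x
    using smult[OF _ that, of "\<ominus> \<one>"] Pc'[OF that] by (simp add: smult_l_minus)
  moreover have "\<zero>\<^bsub>M\<^esub> \<in> ?P"
    using I[of "\<zero>\<^bsub>M\<^esub>" \<zero>] z v by (simp add: minus_zero_right)
  ultimately show ?thesis
    using Pc add smult by (intro submoduleI)
qed

lemma subset_span_sum: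
  assumes K: "submodule K R M" and v: "v \<in> carrier M"
  shows "K \<subseteq> (\<lambda>r. r \<odot>\<^bsub>M\<^esub> v) ` carrier R <+>\<^bsub>M\<^esub> K"
proof
  fix x assume x: "x \<in> K"
  then have xc: "x \<in> carrier M" using submoduleE(1)[OF K] by blast
  show "x \<in> (\<lambda>r. r \<odot>\<^bsub>M\<^esub> v) ` carrier R <+>\<^bsub>M\<^esub> K"
    unfolding mem_span_sum_iff[OF K v xc]
    using x xc v by (intro bexI[of _ \<zero>]) (simp_all add: minus_zero_right)
qed

end

locale pid_module = module R M + principal_domain R for R (structure) and M (structure)

text \<open>An element whose annihilator modulo \<open>K\<close> is the smallest possible can be split off: \<open>lam\<close> below
  is a retraction \<open>M/K \<rightarrow> R/g\<^sub>s\<close> of \<open>r \<mapsto> r v\<close>, and stable range one lets us choose it so that the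
  coefficient of the last coordinate is a unit, so that the remaining coordinates, corrected by
  multiples of \<open>lam\<close>, are coordinates modulo \<open>R v + K\<close>.\<close>

lemma (in pid_module) split_off_maximal_order_element:
  assumes K: "submodule K R M" and I: "finite I" "s \<notin> I"
    and g: "g \<in> insert s I \<rightarrow> carrier R" "\<And>i. i \<in> I \<Longrightarrow> g i divides g s" "g s \<noteq> \<zero>"
    and \<xi>: "quotient_coordinates R M K (insert s I) g \<xi>"
    and v: "v \<in> carrier M"
    and ann: "\<And>r. \<lbrakk>r \<in> carrier R; r \<odot>\<^bsub>M\<^esub> v \<in> K\<rbrakk> \<Longrightarrow> g s divides r"
  shows "\<exists>\<xi>'. quotient_coordinates R M ((\<lambda>r. r \<odot>\<^bsub>M\<^esub> v) ` carrier R <+>\<^bsub>M\<^esub> K) I g \<xi>'"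
proof -
  have gi: "g i \<in> carrier R" if "i \<in> I" for i using g that by auto
  have gs: "g s \<in> carrier R" using g by auto
  have lin: "linear_mod R M (g i) (\<xi> i)" if "i \<in> I" for i
    using \<xi> that by (simp add: quotient_coordinates_def)
  have lins: "linear_mod R M (g s) (\<xi> s)" using \<xi> by (simp add: quotient_coordinates_def)
  have memK: "x \<in> K \<longleftrightarrow> g s divides \<xi> s x \<and> (\<forall>i\<in>I. g i divides \<xi> i x)" if "x \<in> carrier M" for x
    using \<xi> that by (simp add: quotient_coordinates_def)
  note D = linear_modD[OF lin] and Ds = linear_modD[OF lins]
  have "\<exists>q\<in>carrier R. g s = g i \<otimes> q" if "i \<in> I" for i
    using g(2)[OF that] by (auto simp: factor_def)
  then obtain q where q: "\<And>i. i \<in> I \<Longrightarrow> q i \<in> carrier R" "\<And>i. i \<in> I \<Longrightarrow> g s = g i \<otimes> q i"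
    by metis
  have qv: "(\<lambda>i. q i \<otimes> \<xi> i v) \<in> I \<rightarrow> carrier R" using q D(1) v by auto
  \<comment> \<open>These coefficients gather all coordinates except the \<open>s\<close>-th into a
    single form \<open>\<sigma>\<close> modulo \<open>g s\<close>, whose value at \<open>v\<close>
    divides every \<open>q i \<otimes> \<xi> i v\<close>. Stable range one is then needed only for
    the two elements \<open>\<xi> s v\<close> and \<open>\<sigma> v\<close>.\<close>
  obtain b where b: "b \<in> I \<rightarrow> carrier R"
    "\<forall>i\<in>I. (\<Oplus>j\<in>I. b j \<otimes> (q j \<otimes> \<xi> j v)) divides (q i \<otimes> \<xi> i v)"
    using bezout_finsum[OF I(1) qv] by blast
  have bc: "b i \<in> carrier R" if "i \<in> I" for i using b(1) that by auto
  define \<sigma> where "\<sigma> x = (\<Oplus>j\<in>I. b j \<otimes> (q j \<otimes> \<xi> j x))" for x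
  have lin_bq: "linear_mod R M (g s) (\<lambda>x. b j \<otimes> (q j \<otimes> \<xi> j x))" if "j \<in> I" for j
    using linear_mod_scale_modulus[OF lin[OF that] gi[OF that] q(1)[OF that]] q(2)[OF that]
      linear_mod_scale[of "g s" "\<lambda>x. q j \<otimes> \<xi> j x" "b j"] gs bc[OF that] by simp
  have lin\<sigma>: "linear_mod R M (g s) \<sigma>"
    unfolding \<sigma>_def using linear_mod_finsum[OF I(1) lin_bq gs] .
  have \<sigma>: "\<sigma> x \<in> carrier R" if "x \<in> carrier M" for x
    using linear_modD(1)[OF lin\<sigma> that] .
  \<comment> \<open>One statement for three uses: \<open>r\<close> is 0 for vectors in
    \<open>K\<close>, \<open>lam x\<close> for vectors killed by the new coordinates, and 1 in the
    proof of surjectivity.\<close>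
  have \<sigma>_cong: "cong_mod R (g s) (\<sigma> x) (r \<otimes> (\<Oplus>j\<in>I. b j \<otimes> (q j \<otimes> c j)))"
    if x: "x \<in> carrier M" and r: "r \<in> carrier R" and c: "\<And>i. i \<in> I \<Longrightarrow> c i \<in> carrier R"
      and xc: "\<And>i. i \<in> I \<Longrightarrow> cong_mod R (g i) (\<xi> i x) (r \<otimes> c i)" for x r c
  proof -
    have "cong_mod R (g s) (b i \<otimes> (q i \<otimes> \<xi> i x)) (r \<otimes> (b i \<otimes> (q i \<otimes> c i)))" if i: "i \<in> I" for i
    proof -
      note bi = bc[OF i]
      have "cong_mod R (g s) (q i \<otimes> \<xi> i x) (q i \<otimes> (r \<otimes> c i))"
        using cong_mod_scale_modulus[OF xc[OF i]] gi i D(1) x q r c by auto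
      then have "cong_mod R (g s) (b i \<otimes> (q i \<otimes> \<xi> i x)) (b i \<otimes> (q i \<otimes> (r \<otimes> c i)))"
        using cong_mod_scale gs bi D(1) x q r c i by auto
      moreover have "b i \<otimes> (q i \<otimes> (r \<otimes> c i)) = r \<otimes> (b i \<otimes> (q i \<otimes> c i))"
        using bi q(1)[OF i] r c[OF i] by (simp add: m_ac)
      ultimately show ?thesis by simp
    qed
    then have "cong_mod R (g s) (\<sigma> x) (\<Oplus>i\<in>I. r \<otimes> (b i \<otimes> (q i \<otimes> c i)))"
      unfolding \<sigma>_def using I bc q(1) D(1) x r c gs by (intro cong_mod_finsum) auto
    also have "(\<Oplus>i\<in>I. r \<otimes> (b i \<otimes> (q i \<otimes> c i))) = r \<otimes> (\<Oplus>j\<in>I. b j \<otimes> (q j \<otimes> c j))"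
      using I bc q(1) c r by (intro R.finsum_rdistr[symmetric]) auto
    finally show ?thesis .
  qed
  note \<sigma>v = \<sigma>[OF v] and xsv = Ds(1)[OF v]

  \<comment> \<open>Two applications of Bezout give a common divisor \<open>?e\<close> of
    \<open>\<xi> s v\<close>, \<open>\<sigma> v\<close> and \<open>g s\<close>, as a combination of
    them. Its cofactor \<open>k\<close> in \<open>g s\<close> maps \<open>v\<close> into
    \<open>K\<close>, so \<open>g s\<close> divides \<open>k\<close>, and cancelling
    \<open>g s\<close> shows that \<open>?e\<close> is a unit.\<close>
  have "\<exists>\<alpha>\<in>carrier R. \<exists>\<beta>\<in>carrier R. \<exists>\<gamma>\<in>carrier R. \<alpha> \<otimes> \<xi> s v \<oplus> \<beta> \<otimes> \<sigma> v \<oplus> \<gamma> \<otimes> g s = \<one>"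
  proof -
    obtain \<alpha> \<beta> where ab: "\<alpha> \<in> carrier R" "\<beta> \<in> carrier R"
      "(\<alpha> \<otimes> \<xi> s v \<oplus> \<beta> \<otimes> \<sigma> v) divides \<xi> s v" "(\<alpha> \<otimes> \<xi> s v \<oplus> \<beta> \<otimes> \<sigma> v) divides \<sigma> v"
      using bezout[OF xsv \<sigma>v] .
    let ?d = "\<alpha> \<otimes> \<xi> s v \<oplus> \<beta> \<otimes> \<sigma> v"
    have d: "?d \<in> carrier R" using ab \<sigma>v xsv by simp
    obtain \<gamma> \<delta> where cd: "\<gamma> \<in> carrier R" "\<delta> \<in> carrier R"
      "(\<gamma> \<otimes> ?d \<oplus> \<delta> \<otimes> g s) divides ?d" "(\<gamma> \<otimes> ?d \<oplus> \<delta> \<otimes> g s) divides g s"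
      using bezout[OF d gs] .
    let ?e = "\<gamma> \<otimes> ?d \<oplus> \<delta> \<otimes> g s"
    have e: "?e \<in> carrier R" using cd d gs by simp
    obtain k where k: "k \<in> carrier R" "g s = ?e \<otimes> k" using cd(4) by (meson dividesE)
    have e_s: "?e divides \<xi> s v" using divides_trans[OF cd(3) ab(3)] e by simp
    have e_i: "?e divides (q i \<otimes> \<xi> i v)" if "i \<in> I" for i
      using divides_trans[OF cd(3) divides_trans[OF ab(4)]] b(2) that e d by (simp add: \<sigma>_def)
    have "g s divides (k \<otimes> \<xi> s v)"
      using divides_mult[OF e k(1) e_s] k e by (simp add: m_comm)
    moreover have "g i divides (k \<otimes> \<xi> i v)" if i: "i \<in> I" for i
    proof -
      have qi: "q i \<in> carrier R" "\<xi> i v \<in> carrier R" using q D(1) i v by auto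
      \<comment> \<open>As \<open>g s\<close> is nonzero, so is \<open>q i\<close>. It can be
        cancelled, which turns divisibility of the scaled coordinate by \<open>g s\<close> into
        divisibility of the coordinate by \<open>g i\<close>.\<close>
      have "q i \<noteq> \<zero>" using q(2)[OF i] g(3) gi[OF i] by auto
      have "k \<otimes> ?e divides (k \<otimes> (q i \<otimes> \<xi> i v))"
        using divides_mult[OF e k(1) e_i[OF i]] .
      then have "q i \<otimes> g i divides (q i \<otimes> (k \<otimes> \<xi> i v))"
        using k e q(2)[OF i] qi gi[OF i] by (simp add: m_ac)
      then show ?thesis
        using mult_divides[of "g i" "k \<otimes> \<xi> i v" "q i"] \<open>q i \<noteq> \<zero>\<close> qi gi[OF i] k(1) by simp
    qed
    ultimately have "k \<odot>\<^bsub>M\<^esub> v \<in> K"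
      using memK[of "k \<odot>\<^bsub>M\<^esub> v"] cong_mod_divides_iff[OF D(3)[OF _ k(1) v]] D(1)
        cong_mod_divides_iff[OF Ds(3)[OF k(1) v]] Ds(1) gi gs k(1) v by simp
    then have "g s divides k" using ann k(1) by blast
    then obtain l where l: "l \<in> carrier R" "k = g s \<otimes> l" by (meson dividesE)
    then have "g s \<otimes> \<one> = g s \<otimes> (?e \<otimes> l)" using k e gs by (metis m_assoc m_comm r_one)
    then have "?e \<otimes> l = \<one>" using m_lcancel[of "g s" \<one> "?e \<otimes> l"] gs g(3) e l by simp
    moreover have "(l \<otimes> \<gamma> \<otimes> \<alpha>) \<otimes> \<xi> s v \<oplus> (l \<otimes> \<gamma> \<otimes> \<beta>) \<otimes> \<sigma> v \<oplus> (l \<otimes> \<delta>) \<otimes> g s = ?e \<otimes> l"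
      using l(1) ab(1,2) cd(1,2) \<sigma>v xsv gs by algebra
    ultimately show ?thesis using l(1) ab(1,2) cd(1,2) by (metis m_closed)
  qed
  then obtain t where t: "t \<in> carrier R" "comaximal R (\<xi> s v \<oplus> t \<otimes> \<sigma> v) (g s)"
    using stable_range_one[OF gs g(3) xsv \<sigma>v] by blast
  define w where "w = \<xi> s v \<oplus> t \<otimes> \<sigma> v"
  have w: "w \<in> carrier R" using w_def xsv \<sigma>v t by simp
  \<comment> \<open>\<open>w'\<close> inverts \<open>w\<close> modulo \<open>g s\<close>. As a
    factor of \<open>lam\<close> it normalizes the value at \<open>v\<close> to 1, while the
    coefficient of \<open>\<xi> s\<close> remains a unit.\<close>
  obtain w' \<beta> where w': "w' \<in> carrier R" "\<beta> \<in> carrier R" "w' \<otimes> w \<oplus> \<beta> \<otimes> g s = \<one>"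
    using t(2) by (auto simp: comaximal_def w_def)
  have w'w: "cong_mod R (g s) (w' \<otimes> w) \<one>"
  proof -
    have "w' \<otimes> w \<ominus> (w' \<otimes> w \<oplus> \<beta> \<otimes> g s) = g s \<otimes> (\<ominus> \<beta>)" using w w'(1,2) gs by algebra
    then show ?thesis using w'(2) by (simp add: cong_mod_def w'(3) dividesI[of "\<ominus> \<beta>"])
  qed

  define lam where "lam x = w' \<otimes> (\<xi> s x \<oplus> t \<otimes> \<sigma> x)" for x
  have lin_lam: "linear_mod R M (g s) lam"
    unfolding lam_def
    by (intro linear_mod_scale linear_mod_add lins lin\<sigma> gs t w')
  note Dl = linear_modD[OF lin_lam]
  have lam_v: "cong_mod R (g s) (lam v) \<one>" using w'w by (simp add: lam_def w_def)
  \<comment> \<open>The corrected coordinates send \<open>v\<close> to 0, as \<open>lam v\<close> is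
    1 modulo \<open>g s\<close> and hence modulo \<open>g i\<close>. The sign sits on the constant
    so that this is the sum of a coordinate and a scaled form.\<close>
  define \<xi>' where "\<xi>' i x = \<xi> i x \<oplus> (\<ominus> \<xi> i v) \<otimes> lam x" for i x
  have \<xi>'_eq: "\<xi>' i x = \<xi> i x \<ominus> lam x \<otimes> \<xi> i v" if "i \<in> I" "x \<in> carrier M" for i x
    using D(1)[OF that] D(1)[OF that(1) v] Dl(1)[OF that(2)] unfolding \<xi>'_def by algebra
  have lin': "linear_mod R M (g i) (\<xi>' i)" if i: "i \<in> I" for i
    unfolding \<xi>'_def
    by (intro linear_mod_add linear_mod_scale lin[OF i] gi[OF i]
        linear_mod_weaken[OF lin_lam g(2)[OF i]] gs) (use D(1)[OF i v] in simp)
  note D' = linear_modD[OF lin']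
  have lam_K: "g s divides lam m" if m: "m \<in> K" "m \<in> carrier M" for m
  proof -
    have mi: "g i divides \<xi> i m" if "i \<in> I" for i using memK m that by blast
    have "cong_mod R (g s) (\<sigma> m) (\<zero> \<otimes> (\<Oplus>j\<in>I. b j \<otimes> (q j \<otimes> \<one>)))"
      using mi gi D(1) m by (intro \<sigma>_cong) (auto simp: cong_mod_zero_iff)
    moreover have "(\<Oplus>j\<in>I. b j \<otimes> (q j \<otimes> \<one>)) \<in> carrier R"
      using bc q(1) by (intro R.finsum_closed) auto
    ultimately have "g s divides \<sigma> m" using cong_mod_zero_iff gs \<sigma> m by simp
    then show ?thesis
      unfolding lam_def using memK m gs Ds(1) \<sigma> t w'
      by (intro divides_mult_left divides_add) auto
  qed
  have "x \<in> (\<lambda>r. r \<odot>\<^bsub>M\<^esub> v) ` carrier R <+>\<^bsub>M\<^esub> K \<longleftrightarrow> (\<forall>i\<in>I. g i divides \<xi>' i x)"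
    if x: "x \<in> carrier M" for x
  proof
    assume "x \<in> (\<lambda>r. r \<odot>\<^bsub>M\<^esub> v) ` carrier R <+>\<^bsub>M\<^esub> K"
    then obtain r where r: "r \<in> carrier R" "x \<ominus>\<^bsub>M\<^esub> r \<odot>\<^bsub>M\<^esub> v \<in> K"
      using mem_span_sum_iff[OF K v x] by blast
    let ?m = "x \<ominus>\<^bsub>M\<^esub> r \<odot>\<^bsub>M\<^esub> v"
    have m: "?m \<in> carrier M" using x r(1) v by simp
    have rv: "r \<odot>\<^bsub>M\<^esub> v \<in> carrier M" using r v by simp
    \<comment> \<open>Both parts of x = m + r v are sent to 0: \<open>?m\<close> because
      \<open>\<xi> i\<close> and \<open>lam\<close> vanish on \<open>K\<close>, and \<open>v\<close>
      by the choice of the correction.\<close>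
    show "\<forall>i\<in>I. g i divides \<xi>' i x"
    proof
      fix i assume i: "i \<in> I"
      have "g i divides \<xi> i ?m" using memK[OF m] r i by blast
      moreover have "g i divides lam ?m"
        using divides_trans[OF g(2)[OF i] lam_K[OF r(2) m]] gi[OF i] by simp
      ultimately have m': "g i divides \<xi>' i ?m"
        unfolding \<xi>'_eq[OF i m] using D(1)[OF i] Dl(1) gi[OF i] m v
        by (intro divides_minus) (auto simp: m_comm intro: divides_mult_left)
      have "cong_mod R (g i) (\<xi>' i v) \<zero>"
      proof -
        have "cong_mod R (g i) (\<xi> i v \<ominus> lam v \<otimes> \<xi> i v) (\<xi> i v \<ominus> \<one> \<otimes> \<xi> i v)"
          using D(1)[OF i v] Dl(1)[OF v] gi[OF i]
            cong_mod_scale[OF cong_mod_weaken[OF lam_v g(2)[OF i] gs], of "\<xi> i v"]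
          by (intro cong_mod_minus) (auto simp: m_comm)
        moreover have "\<xi> i v \<ominus> \<one> \<otimes> \<xi> i v = \<zero>" using D(1)[OF i v] by algebra
        ultimately show ?thesis using \<xi>'_eq[OF i v] by simp
      qed
      then have v': "g i divides \<xi>' i v" using cong_mod_zero_iff gi[OF i] D'(1)[OF i v] by simp
      have "cong_mod R (g i) (\<xi>' i ?m) (\<xi>' i x \<ominus> r \<otimes> \<xi>' i v)"
        using linear_mod_minus_smult[OF lin'[OF i] gi[OF i] r(1) x v] .
      then have "g i divides (\<xi>' i x \<ominus> r \<otimes> \<xi>' i v)"
        using cong_mod_divides_iff m' gi[OF i] D'(1)[OF i] m x v r(1) by auto
      then have "g i divides ((\<xi>' i x \<ominus> r \<otimes> \<xi>' i v) \<oplus> r \<otimes> \<xi>' i v)"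
        using v' gi[OF i] D'(1)[OF i] x v r(1) by (intro divides_add divides_mult_left) auto
      moreover have "(\<xi>' i x \<ominus> r \<otimes> \<xi>' i v) \<oplus> r \<otimes> \<xi>' i v = \<xi>' i x"
        using D'(1)[OF i x] D'(1)[OF i v] r(1) by algebra
      ultimately show "g i divides \<xi>' i x" by simp
    qed
  next
    \<comment> \<open>The multiple of \<open>v\<close> to subtract from \<open>x\<close> is the one
      with coefficient \<open>lam x\<close>. Away from \<open>s\<close> the coordinates of both
      agree by assumption, hence so do the values of \<open>\<sigma>\<close>. Since
      \<open>w \<otimes> lam x\<close> is congruent to
      \<open>\<xi> s x \<oplus> t \<otimes> \<sigma> x\<close>, and \<open>w\<close> contains
      \<open>\<xi> s v\<close> with coefficient 1, the \<open>s\<close>-th coordinates agree as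
      well.\<close>
    assume x': "\<forall>i\<in>I. g i divides \<xi>' i x"
    have lx: "lam x \<in> carrier R" using Dl(1) x .
    have ci: "cong_mod R (g i) (\<xi> i x) (lam x \<otimes> \<xi> i v)" if "i \<in> I" for i
      using x' that unfolding cong_mod_def \<xi>'_eq[OF that x, symmetric] by blast
    have "cong_mod R (g s) (\<sigma> x) (lam x \<otimes> \<sigma> v)"
      unfolding \<sigma>_def[of v] using \<sigma>_cong[OF x lx _ ci] D(1) v by simp
    then have 1: "cong_mod R (g s) (t \<otimes> \<sigma> x) (t \<otimes> (lam x \<otimes> \<sigma> v))"
      using cong_mod_scale gs \<sigma> x v lx t(1) by simp
    have y: "\<xi> s x \<oplus> t \<otimes> \<sigma> x \<in> carrier R" using Ds(1) \<sigma> x t(1) by simp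
    have "cong_mod R (g s) (w \<otimes> lam x) (\<xi> s x \<oplus> t \<otimes> \<sigma> x)"
    proof -
      have "cong_mod R (g s) ((\<xi> s x \<oplus> t \<otimes> \<sigma> x) \<otimes> (w' \<otimes> w)) ((\<xi> s x \<oplus> t \<otimes> \<sigma> x) \<otimes> \<one>)"
        using cong_mod_scale[OF w'w] gs y w w'(1) by simp
      moreover have "w \<otimes> lam x = (\<xi> s x \<oplus> t \<otimes> \<sigma> x) \<otimes> (w' \<otimes> w)"
        unfolding lam_def using y w w'(1) by (simp add: m_ac)
      ultimately show ?thesis using y by simp
    qed
    then have "cong_mod R (g s) (w \<otimes> lam x \<ominus> t \<otimes> (lam x \<otimes> \<sigma> v))
        ((\<xi> s x \<oplus> t \<otimes> \<sigma> x) \<ominus> t \<otimes> \<sigma> x)"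
      using cong_mod_sym[OF _ _ _ 1] gs w lx y \<sigma>[OF x] \<sigma>v t(1) by (intro cong_mod_minus) auto
    moreover have "w \<otimes> lam x \<ominus> t \<otimes> (lam x \<otimes> \<sigma> v) = lam x \<otimes> \<xi> s v"
      unfolding w_def using xsv \<sigma>v t(1) lx by algebra
    moreover have "(\<xi> s x \<oplus> t \<otimes> \<sigma> x) \<ominus> t \<otimes> \<sigma> x = \<xi> s x"
      using Ds(1)[OF x] \<sigma>[OF x] t(1) by algebra
    ultimately have cs: "cong_mod R (g s) (\<xi> s x) (lam x \<otimes> \<xi> s v)"
      using cong_mod_sym gs Ds(1) x v lx by simp
    have m: "x \<ominus>\<^bsub>M\<^esub> lam x \<odot>\<^bsub>M\<^esub> v \<in> carrier M" using x lx v by simp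
    have "g s divides \<xi> s (x \<ominus>\<^bsub>M\<^esub> lam x \<odot>\<^bsub>M\<^esub> v)"
      using cong_mod_divides_iff[OF linear_mod_minus_smult[OF lins gs lx x v]] cs gs Ds(1) m x v lx
      by (simp add: cong_mod_def)
    moreover have "g i divides \<xi> i (x \<ominus>\<^bsub>M\<^esub> lam x \<odot>\<^bsub>M\<^esub> v)" if i: "i \<in> I" for i
      using cong_mod_divides_iff[OF linear_mod_minus_smult[OF lin[OF i] gi[OF i] lx x v]]
        ci[OF i] gi[OF i] D(1)[OF i] m x v lx by (simp add: cong_mod_def)
    ultimately have "x \<ominus>\<^bsub>M\<^esub> lam x \<odot>\<^bsub>M\<^esub> v \<in> K" using memK[OF m] by blast
    then show "x \<in> (\<lambda>r. r \<odot>\<^bsub>M\<^esub> v) ` carrier R <+>\<^bsub>M\<^esub> K"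
      using mem_span_sum_iff[OF K v x] lx by blast
  qed
  moreover have "\<exists>x\<in>carrier M. \<forall>i\<in>I. cong_mod R (g i) (\<xi>' i x) (c i)" if c: "c \<in> I \<rightarrow> carrier R" for c
  proof -
    have ci: "c i \<in> carrier R" if "i \<in> I" for i using c that by auto
    \<comment> \<open>\<open>\<tau>\<close> is the value that \<open>\<sigma>\<close> takes, modulo
      \<open>g s\<close>, on any vector with coordinates \<open>c\<close>. Prescribing
      \<open>\<ominus> (t \<otimes> \<tau>)\<close> as the \<open>s\<close>-th coordinate makes
      \<open>lam\<close> vanish modulo \<open>g s\<close>, so there is nothing to correct and
      \<open>\<xi>'\<close> agrees with \<open>\<xi>\<close>.\<close>
    define \<tau> where "\<tau> = (\<Oplus>j\<in>I. b j \<otimes> (q j \<otimes> c j))"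
    have \<tau>: "\<tau> \<in> carrier R" unfolding \<tau>_def using bc q(1) ci by (intro R.finsum_closed) auto
    have "c(s := \<ominus> (t \<otimes> \<tau>)) \<in> insert s I \<rightarrow> carrier R" using c \<tau> t(1) by auto
    then obtain x where x: "x \<in> carrier M"
      "\<forall>i\<in>insert s I. cong_mod R (g i) (\<xi> i x) ((c(s := \<ominus> (t \<otimes> \<tau>))) i)"
      using \<xi> unfolding quotient_coordinates_def by blast
    then have xs: "cong_mod R (g s) (\<xi> s x) (\<ominus> (t \<otimes> \<tau>))" by simp
    have xi: "cong_mod R (g i) (\<xi> i x) (c i)" if "i \<in> I" for i
    proof -
      have "i \<noteq> s" using that I by auto
      then show ?thesis using x(2) that by auto
    qed
    have "cong_mod R (g s) (\<sigma> x) (\<one> \<otimes> \<tau>)"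
      unfolding \<tau>_def using xi ci by (intro \<sigma>_cong[OF x(1)]) auto
    then have "cong_mod R (g s) (\<sigma> x) \<tau>" using \<tau> by simp
    then have "cong_mod R (g s) (\<xi> s x \<oplus> t \<otimes> \<sigma> x) (\<ominus> (t \<otimes> \<tau>) \<oplus> t \<otimes> \<tau>)"
      using xs gs Ds(1) x(1) \<sigma> \<tau> t(1) by (intro cong_mod_add cong_mod_scale) auto
    then have "g s divides (\<xi> s x \<oplus> t \<otimes> \<sigma> x)"
      using cong_mod_zero_iff gs Ds(1) x(1) \<sigma> \<tau> t(1) by (simp add: R.l_neg)
    then have lx: "g s divides lam x"
      unfolding lam_def using gs Ds(1) x(1) \<sigma> t(1) w'(1) by (intro divides_mult_left) auto
    have "cong_mod R (g i) (\<xi>' i x) (c i)" if i: "i \<in> I" for i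
    proof -
      have "g i divides lam x" using divides_trans[OF g(2)[OF i] lx] gi[OF i] by simp
      then have "g i divides (lam x \<otimes> \<xi> i v)"
        using gi[OF i] Dl(1)[OF x(1)] D(1)[OF i v]
        by (simp add: m_comm[of "lam x"] divides_mult_left)
      then have "cong_mod R (g i) (lam x \<otimes> \<xi> i v) \<zero>"
        using cong_mod_zero_iff gi[OF i] Dl(1)[OF x(1)] D(1)[OF i v] by simp
      then have "cong_mod R (g i) (\<xi> i x \<ominus> lam x \<otimes> \<xi> i v) (c i \<ominus> \<zero>)"
        using xi[OF i] gi[OF i] Dl(1)[OF x(1)] D(1)[OF i] v x(1) ci[OF i]
        by (intro cong_mod_minus) auto
      moreover have "c i \<ominus> \<zero> = c i" using ci[OF i] by algebra
      ultimately show ?thesis using \<xi>'_eq[OF i x(1)] by simp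
    qed
    then show ?thesis using x(1) by blast
  qed
  ultimately show ?thesis
    using lin' by (intro exI[of _ \<xi>']) (simp add: quotient_coordinates_def)
qed

subsection \<open>Matrices and unimodular rows\<close>

lemma (in abelian_monoid) finsum_swap:
  assumes "finite A" "finite B" "\<And>i j. \<lbrakk>i \<in> A; j \<in> B\<rbrakk> \<Longrightarrow> f i j \<in> carrier G"
  shows "(\<Oplus>i\<in>A. \<Oplus>j\<in>B. f i j) = (\<Oplus>j\<in>B. \<Oplus>i\<in>A. f i j)"
  using assms(1,3)
proof (induction rule: finite_induct)
  case empty
  then show ?case by (simp add: finsum_zero)
next
  case (insert x F)
  have "(\<Oplus>j\<in>B. \<Oplus>i\<in>insert x F. f i j) = (\<Oplus>j\<in>B. f x j \<oplus> (\<Oplus>i\<in>F. f i j))"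
    using insert by (intro finsum_cong') (auto intro!: finsum_insert)
  also have "\<dots> = (\<Oplus>j\<in>B. f x j) \<oplus> (\<Oplus>j\<in>B. \<Oplus>i\<in>F. f i j)"
    using insert assms(2) by (intro finsum_addf) auto
  also have "\<dots> = (\<Oplus>j\<in>B. f x j) \<oplus> (\<Oplus>i\<in>F. \<Oplus>j\<in>B. f i j)"
    using insert by simp
  also have "\<dots> = (\<Oplus>i\<in>insert x F. \<Oplus>j\<in>B. f i j)"
    using insert assms(2) by (intro finsum_insert[symmetric]) auto
  finally show ?case by simp
qed

lemma (in abelian_monoid) finsum_pair:
  assumes "finite A" "p \<in> A" "q \<in> A" "p \<noteq> q" "f \<in> A \<rightarrow> carrier G"
    and "\<And>k. \<lbrakk>k \<in> A; k \<noteq> p; k \<noteq> q\<rbrakk> \<Longrightarrow> f k = \<zero>"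
  shows "(\<Oplus>k\<in>A. f k) = f p \<oplus> f q"
proof -
  have A: "A = insert p (insert q (A - {p, q}))" using assms by auto
  have f: "f p \<in> carrier G" "f q \<in> carrier G" using assms by auto
  have "(\<Oplus>k\<in>A - {p, q}. f k) = (\<Oplus>k\<in>A - {p, q}. \<zero>)"
    using assms(6) by (intro finsum_cong') auto
  then have z: "(\<Oplus>k\<in>A - {p, q}. f k) = \<zero>" by (simp add: finsum_zero)
  have "(\<Oplus>k\<in>insert p (insert q (A - {p, q})). f k) = f p \<oplus> (\<Oplus>k\<in>insert q (A - {p, q}). f k)"
    using assms by (intro finsum_insert) auto
  also have "(\<Oplus>k\<in>insert q (A - {p, q}). f k) = f q \<oplus> (\<Oplus>k\<in>A - {p, q}. f k)"
    using assms by (intro finsum_insert) auto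
  finally show ?thesis using A z f by simp
qed

lemma (in abelian_monoid) finsum_single:
  assumes "finite A" "p \<in> A" "f \<in> A \<rightarrow> carrier G" "\<And>k. \<lbrakk>k \<in> A; k \<noteq> p\<rbrakk> \<Longrightarrow> f k = \<zero>"
  shows "(\<Oplus>k\<in>A. f k) = f p"
proof -
  have "(\<Oplus>k\<in>A. f k) = (\<Oplus>k\<in>A. if p = k then f k else \<zero>)"
    using assms by (intro finsum_cong') auto
  then show ?thesis using finsum_singleton[OF assms(2,1,3)] by simp
qed

context cring begin

text \<open>The exchange of sums behind associativity of the matrix product: a row, a matrix and a
  column can be multiplied in either order.\<close>

lemma finsum_mult_assoc:
  assumes "finite I" "finite J" "x \<in> I \<rightarrow> carrier R" "y \<in> J \<rightarrow> carrier R"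
    "\<And>i k. \<lbrakk>i \<in> I; k \<in> J\<rbrakk> \<Longrightarrow> A i k \<in> carrier R"
  shows "(\<Oplus>k\<in>J. (\<Oplus>i\<in>I. x i \<otimes> A i k) \<otimes> y k) = (\<Oplus>i\<in>I. x i \<otimes> (\<Oplus>k\<in>J. A i k \<otimes> y k))"
proof -
  have x: "x i \<in> carrier R" if "i \<in> I" for i using assms(3) that by auto
  have y: "y k \<in> carrier R" if "k \<in> J" for k using assms(4) that by auto
  have "(\<Oplus>k\<in>J. (\<Oplus>i\<in>I. x i \<otimes> A i k) \<otimes> y k) = (\<Oplus>k\<in>J. \<Oplus>i\<in>I. x i \<otimes> A i k \<otimes> y k)"
    using assms(1,2,5) x y by (intro finsum_cong') (auto intro!: finsum_ldistr)
  also have "\<dots> = (\<Oplus>i\<in>I. \<Oplus>k\<in>J. x i \<otimes> A i k \<otimes> y k)"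
    using assms(1,2,5) x y by (intro finsum_swap) auto
  also have "\<dots> = (\<Oplus>i\<in>I. x i \<otimes> (\<Oplus>k\<in>J. A i k \<otimes> y k))"
  proof (intro finsum_cong')
    fix i assume i: "i \<in> I"
    have "(\<Oplus>k\<in>J. x i \<otimes> A i k \<otimes> y k) = (\<Oplus>k\<in>J. x i \<otimes> (A i k \<otimes> y k))"
      using assms(5) x y i by (intro finsum_cong') (auto simp: m_assoc)
    also have "\<dots> = x i \<otimes> (\<Oplus>k\<in>J. A i k \<otimes> y k)"
      using assms(2,5) x y i by (intro finsum_rdistr[symmetric]) auto
    finally show "(\<Oplus>k\<in>J. x i \<otimes> A i k \<otimes> y k) = x i \<otimes> (\<Oplus>k\<in>J. A i k \<otimes> y k)" .
  qed (use assms(5) x y in auto)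
  finally show ?thesis .
qed

lemma matrix_entry_closed:
  assumes "A \<in> carrier (matrix_monoid R n)" "i \<in> {1..n}" "j \<in> {1..n}"
  shows "A (i, j) \<in> carrier R"
  using assms by (auto simp: matrix_monoid_def PiE_iff)

text \<open>Each row of a product is a row times a matrix. Identities between matrices are thus
  checked row by row, through facts about \<open>row_times_matrix\<close>.\<close>

lemma matrix_mult_entry:
  assumes "i \<in> {1..n}" "j \<in> {1..n}"
  shows "(A \<otimes>\<^bsub>matrix_monoid R n\<^esub> B) (i, j) = row_times_matrix R n (\<lambda>k. A (i, k)) B j"
  using assms by (simp add: matrix_monoid_def row_times_matrix_def)

lemma row_times_matrix_closed:
  assumes "A \<in> carrier (matrix_monoid R n)" "a \<in> {1..n} \<rightarrow> carrier R" "j \<in> {1..n}"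
  shows "row_times_matrix R n a A j \<in> carrier R"
  unfolding row_times_matrix_def
  using assms matrix_entry_closed[OF assms(1) _ assms(3)] by (intro finsum_closed) auto

lemma row_times_matrix_one:
  assumes "a \<in> {1..n} \<rightarrow> carrier R" "j \<in> {1..n}"
  shows "row_times_matrix R n a \<one>\<^bsub>matrix_monoid R n\<^esub> j = a j"
proof -
  have a: "a i \<in> carrier R" if "i \<in> {1..n}" for i using assms that by auto
  have "row_times_matrix R n a \<one>\<^bsub>matrix_monoid R n\<^esub> j = a j \<otimes> \<one>\<^bsub>matrix_monoid R n\<^esub> (j, j)"
    unfolding row_times_matrix_def using a assms(2)
    by (intro finsum_single) (auto simp: matrix_monoid_def)
  then show ?thesis using a assms(2) by (simp add: matrix_monoid_def)
qed

lemma matrix_mult_closed: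
  assumes "A \<in> carrier (matrix_monoid R n)" "B \<in> carrier (matrix_monoid R n)"
  shows "A \<otimes>\<^bsub>matrix_monoid R n\<^esub> B \<in> carrier (matrix_monoid R n)"
proof -
  have "(\<Oplus>k\<in>{1..n}. A (i, k) \<otimes> B (k, j)) \<in> carrier R" if "i \<in> {1..n}" "j \<in> {1..n}" for i j
    using row_times_matrix_closed[OF assms(2), of "\<lambda>k. A (i, k)" j]
      matrix_entry_closed[OF assms(1)] that by (auto simp: row_times_matrix_def)
  then show ?thesis by (auto simp: matrix_monoid_def)
qed

lemma row_times_matrix_mult:
  assumes "A \<in> carrier (matrix_monoid R n)" "B \<in> carrier (matrix_monoid R n)"
    "a \<in> {1..n} \<rightarrow> carrier R" "j \<in> {1..n}"
  shows "row_times_matrix R n a (A \<otimes>\<^bsub>matrix_monoid R n\<^esub> B) j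
    = row_times_matrix R n (row_times_matrix R n a A) B j"
proof -
  have "row_times_matrix R n (row_times_matrix R n a A) B j
      = (\<Oplus>i\<in>{1..n}. a i \<otimes> (\<Oplus>k\<in>{1..n}. A (i, k) \<otimes> B (k, j)))"
    unfolding row_times_matrix_def
    using assms matrix_entry_closed[OF assms(1)] matrix_entry_closed[OF assms(2)]
    by (intro finsum_mult_assoc) auto
  also have "\<dots> = row_times_matrix R n a (A \<otimes>\<^bsub>matrix_monoid R n\<^esub> B) j"
    unfolding row_times_matrix_def
  proof (intro finsum_cong')
    show "(\<lambda>i. a i \<otimes> (A \<otimes>\<^bsub>matrix_monoid R n\<^esub> B) (i, j)) \<in> {1..n} \<rightarrow> carrier R"
      using matrix_entry_closed[OF matrix_mult_closed[OF assms(1,2)] _ assms(4)] assms(3) by auto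
  qed (use assms(4) in \<open>auto simp: matrix_mult_entry row_times_matrix_def\<close>)
  finally show ?thesis by simp
qed

lemma matrix_ext:
  assumes "A \<in> carrier (matrix_monoid R n)" "B \<in> carrier (matrix_monoid R n)"
    "\<And>i j. \<lbrakk>i \<in> {1..n}; j \<in> {1..n}\<rbrakk> \<Longrightarrow> A (i, j) = B (i, j)"
  shows "A = B"
proof (rule PiE_ext[of A "{1..n} \<times> {1..n}" "\<lambda>_. carrier R"])
  show "A \<in> {1..n} \<times> {1..n} \<rightarrow>\<^sub>E carrier R" "B \<in> {1..n} \<times> {1..n} \<rightarrow>\<^sub>E carrier R"
    using assms(1,2) by (simp_all add: matrix_monoid_def)
qed (use assms(3) in auto)

lemma matrix_one_closed: "\<one>\<^bsub>matrix_monoid R n\<^esub> \<in> carrier (matrix_monoid R n)"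
  by (auto simp: matrix_monoid_def)

lemma row_times_matrix_cong:
  assumes "\<And>i. i \<in> {1..n} \<Longrightarrow> a i = b i" "b \<in> {1..n} \<rightarrow> carrier R"
    "A \<in> carrier (matrix_monoid R n)" "j \<in> {1..n}"
  shows "row_times_matrix R n a A j = row_times_matrix R n b A j"
  unfolding row_times_matrix_def using assms matrix_entry_closed[OF assms(3) _ assms(4)]
  by (intro finsum_cong') auto

lemma monoid_matrix_monoid: "monoid (matrix_monoid R n)"
proof
  let ?G = "matrix_monoid R n"
  have row: "(\<lambda>k. A (i, k)) \<in> {1..n} \<rightarrow> carrier R" if "A \<in> carrier ?G" "i \<in> {1..n}" for A i
    using matrix_entry_closed that by auto
  fix A assume A: "A \<in> carrier ?G"
  show "A \<otimes>\<^bsub>?G\<^esub> \<one>\<^bsub>?G\<^esub> = A"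
    using A by (intro matrix_ext[OF matrix_mult_closed[OF A matrix_one_closed] A])
      (simp add: matrix_mult_entry row_times_matrix_one[OF row[OF A]])
  show "\<one>\<^bsub>?G\<^esub> \<otimes>\<^bsub>?G\<^esub> A = A"
  proof (rule matrix_ext[OF matrix_mult_closed[OF matrix_one_closed A] A])
    fix i j assume ij: "i \<in> {1..n}" "j \<in> {1..n}"
    note e = matrix_entry_closed[OF A]
    have "(\<one>\<^bsub>?G\<^esub> \<otimes>\<^bsub>?G\<^esub> A) (i, j) = \<one>\<^bsub>?G\<^esub> (i, i) \<otimes> A (i, j)"
      unfolding matrix_mult_entry[OF ij] row_times_matrix_def
      using e ij by (intro finsum_single) (auto simp: matrix_monoid_def)
    then show "(\<one>\<^bsub>?G\<^esub> \<otimes>\<^bsub>?G\<^esub> A) (i, j) = A (i, j)"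
      using e[OF ij] ij by (simp add: matrix_monoid_def)
  qed
  fix B assume B: "B \<in> carrier ?G"
  show "A \<otimes>\<^bsub>?G\<^esub> B \<in> carrier ?G" using matrix_mult_closed A B .
  fix C assume C: "C \<in> carrier ?G"
  show "A \<otimes>\<^bsub>?G\<^esub> B \<otimes>\<^bsub>?G\<^esub> C = A \<otimes>\<^bsub>?G\<^esub> (B \<otimes>\<^bsub>?G\<^esub> C)"
  proof (rule matrix_ext)
    fix i j assume ij: "i \<in> {1..n}" "j \<in> {1..n}"
    have "(A \<otimes>\<^bsub>?G\<^esub> B \<otimes>\<^bsub>?G\<^esub> C) (i, j)
        = row_times_matrix R n (row_times_matrix R n (\<lambda>k. A (i, k)) B) C j"
      unfolding matrix_mult_entry[OF ij]
      using row_times_matrix_closed[OF B row[OF A ij(1)]] C ij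
      by (intro row_times_matrix_cong) (auto simp: matrix_mult_entry)
    also have "\<dots> = (A \<otimes>\<^bsub>?G\<^esub> (B \<otimes>\<^bsub>?G\<^esub> C)) (i, j)"
      using row_times_matrix_mult[OF B C row[OF A ij(1)] ij(2)] ij
      by (simp add: matrix_mult_entry)
    finally show "(A \<otimes>\<^bsub>?G\<^esub> B \<otimes>\<^bsub>?G\<^esub> C) (i, j) = (A \<otimes>\<^bsub>?G\<^esub> (B \<otimes>\<^bsub>?G\<^esub> C)) (i, j)" .
  qed (simp_all add: matrix_mult_closed A B C)
qed (rule matrix_one_closed)

end

text \<open>The identity matrix with a 2 x 2 block placed in rows and columns 1 and
  \<open>m\<close>.\<close>

definition two_by_two :: "('a, 'm) ring_scheme \<Rightarrow> nat \<Rightarrow> nat \<Rightarrow> 'a \<Rightarrow> 'a \<Rightarrow> 'a \<Rightarrow> 'a \<Rightarrow> nat \<times> nat \<Rightarrow> 'a"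
  where "two_by_two R n m \<alpha> \<beta> \<gamma> \<delta> = (\<lambda>(i, j)\<in>{1..n} \<times> {1..n}.
    if i = 1 \<and> j = 1 then \<alpha> else if i = 1 \<and> j = m then \<beta>
    else if i = m \<and> j = 1 then \<gamma> else if i = m \<and> j = m then \<delta>
    else if i = j then \<one>\<^bsub>R\<^esub> else \<zero>\<^bsub>R\<^esub>)"

context cring begin

lemma two_by_two_closed:
  assumes "\<alpha> \<in> carrier R" "\<beta> \<in> carrier R" "\<gamma> \<in> carrier R" "\<delta> \<in> carrier R"
  shows "two_by_two R n m \<alpha> \<beta> \<gamma> \<delta> \<in> carrier (matrix_monoid R n)"
  using assms by (auto simp: matrix_monoid_def two_by_two_def)

lemma row_times_two_by_two:
  assumes c: "\<alpha> \<in> carrier R" "\<beta> \<in> carrier R" "\<gamma> \<in> carrier R" "\<delta> \<in> carrier R"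
    and m: "m \<in> {2..n}" and a: "a \<in> {1..n} \<rightarrow> carrier R" and j: "j \<in> {1..n}"
  shows "row_times_matrix R n a (two_by_two R n m \<alpha> \<beta> \<gamma> \<delta>) j =
    (if j = 1 then a 1 \<otimes> \<alpha> \<oplus> a m \<otimes> \<gamma> else if j = m then a 1 \<otimes> \<beta> \<oplus> a m \<otimes> \<delta> else a j)"
proof -
  let ?E = "two_by_two R n m \<alpha> \<beta> \<gamma> \<delta>"
  have a': "a i \<in> carrier R" if "i \<in> {1..n}" for i using a that by auto
  have t: "a i \<otimes> ?E (i, j) \<in> carrier R" if "i \<in> {1..n}" for i
    using a'[OF that] matrix_entry_closed[OF two_by_two_closed[OF c] that j] by simp
  show ?thesis
  proof (cases "j = 1 \<or> j = m")
    case True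
    have "row_times_matrix R n a ?E j = a 1 \<otimes> ?E (1, j) \<oplus> a m \<otimes> ?E (m, j)"
      unfolding row_times_matrix_def
    proof (intro finsum_pair)
      fix k assume "k \<in> {1..n}" "k \<noteq> 1" "k \<noteq> m"
      then show "a k \<otimes> ?E (k, j) = \<zero>" using True a' j by (auto simp: two_by_two_def)
    qed (use t m in auto)
    then show ?thesis using True m by (auto simp: two_by_two_def)
  next
    case False
    have "row_times_matrix R n a ?E j = a j \<otimes> ?E (j, j)"
      unfolding row_times_matrix_def
    proof (intro finsum_single)
      fix k assume "k \<in> {1..n}" "k \<noteq> j"
      then show "a k \<otimes> ?E (k, j) = \<zero>" using False a' j by (auto simp: two_by_two_def)
    qed (use t j in auto)
    then show ?thesis using False a'[OF j] j by (auto simp: two_by_two_def)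
  qed
qed

text \<open>The second factor carries the adjugate of the block, which is the inverse of a block of
  determinant 1.\<close>

lemma two_by_two_mult:
  assumes c: "\<alpha> \<in> carrier R" "\<beta> \<in> carrier R" "\<gamma> \<in> carrier R" "\<delta> \<in> carrier R"
    and m: "m \<in> {2..n}" and det: "\<alpha> \<otimes> \<delta> \<ominus> \<beta> \<otimes> \<gamma> = \<one>"
  shows "two_by_two R n m \<alpha> \<beta> \<gamma> \<delta> \<otimes>\<^bsub>matrix_monoid R n\<^esub> two_by_two R n m \<delta> (\<ominus> \<beta>) (\<ominus> \<gamma>) \<alpha>
    = \<one>\<^bsub>matrix_monoid R n\<^esub>"
proof (rule matrix_ext)
  have e: "\<alpha> \<otimes> \<delta> \<oplus> \<beta> \<otimes> \<ominus> \<gamma> = \<one>" "\<alpha> \<otimes> \<ominus> \<beta> \<oplus> \<beta> \<otimes> \<alpha> = \<zero>"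
    "\<gamma> \<otimes> \<delta> \<oplus> \<delta> \<otimes> \<ominus> \<gamma> = \<zero>" "\<gamma> \<otimes> \<ominus> \<beta> \<oplus> \<delta> \<otimes> \<alpha> = \<one>"
    unfolding det[symmetric] using c by algebra+
  fix i j assume ij: "i \<in> {1..n}" "j \<in> {1..n}"
  let ?r = "\<lambda>k. two_by_two R n m \<alpha> \<beta> \<gamma> \<delta> (i, k)"
  have m': "m \<in> {1..n}" "1 \<in> {1..n}" "m \<noteq> 1" using m by auto
  have "?r \<in> {1..n} \<rightarrow> carrier R"
    using matrix_entry_closed[OF two_by_two_closed[OF c] ij(1)] by blast
  then have prod: "(two_by_two R n m \<alpha> \<beta> \<gamma> \<delta> \<otimes>\<^bsub>matrix_monoid R n\<^esub> two_by_two R n m \<delta> (\<ominus> \<beta>) (\<ominus> \<gamma>) \<alpha>) (i, j)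
      = (if j = 1 then ?r 1 \<otimes> \<delta> \<oplus> ?r m \<otimes> (\<ominus> \<gamma>)
         else if j = m then ?r 1 \<otimes> (\<ominus> \<beta>) \<oplus> ?r m \<otimes> \<alpha> else ?r j)"
    unfolding matrix_mult_entry[OF ij] using c
    by (intro row_times_two_by_two[OF _ _ _ _ m _ ij(2)]) simp_all
  have one: "\<one>\<^bsub>matrix_monoid R n\<^esub> (i, j) = (if i = j then \<one> else \<zero>)"
    using ij by (simp add: matrix_monoid_def)
  consider "i = 1" | "i = m" | "i \<noteq> 1" "i \<noteq> m" by blast
  then show "(two_by_two R n m \<alpha> \<beta> \<gamma> \<delta> \<otimes>\<^bsub>matrix_monoid R n\<^esub> two_by_two R n m \<delta> (\<ominus> \<beta>) (\<ominus> \<gamma>) \<alpha>) (i, j)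
      = \<one>\<^bsub>matrix_monoid R n\<^esub> (i, j)"
  proof cases
    case 1
    then have r: "?r 1 = \<alpha>" "?r m = \<beta>" "j \<noteq> 1 \<Longrightarrow> j \<noteq> m \<Longrightarrow> ?r j = \<zero>"
      using m' ij by (simp_all add: two_by_two_def)
    then show ?thesis unfolding prod one r(1,2) using 1 e(1,2) m'(3) r(3) by auto
  next
    case 2
    then have r: "?r 1 = \<gamma>" "?r m = \<delta>" "j \<noteq> 1 \<Longrightarrow> j \<noteq> m \<Longrightarrow> ?r j = \<zero>"
      using m' ij by (simp_all add: two_by_two_def)
    then show ?thesis unfolding prod one r(1,2) using 2 e(3,4) m'(3) r(3) by auto
  next
    case 3
    then have r: "?r 1 = \<zero>" "?r m = \<zero>" "j \<noteq> 1 \<Longrightarrow> j \<noteq> m \<Longrightarrow> ?r j = (if i = j then \<one> else \<zero>)"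
      using m' ij by (simp_all add: two_by_two_def)
    then show ?thesis unfolding prod one r(1,2) using 3 c r(3) by auto
  qed
qed (use c in \<open>auto intro!: matrix_mult_closed two_by_two_closed matrix_one_closed\<close>)

lemma two_by_two_GL:
  assumes "\<alpha> \<in> carrier R" "\<beta> \<in> carrier R" "\<gamma> \<in> carrier R" "\<delta> \<in> carrier R"
    "m \<in> {2..n}" "\<alpha> \<otimes> \<delta> \<ominus> \<beta> \<otimes> \<gamma> = \<one>"
  shows "two_by_two R n m \<alpha> \<beta> \<gamma> \<delta> \<in> GL R n"
proof -
  \<comment> \<open>The adjugate has determinant 1 too, so the same lemma with the roles exchanged
    makes the inverse two-sided.\<close>
  have "\<delta> \<otimes> \<alpha> \<ominus> (\<ominus> \<beta>) \<otimes> (\<ominus> \<gamma>) = \<one>"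
    unfolding assms(6)[symmetric] using assms(1-4) by algebra
  then have "two_by_two R n m \<delta> (\<ominus> \<beta>) (\<ominus> \<gamma>) \<alpha> \<otimes>\<^bsub>matrix_monoid R n\<^esub> two_by_two R n m \<alpha> \<beta> \<gamma> \<delta>
      = \<one>\<^bsub>matrix_monoid R n\<^esub>"
    using two_by_two_mult[of \<delta> "\<ominus> \<beta>" "\<ominus> \<gamma>" \<alpha>] assms by simp
  then show ?thesis
    unfolding GL_def Units_def using two_by_two_mult[OF assms] assms(1-4)
    by (auto intro!: two_by_two_closed bexI[of _ "two_by_two R n m \<delta> (\<ominus> \<beta>) (\<ominus> \<gamma>) \<alpha>"])
qed

lemma GL_mult:
  assumes "P \<in> GL R n" "Q \<in> GL R n"
  shows "P \<otimes>\<^bsub>matrix_monoid R n\<^esub> Q \<in> GL R n"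
  using monoid.Units_m_closed[OF monoid_matrix_monoid] assms by (simp add: GL_def)

lemma row_times_GL_mult:
  assumes "a \<in> {1..n} \<rightarrow> carrier R" "P \<in> GL R n" "Q \<in> GL R n" "j \<in> {1..n}"
  shows "row_times_matrix R n a (P \<otimes>\<^bsub>matrix_monoid R n\<^esub> Q) j
      = row_times_matrix R n (row_times_matrix R n a P) Q j"
  using assms row_times_matrix_mult by (simp add: GL_def Units_def)

text \<open>As 1 is a common divisor of any set, it is a greatest one as soon as every common
  divisor divides 1.\<close>

lemma is_gcd_one_iff:
  assumes "A \<subseteq> carrier R"
  shows "is_gcd_of_set R \<one> A \<longleftrightarrow> (\<forall>d\<in>carrier R. (\<forall>a\<in>A. d divides a) \<longrightarrow> d \<in> Units R)"
proof -
  have "Lower (division_rel R) A = {d \<in> carrier R. \<forall>a\<in>A. d divides a}"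
    using assms by (auto simp: Lower_def)
  then show ?thesis
    using assms one_divides divides_one by (auto simp: is_gcd_of_set_def greatest_def)
qed

end

section \<open>Reduction of a unimodular row over a principal ideal domain\<close>

context principal_domain begin

text \<open>Entries are cleared one after the other against the first entry; the block used for
  entry \<open>Suc k\<close> touches only columns 1 and \<open>Suc k\<close>, so the zeros already
  obtained survive.\<close>

lemma clear_row:
  assumes a: "a \<in> {1..n} \<rightarrow> carrier R" and k: "1 \<le> k" "k \<le> n"
  shows "\<exists>Q\<in>GL R n. \<forall>j\<in>{2..k}. row_times_matrix R n a Q j = \<zero>"
  using k
proof (induction k rule: nat_induct_at_least)
  case base
  interpret G: monoid "matrix_monoid R n" by (rule monoid_matrix_monoid)
  show ?case using G.Units_one_closed by (auto simp: GL_def)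
next
  case (Suc k)
  then obtain Q where Q: "Q \<in> GL R n" "\<forall>j\<in>{2..k}. row_times_matrix R n a Q j = \<zero>" by auto
  define b where "b = row_times_matrix R n a Q"
  have b: "b j \<in> carrier R" if "j \<in> {1..n}" for j
    using row_times_matrix_closed[OF _ a that] Q(1) by (auto simp: b_def GL_def Units_def)
  let ?m = "Suc k"
  have m: "?m \<in> {2..n}" using Suc by auto
  have b1: "b 1 \<in> carrier R" "b ?m \<in> carrier R" using b Suc by auto
  obtain \<alpha> \<gamma> where ac: "\<alpha> \<in> carrier R" "\<gamma> \<in> carrier R"
    "(\<alpha> \<otimes> b 1 \<oplus> \<gamma> \<otimes> b ?m) divides b 1" "(\<alpha> \<otimes> b 1 \<oplus> \<gamma> \<otimes> b ?m) divides b ?m"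
    using bezout[OF b1] .
  let ?d = "\<alpha> \<otimes> b 1 \<oplus> \<gamma> \<otimes> b ?m"
  have d: "?d \<in> carrier R" using ac b1 by simp
  show ?case
  proof (cases "?d = \<zero>")
    case True
    then have "b ?m = \<zero>" using ac(4) zero_divides by simp
    then have "row_times_matrix R n a Q j = \<zero>" if "j \<in> {2..Suc k}" for j
      using Q(2) that by (cases "j = Suc k") (simp_all add: b_def)
    then show ?thesis using Q(1) by blast
  next
    case False
    \<comment> \<open>The pair of entries is \<open>?d\<close> times (p, q). Cancelling
      \<open>?d\<close> in its Bezout identity gives the determinant 1 of the block, whose second
      column (-q, p) annihilates the pair.\<close>
    obtain p q where pq: "p \<in> carrier R" "b 1 = ?d \<otimes> p" "q \<in> carrier R" "b ?m = ?d \<otimes> q"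
      using ac(3,4) by (meson dividesE)
    have "?d \<otimes> (\<alpha> \<otimes> p \<oplus> \<gamma> \<otimes> q) = \<alpha> \<otimes> (?d \<otimes> p) \<oplus> \<gamma> \<otimes> (?d \<otimes> q)"
      using ac(1,2) pq(1,3) d by algebra
    also have "\<dots> = ?d \<otimes> \<one>" using pq(2,4) d by simp
    finally have "\<alpha> \<otimes> p \<oplus> \<gamma> \<otimes> q = \<one>"
      using m_lcancel[OF False d, of "\<alpha> \<otimes> p \<oplus> \<gamma> \<otimes> q" \<one>] ac(1,2) pq(1,3) by simp
    moreover have "\<alpha> \<otimes> p \<ominus> (\<ominus> q) \<otimes> \<gamma> = \<alpha> \<otimes> p \<oplus> \<gamma> \<otimes> q" using ac(1,2) pq(1,3) by algebra
    ultimately have det: "\<alpha> \<otimes> p \<ominus> (\<ominus> q) \<otimes> \<gamma> = \<one>" by simp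
    let ?E = "two_by_two R n ?m \<alpha> (\<ominus> q) \<gamma> p"
    have E: "?E \<in> GL R n" using two_by_two_GL det m ac(1,2) pq(1,3) by simp
    have "row_times_matrix R n a (Q \<otimes>\<^bsub>matrix_monoid R n\<^esub> ?E) j = \<zero>" if j: "j \<in> {2..Suc k}" for j
    proof -
      have jn: "j \<in> {1..n}" using j Suc by auto
      have "row_times_matrix R n a (Q \<otimes>\<^bsub>matrix_monoid R n\<^esub> ?E) j
          = (if j = ?m then b 1 \<otimes> (\<ominus> q) \<oplus> b ?m \<otimes> p else b j)"
        using row_times_GL_mult[OF a Q(1) E jn]
          row_times_two_by_two[OF ac(1) _ ac(2) pq(1) m _ jn, of "\<ominus> q" b] pq(3) b j
        by (auto simp: b_def)
      moreover have "b 1 \<otimes> (\<ominus> q) \<oplus> b ?m \<otimes> p = ?d \<otimes> p \<otimes> (\<ominus> q) \<oplus> ?d \<otimes> q \<otimes> p"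
        using pq(2,4) by simp
      moreover have "\<dots> = \<zero>" using d pq(1,3) by algebra
      ultimately show ?thesis using Q(2) j by (auto simp: b_def)
    qed
    then show ?thesis using GL_mult[OF Q(1) E] by blast
  qed
qed

text \<open>After clearing, only the first entry is left. Undoing the transformation shows that it
  divides every entry of the original row, so it is a unit.\<close>

lemma unimodular_row_to_e1:
  assumes a: "a \<in> {1..n} \<rightarrow> carrier R" and n: "2 \<le> n"
    and gcd: "is_gcd_of_set R \<one> (a ` {1..n})"
  shows "\<exists>Q\<in>GL R n. row_is_e1 R n (row_times_matrix R n a Q)"
proof -
  interpret G: monoid "matrix_monoid R n" by (rule monoid_matrix_monoid)
  obtain Q where Q: "Q \<in> GL R n" "\<forall>j\<in>{2..n}. row_times_matrix R n a Q j = \<zero>"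
    using clear_row[OF a, of n] n by auto
  define b where "b = row_times_matrix R n a Q"
  let ?Q' = "inv\<^bsub>matrix_monoid R n\<^esub> Q"
  have Q': "?Q' \<in> GL R n" "Q \<in> carrier (matrix_monoid R n)" "?Q' \<in> carrier (matrix_monoid R n)"
    using Q(1) by (auto simp: GL_def)
  have b: "b j \<in> carrier R" if "j \<in> {1..n}" for j
    using row_times_matrix_closed[OF _ a that] Q' by (auto simp: b_def)
  have b1: "b 1 \<in> carrier R" using b n by simp
  have "b 1 divides a j" if j: "j \<in> {1..n}" for j
  proof -
    have "a j = row_times_matrix R n a (Q \<otimes>\<^bsub>matrix_monoid R n\<^esub> ?Q') j"
      using G.Units_r_inv Q(1) row_times_matrix_one[OF a j] by (simp add: GL_def)
    also have "\<dots> = row_times_matrix R n b ?Q' j"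
      using row_times_GL_mult[OF a Q(1) Q'(1) j] by (simp add: b_def)
    also have "\<dots> = b 1 \<otimes> ?Q' (1, j)"
      unfolding row_times_matrix_def
    proof (intro finsum_single)
      fix k assume "k \<in> {1..n}" "k \<noteq> 1"
      then have "b k = \<zero>" using Q(2) by (auto simp: b_def)
      then show "b k \<otimes> ?Q' (k, j) = \<zero>"
        using matrix_entry_closed[OF Q'(3) \<open>k \<in> {1..n}\<close> j] by simp
    qed (use n b j matrix_entry_closed[OF Q'(3)] in auto)
    finally show ?thesis using matrix_entry_closed[OF Q'(3) _ j, of 1] n by (auto intro: dividesI)
  qed
  moreover have "a ` {1..n} \<subseteq> carrier R" using a by auto
  ultimately have unit: "b 1 \<in> Units R" using gcd b1 by (auto simp: is_gcd_one_iff)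
  let ?c = "inv b 1"
  have c: "?c \<in> carrier R" "b 1 \<otimes> ?c = \<one>" "?c \<otimes> b 1 = \<one>" using unit by auto
  \<comment> \<open>The unit is normalized by the block with diagonal \<open>?c\<close>,
    \<open>b 1\<close>, which has determinant 1. Its second place needs \<open>2 \<le> n\<close>,
    and does no harm as the second entry of the row is zero.\<close>
  have m: "2 \<in> {2..n}" using n by simp
  have "?c \<otimes> b 1 \<ominus> \<zero> \<otimes> \<zero> = \<one>" using c b1 by (simp add: a_minus_def)
  then have E: "two_by_two R n 2 ?c \<zero> \<zero> (b 1) \<in> GL R n"
    using two_by_two_GL[OF c(1) _ _ b1 m] by simp
  have "row_is_e1 R n (row_times_matrix R n a (Q \<otimes>\<^bsub>matrix_monoid R n\<^esub> two_by_two R n 2 ?c \<zero> \<zero> (b 1)))"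
    unfolding row_is_e1_def
  proof
    fix j assume j: "j \<in> {1..n}"
    have b2: "b k = \<zero>" if "k \<in> {1..n}" "k \<noteq> 1" for k using Q(2) that by (auto simp: b_def)
    have "row_times_matrix R n a (Q \<otimes>\<^bsub>matrix_monoid R n\<^esub> two_by_two R n 2 ?c \<zero> \<zero> (b 1)) j
      = (if j = 1 then b 1 \<otimes> ?c \<oplus> b 2 \<otimes> \<zero> else if j = 2 then b 1 \<otimes> \<zero> \<oplus> b 2 \<otimes> b 1 else b j)"
      using row_times_GL_mult[OF a Q(1) E j] row_times_two_by_two[OF c(1) _ _ b1 m _ j, of \<zero> \<zero> b] b
      by (simp add: b_def)
    then show "row_times_matrix R n a (Q \<otimes>\<^bsub>matrix_monoid R n\<^esub> two_by_two R n 2 ?c \<zero> \<zero> (b 1)) j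
        = (if j = 1 then \<one> else \<zero>)"
      using c(2) b2[of 2] b2[OF j] n b1 by auto
  qed
  then show ?thesis using GL_mult[OF Q(1) E] by blast
qed

end

subsection \<open>Submodules and bases\<close>

lemma is_basis_independent:
  assumes "is_basis R N I u" "c \<in> I \<rightarrow> carrier R"
    "(\<Oplus>\<^bsub>N\<^esub> i\<in>I. c i \<odot>\<^bsub>N\<^esub> u i) = \<zero>\<^bsub>N\<^esub>" "i \<in> I"
  shows "c i = \<zero>\<^bsub>R\<^esub>"
  using assms unfolding is_basis_def by blast

lemma is_basis_spans:
  assumes "is_basis R N I u" "x \<in> carrier N"
  obtains c where "c \<in> I \<rightarrow> carrier R" "x = (\<Oplus>\<^bsub>N\<^esub> i\<in>I. c i \<odot>\<^bsub>N\<^esub> u i)"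
  using assms unfolding is_basis_def by blast

section \<open>Computations inside a submodule, and the quotient of R v + K by K\<close>

context module begin

text \<open>The negative is selected within the carrier, so restricting the carrier changes the
  term; uniqueness of inverses identifies the two.\<close>

lemma uminus_restrict_module:
  assumes P: "submodule P R M" and x: "x \<in> P"
  shows "\<ominus>\<^bsub>restrict_module M P\<^esub> x = \<ominus>\<^bsub>M\<^esub> x"
proof -
  interpret N: module R "restrict_module M P"
    using submodule.submodule_is_module[OF P module_axioms] .
  have "x \<in> carrier M" "\<ominus>\<^bsub>M\<^esub> x \<in> P" using submoduleE(1,3)[OF P] x by auto
  then show ?thesis using x by (intro N.minus_equality) (simp_all add: M.l_neg)
qed

lemma minus_restrict_module:
  assumes P: "submodule P R M" and x: "y \<in> P"
  shows "x \<ominus>\<^bsub>restrict_module M P\<^esub> y = x \<ominus>\<^bsub>M\<^esub> y"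
  using uminus_restrict_module[OF assms] by (simp add: a_minus_def)

lemma submodule_zero_closed:
  assumes "submodule K R M" shows "\<zero>\<^bsub>M\<^esub> \<in> K"
  using subgroup.one_closed[OF submodule.axioms(1)[OF assms]] by simp

lemma submodule_restrict_module:
  assumes P: "submodule P R M" and K: "submodule K R M" "K \<subseteq> P"
  shows "submodule K R (restrict_module M P)"
proof (rule module.submoduleI[OF submodule.submodule_is_module[OF P module_axioms]])
  show "\<ominus>\<^bsub>restrict_module M P\<^esub> x \<in> K" if "x \<in> K" for x
    using uminus_restrict_module[OF P] submoduleE(3)[OF K(1)] K(2) that by auto
qed (use K submoduleE[OF K(1)] submodule_zero_closed[OF K(1)] in simp_all)

text \<open>Finite sums also refer to the carrier of the record. Bases of submodules are stated with
  sums in the restricted module, whereas the computations take place in \<open>M\<close>.\<close>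

lemma finsum_restrict_module:
  assumes P: "submodule P R M" and "finite I" "x \<in> I \<rightarrow> P"
  shows "(\<Oplus>\<^bsub>restrict_module M P\<^esub> i\<in>I. x i) = (\<Oplus>\<^bsub>M\<^esub> i\<in>I. x i)"
    and "(\<Oplus>\<^bsub>M\<^esub> i\<in>I. x i) \<in> P"
proof -
  interpret N: module R "restrict_module M P"
    using submodule.submodule_is_module[OF P module_axioms] .
  have "x \<in> J \<rightarrow> P \<Longrightarrow> (\<Oplus>\<^bsub>restrict_module M P\<^esub> i\<in>J. x i) = (\<Oplus>\<^bsub>M\<^esub> i\<in>J. x i)" if "finite J" for J
    using that
  proof (induction rule: finite_induct)
    case empty
    then show ?case using N.finsum_empty M.finsum_empty by simp
  next
    case (insert j J)
    then have "x \<in> J \<rightarrow> P" "x j \<in> P" by auto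
    moreover have "x \<in> J \<rightarrow> carrier M" "x j \<in> carrier M"
      using submoduleE(1)[OF P] calculation by auto
    ultimately show ?case
      using insert N.finsum_insert[of J j x] M.finsum_insert[of J j x] by simp
  qed
  then show eq: "(\<Oplus>\<^bsub>restrict_module M P\<^esub> i\<in>I. x i) = (\<Oplus>\<^bsub>M\<^esub> i\<in>I. x i)"
    using assms by blast
  show "(\<Oplus>\<^bsub>M\<^esub> i\<in>I. x i) \<in> P" using N.finsum_closed[of x I] assms(3) eq by simp
qed

lemma finsum_smult_rdistr:
  assumes "finite I" "a \<in> I \<rightarrow> carrier R" "x \<in> carrier M"
  shows "(\<Oplus>i\<in>I. a i) \<odot>\<^bsub>M\<^esub> x = (\<Oplus>\<^bsub>M\<^esub> i\<in>I. a i \<odot>\<^bsub>M\<^esub> x)"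
  using assms(1,2)
proof (induction rule: finite_induct)
  case empty
  then show ?case using assms(3) by simp
next
  case (insert i I)
  then have "a \<in> I \<rightarrow> carrier R" "a i \<in> carrier R" by auto
  then show ?case
    using insert assms(3) by (simp add: smult_l_distr Pi_iff)
qed

text \<open>The analogue of \<open>finsum_mult_assoc\<close> for a column of vectors: it moves a
  matrix from the vectors to the row of coefficients.\<close>

lemma finsum_smult_assoc:
  assumes "finite I" "finite J" "x \<in> I \<rightarrow> carrier R" "y \<in> J \<rightarrow> carrier M"
    "\<And>i k. \<lbrakk>i \<in> I; k \<in> J\<rbrakk> \<Longrightarrow> A i k \<in> carrier R"
  shows "(\<Oplus>\<^bsub>M\<^esub> i\<in>I. x i \<odot>\<^bsub>M\<^esub> (\<Oplus>\<^bsub>M\<^esub> k\<in>J. A i k \<odot>\<^bsub>M\<^esub> y k))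
    = (\<Oplus>\<^bsub>M\<^esub> k\<in>J. (\<Oplus>i\<in>I. x i \<otimes> A i k) \<odot>\<^bsub>M\<^esub> y k)"
proof -
  have x: "x i \<in> carrier R" if "i \<in> I" for i using assms(3) that by auto
  have y: "y k \<in> carrier M" if "k \<in> J" for k using assms(4) that by auto
  have "(\<Oplus>\<^bsub>M\<^esub> k\<in>J. (\<Oplus>i\<in>I. x i \<otimes> A i k) \<odot>\<^bsub>M\<^esub> y k)
      = (\<Oplus>\<^bsub>M\<^esub> k\<in>J. \<Oplus>\<^bsub>M\<^esub> i\<in>I. (x i \<otimes> A i k) \<odot>\<^bsub>M\<^esub> y k)"
    using assms(1,2,5) x y by (intro M.finsum_cong') (auto intro!: finsum_smult_rdistr)
  also have "\<dots> = (\<Oplus>\<^bsub>M\<^esub> i\<in>I. \<Oplus>\<^bsub>M\<^esub> k\<in>J. (x i \<otimes> A i k) \<odot>\<^bsub>M\<^esub> y k)"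
    using assms(1,2,5) x y by (intro M.finsum_swap) auto
  also have "\<dots> = (\<Oplus>\<^bsub>M\<^esub> i\<in>I. x i \<odot>\<^bsub>M\<^esub> (\<Oplus>\<^bsub>M\<^esub> k\<in>J. A i k \<odot>\<^bsub>M\<^esub> y k))"
  proof (intro M.finsum_cong')
    fix i assume i: "i \<in> I"
    have "(\<Oplus>\<^bsub>M\<^esub> k\<in>J. (x i \<otimes> A i k) \<odot>\<^bsub>M\<^esub> y k) = (\<Oplus>\<^bsub>M\<^esub> k\<in>J. x i \<odot>\<^bsub>M\<^esub> (A i k \<odot>\<^bsub>M\<^esub> y k))"
      using assms(5) x y i by (intro M.finsum_cong') (auto simp: smult_assoc1)
    also have "\<dots> = x i \<odot>\<^bsub>M\<^esub> (\<Oplus>\<^bsub>M\<^esub> k\<in>J. A i k \<odot>\<^bsub>M\<^esub> y k)"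
      using assms(2,5) x y i by (intro finsum_smult_ldistr[symmetric]) auto
    finally show "(\<Oplus>\<^bsub>M\<^esub> k\<in>J. (x i \<otimes> A i k) \<odot>\<^bsub>M\<^esub> y k)
        = x i \<odot>\<^bsub>M\<^esub> (\<Oplus>\<^bsub>M\<^esub> k\<in>J. A i k \<odot>\<^bsub>M\<^esub> y k)" .
  qed (use assms(5) x y in auto)
  finally show ?thesis by simp
qed

text \<open>The isomorphism reads off a coefficient of \<open>v\<close>. Such a coefficient is
  picked by choice, and \<open>ann\<close> makes it unique modulo \<open>d\<close>.\<close>

lemma span_quotient_isomorphic_cyclic:
  assumes K: "submodule K R M" and v: "v \<in> carrier M" and d: "d \<in> carrier R"
    and ann: "\<And>r. r \<in> carrier R \<Longrightarrow> r \<odot>\<^bsub>M\<^esub> v \<in> K \<longleftrightarrow> d divides r"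
  shows "module_isomorphic R
    (quotient_module (restrict_module M ((\<lambda>r. r \<odot>\<^bsub>M\<^esub> v) ` carrier R <+>\<^bsub>M\<^esub> K)) K)
    (cyclic_module R d)"
proof -
  let ?P = "(\<lambda>r. r \<odot>\<^bsub>M\<^esub> v) ` carrier R <+>\<^bsub>M\<^esub> K" and ?N = "cyclic_module R d"
  let ?PM = "restrict_module M ?P"
  have P: "submodule ?P R M" using submodule_span_sum[OF K v] .
  have Pc: "x \<in> carrier M" if "x \<in> ?P" for x using submoduleE(1)[OF P] that by (rule subsetD)
  have ex: "\<exists>r\<in>carrier R. x \<ominus>\<^bsub>M\<^esub> r \<odot>\<^bsub>M\<^esub> v \<in> K" if "x \<in> ?P" for x
    using mem_span_sum_iff[OF K v Pc[OF that]] that by (rule iffD1)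
  define c where "c x = (SOME r. r \<in> carrier R \<and> x \<ominus>\<^bsub>M\<^esub> r \<odot>\<^bsub>M\<^esub> v \<in> K)" for x
  have c: "c x \<in> carrier R" "x \<ominus>\<^bsub>M\<^esub> c x \<odot>\<^bsub>M\<^esub> v \<in> K" if "x \<in> ?P" for x
    using someI_ex[of "\<lambda>r. r \<in> carrier R \<and> x \<ominus>\<^bsub>M\<^esub> r \<odot>\<^bsub>M\<^esub> v \<in> K"] ex[OF that]
    unfolding c_def[symmetric] by blast+
  \<comment> \<open>Used twice: for x = y it shows that the class of the coefficient does not depend
    on the choice, and for arbitrary x and y it determines the kernel.\<close>
  have key: "x \<ominus>\<^bsub>M\<^esub> y \<in> K \<longleftrightarrow> cong_mod R d r q"
    if x: "x \<in> carrier M" "r \<in> carrier R" "x \<ominus>\<^bsub>M\<^esub> r \<odot>\<^bsub>M\<^esub> v \<in> K"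
      and y: "y \<in> carrier M" "q \<in> carrier R" "y \<ominus>\<^bsub>M\<^esub> q \<odot>\<^bsub>M\<^esub> v \<in> K" for x y r q
  proof -
    let ?z = "x \<ominus>\<^bsub>M\<^esub> y" and ?w = "(r \<ominus> q) \<odot>\<^bsub>M\<^esub> v"
    have zw: "?z \<in> carrier M" "?w \<in> carrier M" using x(1,2) y(1,2) v by auto
    have "?z = x \<oplus>\<^bsub>M\<^esub> (\<ominus> \<one>) \<odot>\<^bsub>M\<^esub> y" "r \<ominus> q = r \<oplus> (\<ominus> \<one>) \<otimes> q"
      using x(1,2) y(1,2) by (simp_all add: a_minus_def smult_l_minus R.l_minus)
    then have k: "?z \<ominus>\<^bsub>M\<^esub> ?w \<in> K"
      using span_coefficient_add[OF K v x _ _ span_coefficient_smult[OF K v _ y, of "\<ominus> \<one>"]] y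
      by simp
    have "?z = (?z \<ominus>\<^bsub>M\<^esub> ?w) \<oplus>\<^bsub>M\<^esub> ?w" "?w = ?z \<oplus>\<^bsub>M\<^esub> \<ominus>\<^bsub>M\<^esub> (?z \<ominus>\<^bsub>M\<^esub> ?w)"
      using zw by (simp_all add: a_minus_def M.a_assoc M.l_neg M.minus_add M.r_neg1 M.r_neg2)
    then have "?z \<in> K \<longleftrightarrow> ?w \<in> K"
      using submoduleE(3,5)[OF K] k by metis
    then show ?thesis using ann[of "r \<ominus> q"] x(2) y(2) by (simp add: cong_mod_def)
  qed
  have coset: "PIdl d +> c x = PIdl d +> r" if "x \<in> ?P" "r \<in> carrier R" "x \<ominus>\<^bsub>M\<^esub> r \<odot>\<^bsub>M\<^esub> v \<in> K" for x r
  proof -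
    have "x \<ominus>\<^bsub>M\<^esub> x \<in> K"
      using submodule_zero_closed[OF K] Pc[OF that(1)] by (simp add: a_minus_def M.r_neg)
    then show ?thesis
      using key[OF Pc[OF that(1)] c[OF that(1)] Pc[OF that(1)] that(2,3)] c(1)[OF that(1)] that(2) d
      by (simp add: PIdl_coset_eq_iff)
  qed
  let ?h = "\<lambda>x. PIdl d +> c x"
  have "?h x \<in> carrier ?N" if "x \<in> ?P" for x using c(1)[OF that] by (simp add: carrier_cyclic_module)
  moreover have "?h (x \<oplus>\<^bsub>M\<^esub> y) = ?h x \<oplus>\<^bsub>?N\<^esub> ?h y" if xy: "x \<in> ?P" "y \<in> ?P" for x y
    using coset[OF submoduleE(5)[OF P xy] _ span_coefficient_add[OF K v Pc[OF xy(1)] c[OF xy(1)] Pc[OF xy(2)] c[OF xy(2)]]]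
      c(1)[OF xy(1)] c(1)[OF xy(2)] d by (simp add: cyclic_module_add)
  moreover have "?h (r \<odot>\<^bsub>M\<^esub> x) = r \<odot>\<^bsub>?N\<^esub> ?h x" if rx: "r \<in> carrier R" "x \<in> ?P" for r x
    using coset[OF submoduleE(4)[OF P rx] _ span_coefficient_smult[OF K v rx(1) Pc[OF rx(2)] c[OF rx(2)]]]
      c(1)[OF rx(2)] rx(1) d by (simp add: cyclic_module_smult)
  ultimately have hom: "?h \<in> module_hom R ?PM ?N" by (simp add: module_hom_def)
  have surj: "?h ` carrier ?PM = carrier ?N"
  proof (intro equalityI subsetI)
    fix X assume "X \<in> ?h ` carrier ?PM"
    then show "X \<in> carrier ?N" using c(1) by (auto simp: carrier_cyclic_module)
  next
    fix X assume "X \<in> carrier ?N"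
    then obtain r where r: "r \<in> carrier R" "X = PIdl d +> r" by (auto simp: carrier_cyclic_module)
    have rv: "r \<odot>\<^bsub>M\<^esub> v \<in> carrier M" "r \<odot>\<^bsub>M\<^esub> v \<ominus>\<^bsub>M\<^esub> r \<odot>\<^bsub>M\<^esub> v \<in> K"
      using r(1) v submodule_zero_closed[OF K] by (auto simp: a_minus_def M.r_neg)
    then have "r \<odot>\<^bsub>M\<^esub> v \<in> ?P" using mem_span_sum_iff[OF K v rv(1)] r(1) by blast
    moreover from coset[OF this r(1) rv(2)] have "?h (r \<odot>\<^bsub>M\<^esub> v) = X" using r(2) by simp
    ultimately show "X \<in> ?h ` carrier ?PM" by auto
  qed
  show ?thesis
  proof (rule module.first_isomorphism[OF submodule.submodule_is_module[OF P module_axioms] _ hom surj])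
    show "submodule K R ?PM"
      using submodule_restrict_module[OF P K subset_span_sum[OF K v]] .
    fix x y assume "x \<in> carrier ?PM" "y \<in> carrier ?PM"
    then have xy: "x \<in> ?P" "y \<in> ?P" by simp_all
    show "?h x = ?h y \<longleftrightarrow> x \<ominus>\<^bsub>?PM\<^esub> y \<in> K"
      unfolding minus_restrict_module[OF P xy(2)] key[OF Pc[OF xy(1)] c[OF xy(1)] Pc[OF xy(2)] c[OF xy(2)]]
      using PIdl_coset_eq_iff[OF d c(1)[OF xy(1)] c(1)[OF xy(2)]] .
  qed
qed

end

context pid_module begin

text \<open>The coordinates of r x are \<open>r\<close> times those of \<open>x\<close>, and R is a
  domain.\<close>

lemma torsion_free_if_basis:
  assumes e: "is_basis R M I e" and r: "r \<in> carrier R" "r \<noteq> \<zero>"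
    and x: "x \<in> carrier M" "r \<odot>\<^bsub>M\<^esub> x = \<zero>\<^bsub>M\<^esub>"
  shows "x = \<zero>\<^bsub>M\<^esub>"
proof -
  have I: "finite I" "\<And>i. i \<in> I \<Longrightarrow> e i \<in> carrier M" using e by (auto simp: is_basis_def)
  obtain c where c: "c \<in> I \<rightarrow> carrier R" "x = (\<Oplus>\<^bsub>M\<^esub> i\<in>I. c i \<odot>\<^bsub>M\<^esub> e i)"
    using is_basis_spans[OF e x(1)] .
  have ci: "c i \<in> carrier R" if "i \<in> I" for i using c(1) that by auto
  have "(\<Oplus>\<^bsub>M\<^esub> i\<in>I. (r \<otimes> c i) \<odot>\<^bsub>M\<^esub> e i) = (\<Oplus>\<^bsub>M\<^esub> i\<in>I. r \<odot>\<^bsub>M\<^esub> (c i \<odot>\<^bsub>M\<^esub> e i))"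
    using I ci r(1) by (intro M.finsum_cong') (auto simp: smult_assoc1)
  also have "\<dots> = r \<odot>\<^bsub>M\<^esub> x"
    unfolding c(2) using I ci r(1) by (intro finsum_smult_ldistr[symmetric]) auto
  finally have sum: "(\<Oplus>\<^bsub>M\<^esub> i\<in>I. (r \<otimes> c i) \<odot>\<^bsub>M\<^esub> e i) = \<zero>\<^bsub>M\<^esub>" using x(2) by simp
  have "(\<lambda>i. r \<otimes> c i) \<in> I \<rightarrow> carrier R" using ci r(1) by auto
  then have "r \<otimes> c i = \<zero>" if "i \<in> I" for i
    by (rule is_basis_independent[OF e _ sum that])
  then have "c i = \<zero>" if "i \<in> I" for i using integral[OF _ r(1) ci[OF that]] r(2) that by simp
  then have "x = (\<Oplus>\<^bsub>M\<^esub> i\<in>I. \<zero>\<^bsub>M\<^esub>)"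
    unfolding c(2) using I by (intro M.finsum_cong') auto
  then show ?thesis by (simp add: M.finsum_zero)
qed

text \<open>The Bezout combination of \<open>r\<close> and \<open>d\<close> also maps
  \<open>v\<close> into \<open>K\<close>, and it divides \<open>d\<close>. As no proper factor of
  \<open>d\<close> does this, it is an associate of \<open>d\<close>; and it divides
  \<open>r\<close>.\<close>

lemma annihilator_of_maximal_order_vector:
  assumes K: "submodule K R M" and u: "u \<in> {1..f} \<rightarrow> K" and d: "d \<in> carrier R"
    and mo: "maximal_order_vector R M K f u d v a"
    and r: "r \<in> carrier R" "r \<odot>\<^bsub>M\<^esub> v \<in> K"
  shows "d divides r"
proof -
  have v: "v \<in> carrier M" and a: "a \<in> {1..f} \<rightarrow> carrier R"
    and dv: "d \<odot>\<^bsub>M\<^esub> v = (\<Oplus>\<^bsub>M\<^esub> i\<in>{1..f}. a i \<odot>\<^bsub>M\<^esub> u i)"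
    and min: "\<And>h. \<lbrakk>h \<in> carrier R; h divides d; h \<odot>\<^bsub>M\<^esub> v \<in> K\<rbrakk> \<Longrightarrow> h \<sim> d"
    using mo unfolding maximal_order_vector_def by blast+
  have "a i \<odot>\<^bsub>M\<^esub> u i \<in> K" if "i \<in> {1..f}" for i
    using submoduleE(4)[OF K] a u that by blast
  then have dK: "d \<odot>\<^bsub>M\<^esub> v \<in> K"
    unfolding dv by (intro finsum_restrict_module(2)[OF K]) auto
  obtain \<alpha> \<beta> where ab: "\<alpha> \<in> carrier R" "\<beta> \<in> carrier R"
    "(\<alpha> \<otimes> r \<oplus> \<beta> \<otimes> d) divides r" "(\<alpha> \<otimes> r \<oplus> \<beta> \<otimes> d) divides d"
    using bezout[OF r(1) d] .
  let ?e = "\<alpha> \<otimes> r \<oplus> \<beta> \<otimes> d"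
  have "?e \<odot>\<^bsub>M\<^esub> v = \<alpha> \<odot>\<^bsub>M\<^esub> (r \<odot>\<^bsub>M\<^esub> v) \<oplus>\<^bsub>M\<^esub> \<beta> \<odot>\<^bsub>M\<^esub> (d \<odot>\<^bsub>M\<^esub> v)"
    using ab(1,2) r(1) d v by (simp add: smult_l_distr smult_assoc1)
  also have "\<dots> \<in> K"
    using submoduleE(5)[OF K submoduleE(4)[OF K ab(1) r(2)] submoduleE(4)[OF K ab(2) dK]] .
  finally have "?e \<sim> d" using ab r(1) d by (intro min) auto
  then have "d divides ?e" by (simp add: associated_def)
  then show ?thesis using divides_trans[OF _ ab(3) d] by simp
qed

end

subsection \<open>The relation module and the new basis\<close>

text \<open>Here \<open>ann\<close> stands in for the condition on proper factors: a bound on all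
  annihilating scalars is the form in which that condition is applied.\<close>

locale maximal_order_element = pid_module R M for R (structure) and M (structure) +
  fixes K and f :: nat and u d v a
  assumes K: "submodule K R M"
    and basis: "is_basis R (restrict_module M K) {1..f} u"
    and v: "v \<in> carrier M"
    and a: "a \<in> {1..f} \<rightarrow> carrier R"
    and d: "d \<in> carrier R"
    and dv: "d \<odot>\<^bsub>M\<^esub> v = (\<Oplus>\<^bsub>M\<^esub> i\<in>{1..f}. a i \<odot>\<^bsub>M\<^esub> u i)"
    and ann: "\<And>r. \<lbrakk>r \<in> carrier R; r \<odot>\<^bsub>M\<^esub> v \<in> K\<rbrakk> \<Longrightarrow> d divides r"
begin

lemma u_K: "i \<in> {1..f} \<Longrightarrow> u i \<in> K"
  using basis by (auto simp: is_basis_def)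

lemma u_M: "i \<in> {1..f} \<Longrightarrow> u i \<in> carrier M"
  using u_K submoduleE(1)[OF K] by blast

lemma combination_K:
  assumes "c \<in> {1..f} \<rightarrow> carrier R"
  shows "(\<Oplus>\<^bsub>restrict_module M K\<^esub> i\<in>{1..f}. c i \<odot>\<^bsub>M\<^esub> u i) = (\<Oplus>\<^bsub>M\<^esub> i\<in>{1..f}. c i \<odot>\<^bsub>M\<^esub> u i)"
    and "(\<Oplus>\<^bsub>M\<^esub> i\<in>{1..f}. c i \<odot>\<^bsub>M\<^esub> u i) \<in> K"
proof -
  have "(\<lambda>i. c i \<odot>\<^bsub>M\<^esub> u i) \<in> {1..f} \<rightarrow> K"
    using assms u_K by (intro Pi_I submoduleE(4)[OF K]) blast+
  then show "(\<Oplus>\<^bsub>restrict_module M K\<^esub> i\<in>{1..f}. c i \<odot>\<^bsub>M\<^esub> u i) = (\<Oplus>\<^bsub>M\<^esub> i\<in>{1..f}. c i \<odot>\<^bsub>M\<^esub> u i)"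
    and "(\<Oplus>\<^bsub>M\<^esub> i\<in>{1..f}. c i \<odot>\<^bsub>M\<^esub> u i) \<in> K"
    using finsum_restrict_module[OF K] by blast+
qed

lemma u_independent:
  assumes "c \<in> {1..f} \<rightarrow> carrier R" "(\<Oplus>\<^bsub>M\<^esub> i\<in>{1..f}. c i \<odot>\<^bsub>M\<^esub> u i) = \<zero>\<^bsub>M\<^esub>" "i \<in> {1..f}"
  shows "c i = \<zero>"
  using is_basis_independent[OF basis assms(1) _ assms(3)] assms(2) combination_K(1)[OF assms(1)]
  by simp

lemma u_spans:
  assumes "x \<in> K"
  obtains c where "c \<in> {1..f} \<rightarrow> carrier R" "x = (\<Oplus>\<^bsub>M\<^esub> i\<in>{1..f}. c i \<odot>\<^bsub>M\<^esub> u i)"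
proof -
  have "x \<in> carrier (restrict_module M K)" using assms by simp
  from is_basis_spans[OF basis this] obtain c where
    c: "c \<in> {1..f} \<rightarrow> carrier R" "x = (\<Oplus>\<^bsub>restrict_module M K\<^esub> i\<in>{1..f}. c i \<odot>\<^bsub>restrict_module M K\<^esub> u i)" .
  then show thesis using that[OF c(1)] combination_K(1)[OF c(1)] by simp
qed

lemma d_v_K: "d \<odot>\<^bsub>M\<^esub> v \<in> K"
  unfolding dv using combination_K(2)[OF a] .

lemma ann_iff:
  assumes "r \<in> carrier R" shows "r \<odot>\<^bsub>M\<^esub> v \<in> K \<longleftrightarrow> d divides r"
proof
  assume "d divides r"
  then obtain k where k: "k \<in> carrier R" "r = d \<otimes> k" by (meson dividesE)
  then have "r \<odot>\<^bsub>M\<^esub> v = k \<odot>\<^bsub>M\<^esub> (d \<odot>\<^bsub>M\<^esub> v)"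
    using d v by (simp add: m_comm[of d] smult_assoc1)
  then show "r \<odot>\<^bsub>M\<^esub> v \<in> K" using submoduleE(4)[OF K k(1) d_v_K] by simp
qed (use ann assms in blast)

abbreviation (input) "P \<equiv> (\<lambda>r. r \<odot>\<^bsub>M\<^esub> v) ` carrier R <+>\<^bsub>M\<^esub> K"
abbreviation (input) "u' \<equiv> u(f + 1 := v)"
abbreviation (input) "a' \<equiv> a(f + 1 := \<ominus> d)"

lemma a'_closed: "a' \<in> {1..f + 1} \<rightarrow> carrier R"
proof
  fix j assume "j \<in> {1..f + 1}"
  then have "j = f + 1 \<or> j \<in> {1..f}" by auto
  then show "a' j \<in> carrier R" using a d by auto
qed

lemma P_submodule: "submodule P R M"
  using submodule_span_sum[OF K v] .

lemma u'_P:
  assumes "j \<in> {1..f + 1}" shows "u' j \<in> P"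
proof (cases "j = f + 1")
  case True
  have "v \<ominus>\<^bsub>M\<^esub> \<one> \<odot>\<^bsub>M\<^esub> v \<in> K"
    using v submodule_zero_closed[OF K] by (simp add: a_minus_def M.r_neg)
  then have "v \<in> P" unfolding mem_span_sum_iff[OF K v v] by blast
  then show ?thesis using True by simp
next
  case False
  then have "u j \<in> K" using assms by (intro u_K) auto
  then show ?thesis using False subset_span_sum[OF K v] by auto
qed

lemma u'_M: "j \<in> {1..f + 1} \<Longrightarrow> u' j \<in> carrier M"
  using u'_P submoduleE(1)[OF P_submodule] by blast

lemma combination_u':
  assumes b: "b \<in> {1..f + 1} \<rightarrow> carrier R"
  shows "(\<Oplus>\<^bsub>M\<^esub> j\<in>{1..f + 1}. b j \<odot>\<^bsub>M\<^esub> u' j)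
    = b (f + 1) \<odot>\<^bsub>M\<^esub> v \<oplus>\<^bsub>M\<^esub> (\<Oplus>\<^bsub>M\<^esub> j\<in>{1..f}. b j \<odot>\<^bsub>M\<^esub> u j)"
proof -
  have bj: "b j \<in> carrier R" if "j \<in> {1..f + 1}" for j using b that by blast
  have set: "{1..f + 1} = insert (f + 1) {1..f}" by auto
  have "(\<Oplus>\<^bsub>M\<^esub> j\<in>insert (f + 1) {1..f}. b j \<odot>\<^bsub>M\<^esub> u' j)
      = b (f + 1) \<odot>\<^bsub>M\<^esub> u' (f + 1) \<oplus>\<^bsub>M\<^esub> (\<Oplus>\<^bsub>M\<^esub> j\<in>{1..f}. b j \<odot>\<^bsub>M\<^esub> u' j)"
  proof (intro M.finsum_insert)
    show "(\<lambda>j. b j \<odot>\<^bsub>M\<^esub> u' j) \<in> {1..f} \<rightarrow> carrier M"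
      using bj u'_M set by (intro Pi_I smult_closed) blast+
    show "b (f + 1) \<odot>\<^bsub>M\<^esub> u' (f + 1) \<in> carrier M"
      using bj u'_M set by (intro smult_closed) blast+
  qed auto
  also have "(\<Oplus>\<^bsub>M\<^esub> j\<in>{1..f}. b j \<odot>\<^bsub>M\<^esub> u' j) = (\<Oplus>\<^bsub>M\<^esub> j\<in>{1..f}. b j \<odot>\<^bsub>M\<^esub> u j)"
  proof (intro M.finsum_cong')
    show "(\<lambda>j. b j \<odot>\<^bsub>M\<^esub> u j) \<in> {1..f} \<rightarrow> carrier M"
      using bj u_M set by (intro Pi_I smult_closed) blast+
  qed auto
  finally show ?thesis unfolding set by simp
qed

lemma relation: "(\<Oplus>\<^bsub>M\<^esub> j\<in>{1..f + 1}. a' j \<odot>\<^bsub>M\<^esub> u' j) = \<zero>\<^bsub>M\<^esub>"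
proof -
  have "(\<Oplus>\<^bsub>M\<^esub> j\<in>{1..f}. a' j \<odot>\<^bsub>M\<^esub> u j) = (\<Oplus>\<^bsub>M\<^esub> j\<in>{1..f}. a j \<odot>\<^bsub>M\<^esub> u j)"
    using a u_M by (intro M.finsum_cong') auto
  then have "(\<Oplus>\<^bsub>M\<^esub> j\<in>{1..f}. a' j \<odot>\<^bsub>M\<^esub> u j) = d \<odot>\<^bsub>M\<^esub> v" using dv by simp
  then show ?thesis
    unfolding combination_u'[OF a'_closed] using d v by (simp add: smult_l_minus M.l_neg)
qed

text \<open>The coefficient of \<open>v\<close> in a relation maps \<open>v\<close> into
  \<open>K\<close>, so it is a multiple d l. Adding l times the basic relation removes
  \<open>v\<close> and leaves a relation among the independent \<open>u\<close>, which is
  trivial.\<close>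

lemma relations_multiple:
  assumes b: "b \<in> {1..f + 1} \<rightarrow> carrier R"
    and rel: "(\<Oplus>\<^bsub>M\<^esub> j\<in>{1..f + 1}. b j \<odot>\<^bsub>M\<^esub> u' j) = \<zero>\<^bsub>M\<^esub>"
  shows "\<exists>k\<in>carrier R. \<forall>j\<in>{1..f + 1}. b j = k \<otimes> a' j"
proof -
  have bj: "b j \<in> carrier R" if "j \<in> {1..f + 1}" for j using b that by blast
  have bf: "b \<in> {1..f} \<rightarrow> carrier R" "b (f + 1) \<in> carrier R" using bj by auto
  let ?s = "\<Oplus>\<^bsub>M\<^esub> j\<in>{1..f}. b j \<odot>\<^bsub>M\<^esub> u j"
  have s: "?s \<in> K" "?s \<in> carrier M"
    using combination_K(2)[OF bf(1)] submoduleE(1)[OF K] by auto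
  have "b (f + 1) \<odot>\<^bsub>M\<^esub> v \<oplus>\<^bsub>M\<^esub> ?s = \<zero>\<^bsub>M\<^esub>" using rel combination_u'[OF b] by simp
  then have eq: "\<ominus>\<^bsub>M\<^esub> ?s = b (f + 1) \<odot>\<^bsub>M\<^esub> v"
    using M.minus_equality[of "b (f + 1) \<odot>\<^bsub>M\<^esub> v" ?s] s(2) bf(2) v by simp
  then have "b (f + 1) \<odot>\<^bsub>M\<^esub> v \<in> K" using submoduleE(3)[OF K s(1)] by simp
  then obtain l where l: "l \<in> carrier R" "b (f + 1) = d \<otimes> l"
    using ann[OF bf(2)] by (meson dividesE)
  have aj: "a j \<in> carrier R" if "j \<in> {1..f}" for j using a that by blast
  have "(\<Oplus>\<^bsub>M\<^esub> j\<in>{1..f}. (b j \<oplus> l \<otimes> a j) \<odot>\<^bsub>M\<^esub> u j)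
      = (\<Oplus>\<^bsub>M\<^esub> j\<in>{1..f}. b j \<odot>\<^bsub>M\<^esub> u j \<oplus>\<^bsub>M\<^esub> l \<odot>\<^bsub>M\<^esub> (a j \<odot>\<^bsub>M\<^esub> u j))"
    using bj aj u_M l(1) by (intro M.finsum_cong') (auto simp: smult_l_distr smult_assoc1)
  also have "\<dots> = ?s \<oplus>\<^bsub>M\<^esub> (\<Oplus>\<^bsub>M\<^esub> j\<in>{1..f}. l \<odot>\<^bsub>M\<^esub> (a j \<odot>\<^bsub>M\<^esub> u j))"
    using bj aj u_M l(1) by (intro M.finsum_addf) auto
  also have "(\<Oplus>\<^bsub>M\<^esub> j\<in>{1..f}. l \<odot>\<^bsub>M\<^esub> (a j \<odot>\<^bsub>M\<^esub> u j)) = l \<odot>\<^bsub>M\<^esub> (d \<odot>\<^bsub>M\<^esub> v)"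
    unfolding dv using aj u_M l(1) by (intro finsum_smult_ldistr[symmetric]) auto
  also have "\<dots> = b (f + 1) \<odot>\<^bsub>M\<^esub> v"
    unfolding l(2) using l(1) d v by (simp add: m_comm[of d] smult_assoc1)
  also have "?s \<oplus>\<^bsub>M\<^esub> b (f + 1) \<odot>\<^bsub>M\<^esub> v = \<zero>\<^bsub>M\<^esub>"
    unfolding eq[symmetric] using s(2) by (simp add: M.r_neg)
  finally have sum: "(\<Oplus>\<^bsub>M\<^esub> j\<in>{1..f}. (b j \<oplus> l \<otimes> a j) \<odot>\<^bsub>M\<^esub> u j) = \<zero>\<^bsub>M\<^esub>" .
  have "(\<lambda>j. b j \<oplus> l \<otimes> a j) \<in> {1..f} \<rightarrow> carrier R" using bj aj l(1) by auto
  then have z: "b j \<oplus> l \<otimes> a j = \<zero>" if "j \<in> {1..f}" for j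
    by (rule u_independent[OF _ sum that])
  \<comment> \<open>The factor is -l, as the row \<open>a'\<close> ends in -d.\<close>
  show ?thesis
  proof (intro bexI[of _ "\<ominus> l"] ballI)
    show "\<ominus> l \<in> carrier R" using l(1) by simp
    fix j assume j: "j \<in> {1..f + 1}"
    show "b j = (\<ominus> l) \<otimes> a' j"
    proof (cases "j = f + 1")
      case True
      have "d \<otimes> l = (\<ominus> l) \<otimes> (\<ominus> d)" using d l(1) by algebra
      then show ?thesis using True l(2) by simp
    next
      case False
      then have j: "j \<in> {1..f}" using j by auto
      have "b j = (b j \<oplus> l \<otimes> a j) \<oplus> (\<ominus> l) \<otimes> a j"
        using bj[of j] aj[OF j] j l(1) by (simp add: R.l_minus R.a_assoc R.r_neg)
      then show ?thesis using z[OF j] False aj[OF j] l(1) by simp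
    qed
  qed
qed

text \<open>By torsion freeness the row divided by a common divisor \<open>e\<close> is again a
  relation, hence a multiple of the row itself, and this forces \<open>e\<close> to be
  invertible.\<close>

lemma gcd_a'_one:
  assumes d0: "d \<noteq> \<zero>"
    and torsion_free: "\<And>r x. \<lbrakk>r \<in> carrier R; r \<noteq> \<zero>; x \<in> carrier M; r \<odot>\<^bsub>M\<^esub> x = \<zero>\<^bsub>M\<^esub>\<rbrakk> \<Longrightarrow> x = \<zero>\<^bsub>M\<^esub>"
  shows "is_gcd_of_set R \<one> (a' ` {1..f + 1})"
proof -
  have "e \<in> Units R" if e: "e \<in> carrier R" "\<forall>x\<in>a' ` {1..f + 1}. e divides x" for e
  proof -
    have "\<exists>b\<in>carrier R. a' j = e \<otimes> b" if "j \<in> {1..f + 1}" for j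
      using e(2) that by (auto simp: factor_def)
    then obtain b where b: "\<And>j. j \<in> {1..f + 1} \<Longrightarrow> b j \<in> carrier R \<and> a' j = e \<otimes> b j"
      by metis
    have bc: "b \<in> {1..f + 1} \<rightarrow> carrier R" using b by blast
    have bn: "b (f + 1) \<in> carrier R" "\<ominus> d = e \<otimes> b (f + 1)" using b[of "f + 1"] by auto
    have e0: "e \<noteq> \<zero>" using bn d0 d by (metis R.add.inv_eq_1_iff R.l_null)
    have x: "(\<Oplus>\<^bsub>M\<^esub> j\<in>{1..f + 1}. b j \<odot>\<^bsub>M\<^esub> u' j) \<in> carrier M"
      using b u'_M by (intro M.finsum_closed) auto
    have "e \<odot>\<^bsub>M\<^esub> (\<Oplus>\<^bsub>M\<^esub> j\<in>{1..f + 1}. b j \<odot>\<^bsub>M\<^esub> u' j)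
        = (\<Oplus>\<^bsub>M\<^esub> j\<in>{1..f + 1}. e \<odot>\<^bsub>M\<^esub> (b j \<odot>\<^bsub>M\<^esub> u' j))"
      using b u'_M e(1) by (intro finsum_smult_ldistr) auto
    also have "\<dots> = (\<Oplus>\<^bsub>M\<^esub> j\<in>{1..f + 1}. a' j \<odot>\<^bsub>M\<^esub> u' j)"
    proof (intro M.finsum_cong')
      fix j assume j: "j \<in> {1..f + 1}"
      show "e \<odot>\<^bsub>M\<^esub> (b j \<odot>\<^bsub>M\<^esub> u' j) = a' j \<odot>\<^bsub>M\<^esub> u' j"
        using b[OF j] u'_M[OF j] e(1) smult_assoc1[of e "b j" "u' j"] by metis
    next
      show "(\<lambda>j. a' j \<odot>\<^bsub>M\<^esub> u' j) \<in> {1..f + 1} \<rightarrow> carrier M"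
        using a'_closed u'_M by (intro Pi_I smult_closed) blast+
    qed simp
    also have "\<dots> = \<zero>\<^bsub>M\<^esub>" by (rule relation)
    finally have rel: "(\<Oplus>\<^bsub>M\<^esub> j\<in>{1..f + 1}. b j \<odot>\<^bsub>M\<^esub> u' j) = \<zero>\<^bsub>M\<^esub>"
      by (rule torsion_free[OF e(1) e0 x])
    obtain k where k: "k \<in> carrier R" "\<forall>j\<in>{1..f + 1}. b j = k \<otimes> a' j"
      using relations_multiple[OF bc rel] by (elim bexE)
    \<comment> \<open>Comparing the last entries is enough: this entry is nonzero because
      \<open>d\<close> is, so it can be cancelled.\<close>
    have "b (f + 1) = k \<otimes> \<ominus> d" using bspec[OF k(2), of "f + 1"] by simp
    then have "b (f + 1) = k \<otimes> (e \<otimes> b (f + 1))" unfolding bn(2) .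
    moreover have "k \<otimes> (e \<otimes> b (f + 1)) = b (f + 1) \<otimes> (e \<otimes> k)"
      using bn(1) k(1) e(1) by (simp add: m_ac)
    ultimately have "b (f + 1) \<otimes> \<one> = b (f + 1) \<otimes> (e \<otimes> k)"
      using bn(1) by (metis R.r_one)
    moreover have "b (f + 1) \<noteq> \<zero>" using bn d0 d e(1) by (metis R.add.inv_eq_1_iff R.r_null)
    ultimately have "\<one> = e \<otimes> k" using m_lcancel[of "b (f + 1)" \<one> "e \<otimes> k"] bn(1) k(1) e(1) by simp
    then show ?thesis using divides_one[OF e(1)] k(1) by (metis dividesI)
  qed
  moreover have "a' ` {1..f + 1} \<subseteq> carrier R" using a'_closed by (intro image_subsetI) blast
  ultimately show ?thesis using is_gcd_one_iff by blast
qed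

text \<open>A combination of the \<open>w\<close> with coefficient row c is the combination of the
  \<open>u'\<close> with row c times the inverse of \<open>Q\<close>. Multiplying rows by
  \<open>Q\<close> and by its inverse translates between both systems, for spanning as well as for
  independence.\<close>

lemma transformed_basis:
  assumes Q: "Q \<in> GL R (f + 1)" and e1: "row_is_e1 R (f + 1) (row_times_matrix R (f + 1) a' Q)"
  defines "w \<equiv> matrix_times_column M (f + 1) (inv\<^bsub>matrix_monoid R (f + 1)\<^esub> Q) u'"
  shows "w 1 = \<zero>\<^bsub>M\<^esub>" and "is_basis R (restrict_module M P) {2..f + 1} w"
proof -
  let ?n = "f + 1"
  let ?G = "matrix_monoid R ?n"
  let ?row = "row_times_matrix R ?n"
  let ?B = "inv\<^bsub>?G\<^esub> Q"
  interpret G: monoid ?G by (rule monoid_matrix_monoid)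
  have QB: "Q \<in> carrier ?G" "?B \<in> carrier ?G" "Q \<otimes>\<^bsub>?G\<^esub> ?B = \<one>\<^bsub>?G\<^esub>" "?B \<otimes>\<^bsub>?G\<^esub> Q = \<one>\<^bsub>?G\<^esub>"
    using G.Units_closed G.Units_inv_closed G.Units_r_inv G.Units_l_inv Q unfolding GL_def by blast+
  have rc: "?row c A \<in> {1..?n} \<rightarrow> carrier R" if "c \<in> {1..?n} \<rightarrow> carrier R" "A \<in> carrier ?G" for c A
    using row_times_matrix_closed[OF that(2,1)] by blast
  have rQB: "?row (?row c Q) ?B j = c j" if "c \<in> {1..?n} \<rightarrow> carrier R" "j \<in> {1..?n}" for c j
    using row_times_matrix_mult[OF QB(1,2) that] QB(3) row_times_matrix_one[OF that] by simp
  have rBQ: "?row (?row c ?B) Q j = c j" if "c \<in> {1..?n} \<rightarrow> carrier R" "j \<in> {1..?n}" for c j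
    using row_times_matrix_mult[OF QB(2,1) that] QB(4) row_times_matrix_one[OF that] by simp
  have w_P: "w i \<in> P" if "i \<in> {1..?n}" for i
    unfolding w_def matrix_times_column_def
    using matrix_entry_closed[OF QB(2) that] u'_P submoduleE(4)[OF P_submodule]
    by (intro finsum_restrict_module(2)[OF P_submodule] Pi_I) blast+
  have w_M: "w i \<in> carrier M" if "i \<in> {1..?n}" for i
    using w_P[OF that] submoduleE(1)[OF P_submodule] by blast
  have comb: "(\<Oplus>\<^bsub>M\<^esub> i\<in>{1..?n}. c i \<odot>\<^bsub>M\<^esub> w i) = (\<Oplus>\<^bsub>M\<^esub> j\<in>{1..?n}. ?row c ?B j \<odot>\<^bsub>M\<^esub> u' j)"
    if "c \<in> {1..?n} \<rightarrow> carrier R" for c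
    unfolding w_def matrix_times_column_def row_times_matrix_def
    using that matrix_entry_closed[OF QB(2)] u'_M by (intro finsum_smult_assoc) blast+
  have e1': "?row a' Q j = (if j = 1 then \<one> else \<zero>)" if "j \<in> {1..?n}" for j
    using e1 that by (simp add: row_is_e1_def)
  have smult_eq: "(\<Oplus>\<^bsub>M\<^esub> j\<in>{1..?n}. x j \<odot>\<^bsub>M\<^esub> u' j) = (\<Oplus>\<^bsub>M\<^esub> j\<in>{1..?n}. y j \<odot>\<^bsub>M\<^esub> u' j)"
    if "\<And>j. j \<in> {1..?n} \<Longrightarrow> x j = y j" "y \<in> {1..?n} \<rightarrow> carrier R" for x y
    using that u'_M by (intro M.finsum_cong' Pi_I smult_closed) auto

  \<comment> \<open>The row \<open>?row a' Q\<close> applied to \<open>w\<close> is computed in two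
    ways: it is the basic relation among the \<open>u'\<close>, and it is \<open>w 1\<close> because
    the row is (1, 0, ..., 0).\<close>
  have "(\<Oplus>\<^bsub>M\<^esub> i\<in>{1..?n}. ?row a' Q i \<odot>\<^bsub>M\<^esub> w i) = (\<Oplus>\<^bsub>M\<^esub> j\<in>{1..?n}. a' j \<odot>\<^bsub>M\<^esub> u' j)"
    unfolding comb[OF rc[OF a'_closed QB(1)]] using rQB[OF a'_closed] a'_closed by (intro smult_eq)
  then have "(\<Oplus>\<^bsub>M\<^esub> i\<in>{1..?n}. ?row a' Q i \<odot>\<^bsub>M\<^esub> w i) = \<zero>\<^bsub>M\<^esub>" using relation by simp
  moreover have "(\<Oplus>\<^bsub>M\<^esub> i\<in>{1..?n}. ?row a' Q i \<odot>\<^bsub>M\<^esub> w i) = ?row a' Q 1 \<odot>\<^bsub>M\<^esub> w 1"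
    using e1' w_M by (intro M.finsum_single) auto
  ultimately show w1: "w 1 = \<zero>\<^bsub>M\<^esub>" using e1'[of 1] w_M[of 1] by simp

  \<comment> \<open>Since \<open>w 1\<close> is zero, the first coefficient is free. Spanning
    discards it, and independence will set it to 0.\<close>
  have drop1: "(\<Oplus>\<^bsub>restrict_module M P\<^esub> i\<in>{2..?n}. c i \<odot>\<^bsub>M\<^esub> w i) = (\<Oplus>\<^bsub>M\<^esub> i\<in>{1..?n}. c' i \<odot>\<^bsub>M\<^esub> w i)"
    if c: "c \<in> {2..?n} \<rightarrow> carrier R" "c' \<in> {1..?n} \<rightarrow> carrier R" "\<And>i. i \<in> {2..?n} \<Longrightarrow> c i = c' i" for c c'
  proof -
    have c': "c' i \<in> carrier R" if "i \<in> {1..?n}" for i using c(2) that by blast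
    have "c i \<odot>\<^bsub>M\<^esub> w i \<in> P" if "i \<in> {2..?n}" for i
    proof (rule submoduleE(4)[OF P_submodule])
      show "c i \<in> carrier R" using c(1) that by blast
      show "w i \<in> P" using that by (intro w_P) simp
    qed
    then have "(\<Oplus>\<^bsub>restrict_module M P\<^esub> i\<in>{2..?n}. c i \<odot>\<^bsub>M\<^esub> w i) = (\<Oplus>\<^bsub>M\<^esub> i\<in>{2..?n}. c i \<odot>\<^bsub>M\<^esub> w i)"
      by (intro finsum_restrict_module(1)[OF P_submodule]) blast+
    also have "\<dots> = (\<Oplus>\<^bsub>M\<^esub> i\<in>{2..?n}. c' i \<odot>\<^bsub>M\<^esub> w i)"
      using c(3) c' w_M by (intro M.finsum_cong') auto
    also have "\<dots> = c' 1 \<odot>\<^bsub>M\<^esub> w 1 \<oplus>\<^bsub>M\<^esub> (\<Oplus>\<^bsub>M\<^esub> i\<in>{2..?n}. c' i \<odot>\<^bsub>M\<^esub> w i)"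
      using w1 c' w_M by (simp add: Pi_iff)
    also have "\<dots> = (\<Oplus>\<^bsub>M\<^esub> i\<in>insert 1 {2..?n}. c' i \<odot>\<^bsub>M\<^esub> w i)"
      using c' w_M by (intro M.finsum_insert[symmetric]) auto
    also have "insert 1 {2..?n} = {1..?n}" by auto
    finally show ?thesis .
  qed
  have "\<exists>c\<in>{2..?n} \<rightarrow> carrier R. x = (\<Oplus>\<^bsub>restrict_module M P\<^esub> i\<in>{2..?n}. c i \<odot>\<^bsub>M\<^esub> w i)"
    if x: "x \<in> P" for x
  proof -
    have xM: "x \<in> carrier M" using x submoduleE(1)[OF P_submodule] by blast
    obtain r where r: "r \<in> carrier R" "x \<ominus>\<^bsub>M\<^esub> r \<odot>\<^bsub>M\<^esub> v \<in> K"
      using x unfolding mem_span_sum_iff[OF K v xM] by blast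
    obtain k where k: "k \<in> {1..f} \<rightarrow> carrier R" "x \<ominus>\<^bsub>M\<^esub> r \<odot>\<^bsub>M\<^esub> v = (\<Oplus>\<^bsub>M\<^esub> i\<in>{1..f}. k i \<odot>\<^bsub>M\<^esub> u i)"
      using u_spans[OF r(2)] .
    let ?b = "k(?n := r)"
    have b: "?b \<in> {1..?n} \<rightarrow> carrier R"
    proof
      fix j assume "j \<in> {1..?n}"
      then have "j = ?n \<or> j \<in> {1..f}" by auto
      then show "?b j \<in> carrier R" using k(1) r(1) by auto
    qed
    have "(\<Oplus>\<^bsub>M\<^esub> j\<in>{1..f}. ?b j \<odot>\<^bsub>M\<^esub> u j) = (\<Oplus>\<^bsub>M\<^esub> j\<in>{1..f}. k j \<odot>\<^bsub>M\<^esub> u j)"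
      using k(1) u_M by (intro M.finsum_cong') auto
    then have "(\<Oplus>\<^bsub>M\<^esub> j\<in>{1..?n}. ?b j \<odot>\<^bsub>M\<^esub> u' j) = r \<odot>\<^bsub>M\<^esub> v \<oplus>\<^bsub>M\<^esub> (x \<ominus>\<^bsub>M\<^esub> r \<odot>\<^bsub>M\<^esub> v)"
      unfolding combination_u'[OF b] k(2) by simp
    also have "\<dots> = x" using xM r(1) v by (simp add: a_minus_def M.a_lcomm M.r_neg)
    finally have "x = (\<Oplus>\<^bsub>M\<^esub> j\<in>{1..?n}. ?b j \<odot>\<^bsub>M\<^esub> u' j)" by simp
    also have "\<dots> = (\<Oplus>\<^bsub>M\<^esub> j\<in>{1..?n}. ?row (?row ?b Q) ?B j \<odot>\<^bsub>M\<^esub> u' j)"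
      using rQB[OF b] b by (intro smult_eq[symmetric])
    also have "\<dots> = (\<Oplus>\<^bsub>M\<^esub> i\<in>{1..?n}. ?row ?b Q i \<odot>\<^bsub>M\<^esub> w i)"
      using comb[OF rc[OF b QB(1)]] by simp
    also have "\<dots> = (\<Oplus>\<^bsub>restrict_module M P\<^esub> i\<in>{2..?n}. ?row ?b Q i \<odot>\<^bsub>M\<^esub> w i)"
      using rc[OF b QB(1)] by (intro drop1[symmetric]) auto
    finally show ?thesis using rc[OF b QB(1)] by (intro bexI[of _ "?row ?b Q"]) auto
  qed
  moreover have "c i = \<zero>"
    if c: "c \<in> {2..?n} \<rightarrow> carrier R" and i: "i \<in> {2..?n}"
      and sum: "(\<Oplus>\<^bsub>restrict_module M P\<^esub> i\<in>{2..?n}. c i \<odot>\<^bsub>M\<^esub> w i) = \<zero>\<^bsub>M\<^esub>" for c i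
  proof -
    \<comment> \<open>Seen among the \<open>u'\<close>, this relation has a row that is k times
      \<open>a'\<close>. Multiplied back by \<open>Q\<close>, this says that \<open>?c\<close> is k
      times (1, 0, ..., 0); the zero put in first place gives k = 0.\<close>
    let ?c = "c(1 := \<zero>)"
    have c': "?c \<in> {1..?n} \<rightarrow> carrier R"
    proof
      fix j assume "j \<in> {1..?n}"
      then have "j = 1 \<or> j \<in> {2..?n}" by auto
      then show "?c j \<in> carrier R" using c by auto
    qed
    have "(\<Oplus>\<^bsub>M\<^esub> i\<in>{1..?n}. ?c i \<odot>\<^bsub>M\<^esub> w i) = \<zero>\<^bsub>M\<^esub>"
      using drop1[OF c c'] sum by simp
    then have "(\<Oplus>\<^bsub>M\<^esub> j\<in>{1..?n}. ?row ?c ?B j \<odot>\<^bsub>M\<^esub> u' j) = \<zero>\<^bsub>M\<^esub>" using comb[OF c'] by simp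
    then have "\<exists>k\<in>carrier R. \<forall>j\<in>{1..?n}. ?row ?c ?B j = k \<otimes> a' j"
      by (rule relations_multiple[OF rc[OF c' QB(2)]])
    then obtain k where k: "k \<in> carrier R" "\<forall>j\<in>{1..?n}. ?row ?c ?B j = k \<otimes> a' j"
      by (elim bexE)
    have a'j: "a' j \<in> carrier R" if "j \<in> {1..?n}" for j using a'_closed that by blast
    have ck: "?c j = k \<otimes> ?row a' Q j" if j: "j \<in> {1..?n}" for j
    proof -
      note q = matrix_entry_closed[OF QB(1) _ j]
      have "?c j = ?row (?row ?c ?B) Q j" using rBQ[OF c' j] by simp
      also have "\<dots> = (\<Oplus>i\<in>{1..?n}. k \<otimes> (a' i \<otimes> Q (i, j)))"
        unfolding row_times_matrix_def[of R ?n "?row ?c ?B"]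
        using k a'j q by (intro R.finsum_cong') (simp_all add: m_assoc)
      also have "\<dots> = k \<otimes> ?row a' Q j"
        unfolding row_times_matrix_def
        using k(1) a'j q by (intro R.finsum_rdistr[symmetric] Pi_I) auto
      finally show ?thesis .
    qed
    have "k = \<zero>" using ck[of 1] e1'[of 1] k(1) by simp
    then show "c i = \<zero>" using ck[of i] e1'[of i] i by auto
  qed
  moreover have "w \<in> {2..?n} \<rightarrow> P" using w_P by auto
  ultimately show "is_basis R (restrict_module M P) {2..f + 1} w"
    unfolding is_basis_def by simp
qed

end

section \<open>Existence of a vector of maximal order, and conclusion\<close>

lemma (in pid_module) maximal_order_vector_exists:
  assumes K: "submodule K R M" and u: "is_basis R (restrict_module M K) {1..f} u"
    and s: "s \<in> I" and g: "g \<in> I \<rightarrow> carrier R" "\<And>i. i \<in> I \<Longrightarrow> g i divides g s"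
    and \<xi>: "quotient_coordinates R M K I g \<xi>"
  shows "\<exists>v a. maximal_order_vector R M K f u (g s) v a"
proof -
  let ?d = "g s"
  have gi: "g i \<in> carrier R" if "i \<in> I" for i using g that by auto
  note d = gi[OF s]
  have lin: "linear_mod R M (g i) (\<xi> i)" if "i \<in> I" for i
    using \<xi> that by (simp add: quotient_coordinates_def)
  note D = linear_modD[OF lin]
  have memK: "x \<in> K \<longleftrightarrow> (\<forall>i\<in>I. g i divides \<xi> i x)" if "x \<in> carrier M" for x
    using \<xi> that by (simp add: quotient_coordinates_def)
  have "\<forall>c\<in>I \<rightarrow> carrier R. \<exists>x\<in>carrier M. \<forall>i\<in>I. cong_mod R (g i) (\<xi> i x) (c i)"
    using \<xi> unfolding quotient_coordinates_def by blast
  \<comment> \<open>All coordinates of \<open>v\<close> are taken to be 1, so r v lies in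
    \<open>K\<close> exactly when every \<open>g i\<close> divides r. That \<open>g s\<close> is a
    multiple of all of them puts its multiple of \<open>v\<close> into \<open>K\<close>; the
    \<open>s\<close>-th coordinate excludes the proper factors.\<close>
  from bspec[OF this, of "\<lambda>i. \<one>"] obtain v where v: "v \<in> carrier M" "\<forall>i\<in>I. cong_mod R (g i) (\<xi> i v) \<one>"
    by auto
  have coord: "g i divides \<xi> i (r \<odot>\<^bsub>M\<^esub> v) \<longleftrightarrow> g i divides r" if i: "i \<in> I" and r: "r \<in> carrier R" for i r
  proof -
    have "cong_mod R (g i) (r \<otimes> \<xi> i v) (r \<otimes> \<one>)"
      using v D(1)[OF i v(1)] gi[OF i] r i by (intro cong_mod_scale) auto
    then have "cong_mod R (g i) (\<xi> i (r \<odot>\<^bsub>M\<^esub> v)) (r \<otimes> \<one>)"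
      using D(1)[OF i v(1)] D(1)[OF i smult_closed[OF r v(1)]] gi[OF i] r
      by (intro cong_mod_trans[OF D(3)[OF i r v(1)]]) simp_all
    from cong_mod_divides_iff[OF this gi[OF i] D(1)[OF i smult_closed[OF r v(1)]]] show ?thesis
      using r by simp
  qed
  have "?d \<odot>\<^bsub>M\<^esub> v \<in> K"
    using memK[of "?d \<odot>\<^bsub>M\<^esub> v"] coord d v(1) g(2) by simp
  then have "?d \<odot>\<^bsub>M\<^esub> v \<in> carrier (restrict_module M K)" by simp
  from is_basis_spans[OF u this] obtain a where a: "a \<in> {1..f} \<rightarrow> carrier R"
    "?d \<odot>\<^bsub>M\<^esub> v = (\<Oplus>\<^bsub>restrict_module M K\<^esub> i\<in>{1..f}. a i \<odot>\<^bsub>restrict_module M K\<^esub> u i)" .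
  have "u i \<in> K" if "i \<in> {1..f}" for i using u that by (auto simp: is_basis_def)
  then have "(\<lambda>i. a i \<odot>\<^bsub>M\<^esub> u i) \<in> {1..f} \<rightarrow> K"
    using a(1) by (intro Pi_I submoduleE(4)[OF K]) blast+
  then have "?d \<odot>\<^bsub>M\<^esub> v = (\<Oplus>\<^bsub>M\<^esub> i\<in>{1..f}. a i \<odot>\<^bsub>M\<^esub> u i)"
    using a(2) finsum_restrict_module(1)[OF K, of "{1..f}" "\<lambda>i. a i \<odot>\<^bsub>M\<^esub> u i"] by simp
  moreover have "h \<sim> ?d" if h: "h \<in> carrier R" "h divides ?d" "h \<odot>\<^bsub>M\<^esub> v \<in> K" for h
  proof -
    have "h \<odot>\<^bsub>M\<^esub> v \<in> carrier M" using h v by simp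
    then have "?d divides \<xi> s (h \<odot>\<^bsub>M\<^esub> v)" using memK h(3) s by blast
    then show ?thesis using h coord[OF s h(1)] by (simp add: associated_def)
  qed
  ultimately show ?thesis
    using v(1) a(1) unfolding maximal_order_vector_def by (intro exI[of _ v] exI[of _ a]) blast
qed

theorem mainTheorem3:
  fixes R :: "('a, 'm) ring_scheme" and L :: "('a, 'b, 'n) module_scheme"
    and M :: "'b set" and f s :: nat and u :: "nat \<Rightarrow> 'b" and g :: "nat \<Rightarrow> 'a"
  assumes PID: "principal_domain R"
    and L: "module R L"
    and f: "1 \<le> f"
    and L_free: "free_of_rank R L f"
    and M: "submodule M R L" "M \<subset> carrier L"
    and u_basis: "is_basis R (restrict_module L M) {1..f} u"
    and g: "invariant_factors R (quotient_module L M) s g"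
  shows
    "(\<exists>v a. maximal_order_vector R L M f u (g s) v a) \<and>
     (\<forall>v a. maximal_order_vector R L M f u (g s) v a \<longrightarrow>
       (let P = (\<lambda>r. r \<odot>\<^bsub>L\<^esub> v) ` carrier R <+>\<^bsub>L\<^esub> M;
            u' = u(f + 1 := v);
            a' = a(f + 1 := \<ominus>\<^bsub>R\<^esub> g s)
        in
          (submodule P R L \<and>
           module_isomorphic R (quotient_module (restrict_module L P) M) (cyclic_module R (g s)) \<and>
           module_isomorphic R (quotient_module L P)
             (finite_direct_sum {1..s - 1} (\<lambda>i. cyclic_module R (g i)))) \<and>
          (is_gcd_of_set R \<one>\<^bsub>R\<^esub> (a' ` {1..f + 1}) \<and>
           (\<exists>Q\<in>GL R (f + 1). row_is_e1 R (f + 1) (row_times_matrix R (f + 1) a' Q)) \<and>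
           (\<forall>Q\<in>GL R (f + 1). row_is_e1 R (f + 1) (row_times_matrix R (f + 1) a' Q) \<longrightarrow>
             (let w = matrix_times_column L (f + 1) (inv\<^bsub>matrix_monoid R (f + 1)\<^esub> Q) u'
              in w 1 = \<zero>\<^bsub>L\<^esub> \<and> is_basis R (restrict_module L P) {2..f + 1} w)))))"
proof -
  interpret PM: pid_module R L
    using L PID by (intro pid_module.intro)
  have s: "1 \<le> s" "s \<in> {1..s}" and g_closed: "g \<in> {1..s} \<rightarrow> carrier R"
    and gs0: "g s \<noteq> \<zero>\<^bsub>R\<^esub>"
    and chain: "\<And>i. i \<in> {1..<s} \<Longrightarrow> g i divides\<^bsub>R\<^esub> g (i + 1)"
    and iso: "module_isomorphic R (quotient_module L M)
      (finite_direct_sum {1..s} (\<lambda>i. cyclic_module R (g i)))"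
    using g by (auto simp: invariant_factors_def)
  have gi: "g i \<in> carrier R" if "i \<in> {1..s}" for i using g_closed that by blast
  have g_dvd: "g i divides\<^bsub>R\<^esub> g s" if "i \<in> {1..s}" for i
  proof -
    have "i \<le> s" "1 \<le> i" using that by auto
    then show ?thesis
    proof (induction rule: inc_induct)
      case base
      show ?case using gi[OF s(2)] by simp
    next
      case (step n)
      then have "g n divides\<^bsub>R\<^esub> g (n + 1)" "g (n + 1) divides\<^bsub>R\<^esub> g s"
        using chain[of n] by auto
      then show ?case using PM.divides_trans gi[of n] step by auto
    qed
  qed
  obtain \<xi> where \<xi>: "quotient_coordinates R L M {1..s} g \<xi>"
    using PM.quotient_coordinates_exist[OF M(1) g_closed iso] by blast
  \<comment> \<open>The basis of \<open>L\<close> provides torsion freeness, from which the gcd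
    statement follows.\<close>
  obtain e where e: "is_basis R L {1..f} e" using L_free by (auto simp: free_of_rank_def)
  have u_M: "u \<in> {1..f} \<rightarrow> M" using u_basis by (simp add: is_basis_def)
  have "(let P = (\<lambda>r. r \<odot>\<^bsub>L\<^esub> v) ` carrier R <+>\<^bsub>L\<^esub> M;
            u' = u(f + 1 := v);
            a' = a(f + 1 := \<ominus>\<^bsub>R\<^esub> g s)
        in
          (submodule P R L \<and>
           module_isomorphic R (quotient_module (restrict_module L P) M) (cyclic_module R (g s)) \<and>
           module_isomorphic R (quotient_module L P)
             (finite_direct_sum {1..s - 1} (\<lambda>i. cyclic_module R (g i)))) \<and>
          (is_gcd_of_set R \<one>\<^bsub>R\<^esub> (a' ` {1..f + 1}) \<and>
           (\<exists>Q\<in>GL R (f + 1). row_is_e1 R (f + 1) (row_times_matrix R (f + 1) a' Q)) \<and>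
           (\<forall>Q\<in>GL R (f + 1). row_is_e1 R (f + 1) (row_times_matrix R (f + 1) a' Q) \<longrightarrow>
             (let w = matrix_times_column L (f + 1) (inv\<^bsub>matrix_monoid R (f + 1)\<^esub> Q) u'
              in w 1 = \<zero>\<^bsub>L\<^esub> \<and> is_basis R (restrict_module L P) {2..f + 1} w))))"
    if mo: "maximal_order_vector R L M f u (g s) v a" for v a
  proof -
    have v: "v \<in> carrier L" and a: "a \<in> {1..f} \<rightarrow> carrier R"
      and gv: "g s \<odot>\<^bsub>L\<^esub> v = (\<Oplus>\<^bsub>L\<^esub> i\<in>{1..f}. a i \<odot>\<^bsub>L\<^esub> u i)"
      using mo by (auto simp: maximal_order_vector_def)
    note ann = PM.annihilator_of_maximal_order_vector[OF M(1) u_M gi[OF s(2)] mo]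
    interpret V: maximal_order_element R L M f u "g s" v a
    proof (rule maximal_order_element.intro[OF PM.pid_module_axioms])
      show "maximal_order_element_axioms R L M f u (g s) v a"
        using M(1) u_basis v a gi[OF s(2)] gv ann by (rule maximal_order_element_axioms.intro)
    qed
    \<comment> \<open>For s = 1 the remaining index set is empty, and the coordinates obtained then
      say P = L.\<close>
    have set: "insert s {1..s - 1} = {1..s}" using s(1) by auto
    have "\<exists>\<xi>'. quotient_coordinates R L V.P {1..s - 1} g \<xi>'"
    proof (rule PM.split_off_maximal_order_element[where s = s])
      show "g \<in> insert s {1..s - 1} \<rightarrow> carrier R" unfolding set by (rule g_closed)
      show "quotient_coordinates R L M (insert s {1..s - 1}) g \<xi>" unfolding set by (rule \<xi>)
      show "g i divides\<^bsub>R\<^esub> g s" if "i \<in> {1..s - 1}" for i using g_dvd that by auto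
      show "s \<notin> {1..s - 1}" using s(1) by auto
    qed (use M(1) gs0 v ann in simp_all)
    then obtain \<xi>' where "quotient_coordinates R L V.P {1..s - 1} g \<xi>'" by blast
    then have LP: "module_isomorphic R (quotient_module L V.P)
        (finite_direct_sum {1..s - 1} (\<lambda>i. cyclic_module R (g i)))"
      using g_closed by (intro PM.isomorphic_if_quotient_coordinates[OF V.P_submodule]) auto
    have gcd: "is_gcd_of_set R \<one>\<^bsub>R\<^esub> (V.a' ` {1..f + 1})"
      using V.gcd_a'_one[OF gs0] PM.torsion_free_if_basis[OF e] by blast
    \<comment> \<open>The bound \<open>1 \<le> f\<close> enters as 2 \<le> f + 1, the length needed
      to normalize the row.\<close>
    show ?thesis
      unfolding Let_def
      using V.P_submodule PM.span_quotient_isomorphic_cyclic[OF M(1) v gi[OF s(2)] V.ann_iff]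
        LP gcd PM.unimodular_row_to_e1[OF V.a'_closed _ gcd] V.transformed_basis f
      by simp
  qed
  then show ?thesis
    using PM.maximal_order_vector_exists[OF M(1) u_basis s(2) g_closed g_dvd \<xi>] by blast
qed

end
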